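(* Let $K$ be an algebraically closed field of characteristic $0$ and let $\mathcal D$ be a locally bounded $K$-linear category of finite global dimension. Let $V=\bigoplus_{X,Y\in\mathcal D}\mathrm{Hom}_{\mathcal D}(X,Y)$ and let $[V,V]$ be the $K$-subspace of $V$ generated by all $fg-gf$ with $f,g\in V$. If $a\in V$ is nilpotent, then $a\in[V,V]$.
   Context: A $K$-linear category $\mathcal D$ is locally bounded if (a) each object is indecomposable, (b) distinct objects are non-isomorphic, and (c) for each object $X$, $\sum_{Y\in\mathcal D}\big(\dim_K\mathrm{Hom}_{\mathcal D}(X,Y)+\dim_K\mathrm{Hom}_{\mathcal D}(Y,X)\big)<\infty$. $V$ is regarded as an associative (in general non-unital) algebra under composition, the product of non-composable morphisms being $0$; nilpotency is with respect to this product. $\mathrm{mod}\,\mathcal D$ is the category of finitely presented covariant functors $\mathcal D\to\mathrm{mod}\,K$; its projective objects are those in the additive closure of the representable functors $\mathrm{Hom}_{\mathcal D}(X,-)$. For an object $X$, $S_X$ is the representation with $S_X(X)=\mathrm{End}_{\mathcal D}(X)/J$, $J$ the Jacobson radical of $\mathrm{End}_{\mathcal D}(X)$, and $S_X(Y)=0$ for $Y\neq X$. The projective dimension of $S_X$ is the least $n$ for which there is an exact sequence $0\to F_n\to\cdots\to F_0\to S_X\to0$ with all $F_i$ projective in $\mathrm{mod}\,\mathcal D$, and the global dimension of $\mathcal D$ is the supremum of these projective dimensions over all objects $X$. *)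

theory Defs
  imports
    "HOL-Analysis.Infinite_Sum"
    "HOL-Computational_Algebra.Polynomial"
    "HOL-Library.Function_Algebras"
begin

section \<open>Linear categories\<close>

text \<open>
  The morphism spaces of a small linear category are subspaces of one ambient vector space
  \<open>'h\<close>; they are not assumed to be disjoint or independent, so this is no restriction (every
  family of vector spaces embeds into its direct sum). Since they may overlap, composition
  carries the three objects: \<open>Comp D X Y Z g f\<close> is the composite of \<open>f : X \<rightarrow> Y\<close> and
  \<open>g : Y \<rightarrow> Z\<close>, that is, \<open>g \<circ> f\<close>.
\<close>

record ('k, 'o, 'h) lincat =
  Smult :: "'k \<Rightarrow> 'h \<Rightarrow> 'h"
  Obj :: "'o set"
  Hom :: "'o \<Rightarrow> 'o \<Rightarrow> 'h set"
  Idn :: "'o \<Rightarrow> 'h"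
  Comp :: "'o \<Rightarrow> 'o \<Rightarrow> 'o \<Rightarrow> 'h \<Rightarrow> 'h \<Rightarrow> 'h"

locale linear_category = vector_space "Smult D"
  for D :: "('k::field, 'o, 'h::ab_group_add) lincat" +
  assumes subspace_Hom: "\<lbrakk>X \<in> Obj D; Y \<in> Obj D\<rbrakk> \<Longrightarrow> subspace (Hom D X Y)"
    and Idn_in_Hom: "X \<in> Obj D \<Longrightarrow> Idn D X \<in> Hom D X X"
    and Comp_in_Hom: "\<lbrakk>X \<in> Obj D; Y \<in> Obj D; Z \<in> Obj D; f \<in> Hom D X Y; g \<in> Hom D Y Z\<rbrakk>
      \<Longrightarrow> Comp D X Y Z g f \<in> Hom D X Z"
    and Comp_Idn_right: "\<lbrakk>X \<in> Obj D; Y \<in> Obj D; f \<in> Hom D X Y\<rbrakk>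
      \<Longrightarrow> Comp D X X Y f (Idn D X) = f"
    and Comp_Idn_left: "\<lbrakk>X \<in> Obj D; Y \<in> Obj D; f \<in> Hom D X Y\<rbrakk>
      \<Longrightarrow> Comp D X Y Y (Idn D Y) f = f"
    and Comp_assoc: "\<lbrakk>W \<in> Obj D; X \<in> Obj D; Y \<in> Obj D; Z \<in> Obj D;
        f \<in> Hom D W X; g \<in> Hom D X Y; h \<in> Hom D Y Z\<rbrakk>
      \<Longrightarrow> Comp D W Y Z h (Comp D W X Y g f) = Comp D W X Z (Comp D X Y Z h g) f"
    and Comp_add_left: "\<lbrakk>X \<in> Obj D; Y \<in> Obj D; Z \<in> Obj D;
        f \<in> Hom D X Y; g \<in> Hom D Y Z; g' \<in> Hom D Y Z\<rbrakk>
      \<Longrightarrow> Comp D X Y Z (g + g') f = Comp D X Y Z g f + Comp D X Y Z g' f"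
    and Comp_add_right: "\<lbrakk>X \<in> Obj D; Y \<in> Obj D; Z \<in> Obj D;
        f \<in> Hom D X Y; f' \<in> Hom D X Y; g \<in> Hom D Y Z\<rbrakk>
      \<Longrightarrow> Comp D X Y Z g (f + f') = Comp D X Y Z g f + Comp D X Y Z g f'"
    and Comp_scale_left: "\<lbrakk>X \<in> Obj D; Y \<in> Obj D; Z \<in> Obj D; f \<in> Hom D X Y; g \<in> Hom D Y Z\<rbrakk>
      \<Longrightarrow> Comp D X Y Z (Smult D c g) f = Smult D c (Comp D X Y Z g f)"
    and Comp_scale_right: "\<lbrakk>X \<in> Obj D; Y \<in> Obj D; Z \<in> Obj D; f \<in> Hom D X Y; g \<in> Hom D Y Z\<rbrakk>
      \<Longrightarrow> Comp D X Y Z g (Smult D c f) = Smult D c (Comp D X Y Z g f)"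


section \<open>Locally bounded categories\<close>

text \<open>
  A locally bounded category has no direct sums and its idempotents need not split a priori, so
  indecomposability of \<open>X\<close> is understood as usual for such categories, namely with respect to
  decompositions in the idempotent completion (equivalently, of the functor \<open>Hom(X,-)\<close>):
  \<open>X\<close> is nonzero and no idempotent endomorphism splits off a proper nonzero summand.
\<close>

definition indecomposable :: "('k::field, 'o, 'h::ab_group_add) lincat \<Rightarrow> 'o \<Rightarrow> bool" where
  "indecomposable D X \<longleftrightarrow> Idn D X \<noteq> 0 \<and>
     (\<forall>e \<in> Hom D X X. Comp D X X X e e = e \<longrightarrow> e = 0 \<or> e = Idn D X)"

definition isomorphic_obj :: "('k::field, 'o, 'h::ab_group_add) lincat \<Rightarrow> 'o \<Rightarrow> 'o \<Rightarrow> bool" where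
  "isomorphic_obj D X Y \<longleftrightarrow> (\<exists>f \<in> Hom D X Y. \<exists>g \<in> Hom D Y X.
     Comp D X Y X g f = Idn D X \<and> Comp D Y X Y f g = Idn D Y)"

definition finite_dim :: "('k::field \<Rightarrow> 'v::ab_group_add \<Rightarrow> 'v) \<Rightarrow> 'v set \<Rightarrow> bool" where
  "finite_dim s A \<longleftrightarrow> (\<exists>B. finite B \<and> A \<subseteq> module.span s B)"

text \<open>The library's dimension is \<open>0\<close> on spaces of infinite dimension, hence the case split.\<close>

definition edim :: "('k::field \<Rightarrow> 'v::ab_group_add \<Rightarrow> 'v) \<Rightarrow> 'v set \<Rightarrow> enat" where
  "edim s A = (if finite_dim s A then enat (vector_space.dim s A) else \<infinity>)"

definition locally_bounded :: "('k::field, 'o, 'h::ab_group_add) lincat \<Rightarrow> bool" where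
  "locally_bounded D \<longleftrightarrow>
     (\<forall>X \<in> Obj D. indecomposable D X) \<and>
     (\<forall>X \<in> Obj D. \<forall>Y \<in> Obj D. X \<noteq> Y \<longrightarrow> \<not> isomorphic_obj D X Y) \<and>
     (\<forall>X \<in> Obj D. infsum (\<lambda>Y. edim (Smult D) (Hom D X Y) + edim (Smult D) (Hom D Y X)) (Obj D) < \<infinity>)"


section \<open>The associative algebra of all morphisms\<close>

text \<open>
  An element of \<open>V\<close> is its family of components \<open>v X Y \<in> Hom(X,Y)\<close>, extended by \<open>0\<close> outside
  the objects of \<open>D\<close>.
\<close>

definition morphism_algebra ::
    "('k::field, 'o, 'h::ab_group_add) lincat \<Rightarrow> ('o \<Rightarrow> 'o \<Rightarrow> 'h) set" where
  "morphism_algebra D = {v.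
     (\<forall>X \<in> Obj D. \<forall>Y \<in> Obj D. v X Y \<in> Hom D X Y) \<and>
     (\<forall>X Y. X \<notin> Obj D \<or> Y \<notin> Obj D \<longrightarrow> v X Y = 0) \<and>
     finite {(X, Y). v X Y \<noteq> 0}}"

text \<open>
  The product \<open>v w\<close> is ``\<open>v\<close> after \<open>w\<close>''. The sum is restricted to the objects that contribute,
  since \<open>Obj D\<close> may be infinite.
\<close>

definition morphism_mult :: "('k::field, 'o, 'h::ab_group_add) lincat \<Rightarrow>
    ('o \<Rightarrow> 'o \<Rightarrow> 'h) \<Rightarrow> ('o \<Rightarrow> 'o \<Rightarrow> 'h) \<Rightarrow> ('o \<Rightarrow> 'o \<Rightarrow> 'h)" where
  "morphism_mult D v w = (\<lambda>X Z.
     \<Sum>Y \<in> {Y \<in> Obj D. w X Y \<noteq> 0 \<and> v Y Z \<noteq> 0}. Comp D X Y Z (v Y Z) (w X Y))"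

definition morphism_scale :: "('k::field, 'o, 'h::ab_group_add) lincat \<Rightarrow>
    'k \<Rightarrow> ('o \<Rightarrow> 'o \<Rightarrow> 'h) \<Rightarrow> ('o \<Rightarrow> 'o \<Rightarrow> 'h)" where
  "morphism_scale D c v = (\<lambda>X Y. Smult D c (v X Y))"

text \<open>As \<open>V\<close> need not have a unit, powers start at \<open>1\<close>: the term below is \<open>a\<close> to the \<open>n + 1\<close>.\<close>

definition nilpotent_morphism ::
    "('k::field, 'o, 'h::ab_group_add) lincat \<Rightarrow> ('o \<Rightarrow> 'o \<Rightarrow> 'h) \<Rightarrow> bool" where
  "nilpotent_morphism D a \<longleftrightarrow> (\<exists>n. (morphism_mult D a ^^ n) a = 0)"

definition commutator_space ::
    "('k::field, 'o, 'h::ab_group_add) lincat \<Rightarrow> ('o \<Rightarrow> 'o \<Rightarrow> 'h) set" where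
  "commutator_space D = module.span (morphism_scale D)
     {morphism_mult D f g - morphism_mult D g f | f g.
        f \<in> morphism_algebra D \<and> g \<in> morphism_algebra D}"


section \<open>Representations\<close>

text \<open>
  The values of representations are finite-dimensional subspaces of \<open>nat \<Rightarrow> 'h\<close> (with pointwise
  operations). This ambient space literally contains the values of all finite direct sums of
  representable functors \<open>Hom(X,-)\<close>, hence, up to isomorphism, also those of all quotients of
  such sums, so every finitely presented functor is isomorphic to one of this form.
\<close>

definition vscale :: "('k::field, 'o, 'h::ab_group_add) lincat \<Rightarrow> 'k \<Rightarrow> (nat \<Rightarrow> 'h) \<Rightarrow> (nat \<Rightarrow> 'h)"
  where "vscale D c v = (\<lambda>i. Smult D c (v i))"

definition linear_map_on :: "('k::field \<Rightarrow> 'a::ab_group_add \<Rightarrow> 'a) \<Rightarrow> 'a set \<Rightarrow>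
    ('k \<Rightarrow> 'b::ab_group_add \<Rightarrow> 'b) \<Rightarrow> 'b set \<Rightarrow> ('a \<Rightarrow> 'b) \<Rightarrow> bool" where
  "linear_map_on s A t B f \<longleftrightarrow>
     (\<forall>x \<in> A. f x \<in> B) \<and>
     (\<forall>x \<in> A. \<forall>y \<in> A. f (x + y) = f x + f y) \<and>
     (\<forall>c. \<forall>x \<in> A. f (s c x) = t c (f x))"

record ('o, 'h) rep =
  Val :: "'o \<Rightarrow> (nat \<Rightarrow> 'h) set"
  Act :: "'o \<Rightarrow> 'o \<Rightarrow> 'h \<Rightarrow> (nat \<Rightarrow> 'h) \<Rightarrow> (nat \<Rightarrow> 'h)"

text \<open>Covariant linear functors to finite-dimensional vector spaces:\<close>

definition is_representation ::
    "('k::field, 'o, 'h::ab_group_add) lincat \<Rightarrow> ('o, 'h) rep \<Rightarrow> bool" where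
  "is_representation D M \<longleftrightarrow>
     (\<forall>X \<in> Obj D. module.subspace (vscale D) (Val M X) \<and> finite_dim (vscale D) (Val M X)) \<and>
     (\<forall>X \<in> Obj D. \<forall>Y \<in> Obj D. \<forall>f \<in> Hom D X Y.
        linear_map_on (vscale D) (Val M X) (vscale D) (Val M Y) (Act M X Y f)) \<and>
     (\<forall>X \<in> Obj D. \<forall>Y \<in> Obj D. \<forall>m \<in> Val M X.
        linear_map_on (Smult D) (Hom D X Y) (vscale D) (Val M Y) (\<lambda>f. Act M X Y f m)) \<and>
     (\<forall>X \<in> Obj D. \<forall>m \<in> Val M X. Act M X X (Idn D X) m = m) \<and>
     (\<forall>X \<in> Obj D. \<forall>Y \<in> Obj D. \<forall>Z \<in> Obj D. \<forall>f \<in> Hom D X Y. \<forall>g \<in> Hom D Y Z. \<forall>m \<in> Val M X.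
        Act M X Z (Comp D X Y Z g f) m = Act M Y Z g (Act M X Y f m))"

definition rep_hom :: "('k::field, 'o, 'h::ab_group_add) lincat \<Rightarrow> ('o, 'h) rep \<Rightarrow> ('o, 'h) rep \<Rightarrow>
    ('o \<Rightarrow> (nat \<Rightarrow> 'h) \<Rightarrow> (nat \<Rightarrow> 'h)) \<Rightarrow> bool" where
  "rep_hom D M N \<phi> \<longleftrightarrow>
     (\<forall>X \<in> Obj D. linear_map_on (vscale D) (Val M X) (vscale D) (Val N X) (\<phi> X)) \<and>
     (\<forall>X \<in> Obj D. \<forall>Y \<in> Obj D. \<forall>f \<in> Hom D X Y. \<forall>m \<in> Val M X.
        \<phi> Y (Act M X Y f m) = Act N X Y f (\<phi> X m))"

text \<open>The direct sum of the representable functors \<open>Hom(X\<^sub>i,-)\<close> for \<open>Xs = [X\<^sub>0, X\<^sub>1, \<dots>]\<close>:\<close>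

definition representable_sum ::
    "('k::field, 'o, 'h::ab_group_add) lincat \<Rightarrow> 'o list \<Rightarrow> ('o, 'h) rep" where
  "representable_sum D Xs = \<lparr>
     Val = (\<lambda>Y. {v. (\<forall>i < length Xs. v i \<in> Hom D (Xs ! i) Y) \<and> (\<forall>i \<ge> length Xs. v i = 0)}),
     Act = (\<lambda>Y Z f v i. if i < length Xs then Comp D (Xs ! i) Y Z f (v i) else 0)\<rparr>"

definition finitely_presented ::
    "('k::field, 'o, 'h::ab_group_add) lincat \<Rightarrow> ('o, 'h) rep \<Rightarrow> bool" where
  "finitely_presented D M \<longleftrightarrow> (\<exists>Xs Ys \<phi> \<psi>. set Xs \<subseteq> Obj D \<and> set Ys \<subseteq> Obj D \<and>
     rep_hom D (representable_sum D Ys) (representable_sum D Xs) \<phi> \<and>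
     rep_hom D (representable_sum D Xs) M \<psi> \<and>
     (\<forall>Y \<in> Obj D.
        \<phi> Y ` Val (representable_sum D Ys) Y = {v \<in> Val (representable_sum D Xs) Y. \<psi> Y v = 0} \<and>
        \<psi> Y ` Val (representable_sum D Xs) Y = Val M Y))"

definition is_direct_sum :: "('k::field, 'o, 'h::ab_group_add) lincat \<Rightarrow>
    ('o, 'h) rep \<Rightarrow> ('o, 'h) rep \<Rightarrow> ('o, 'h) rep \<Rightarrow> bool" where
  "is_direct_sum D F P Q \<longleftrightarrow> (\<exists>\<iota> \<pi> \<iota>' \<pi>'.
     rep_hom D P F \<iota> \<and> rep_hom D F P \<pi> \<and> rep_hom D Q F \<iota>' \<and> rep_hom D F Q \<pi>' \<and>
     (\<forall>X \<in> Obj D.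
        (\<forall>p \<in> Val P X. \<pi> X (\<iota> X p) = p \<and> \<pi>' X (\<iota> X p) = 0) \<and>
        (\<forall>q \<in> Val Q X. \<pi>' X (\<iota>' X q) = q \<and> \<pi> X (\<iota>' X q) = 0) \<and>
        (\<forall>v \<in> Val F X. \<iota> X (\<pi> X v) + \<iota>' X (\<pi>' X v) = v)))"

text \<open>
  The projective objects of \<open>mod D\<close>: the additive closure of the representable functors, i.e. all
  direct summands of finite direct sums of them.
\<close>

definition projective_rep ::
    "('k::field, 'o, 'h::ab_group_add) lincat \<Rightarrow> ('o, 'h) rep \<Rightarrow> bool" where
  "projective_rep D P \<longleftrightarrow> is_representation D P \<and> finitely_presented D P \<and>
     (\<exists>Xs Q. set Xs \<subseteq> Obj D \<and> is_representation D Q \<and> is_direct_sum D (representable_sum D Xs) P Q)"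


section \<open>The representations S(X) and global dimension\<close>

definition left_ideal_End ::
    "('k::field, 'o, 'h::ab_group_add) lincat \<Rightarrow> 'o \<Rightarrow> 'h set \<Rightarrow> bool" where
  "left_ideal_End D X I \<longleftrightarrow> I \<subseteq> Hom D X X \<and> 0 \<in> I \<and>
     (\<forall>f \<in> I. \<forall>g \<in> I. f - g \<in> I) \<and>
     (\<forall>h \<in> Hom D X X. \<forall>f \<in> I. Comp D X X X h f \<in> I)"

definition maximal_left_ideal_End ::
    "('k::field, 'o, 'h::ab_group_add) lincat \<Rightarrow> 'o \<Rightarrow> 'h set \<Rightarrow> bool" where
  "maximal_left_ideal_End D X I \<longleftrightarrow> left_ideal_End D X I \<and> I \<noteq> Hom D X X \<and>
     (\<forall>I'. left_ideal_End D X I' \<and> I \<subseteq> I' \<longrightarrow> I' = I \<or> I' = Hom D X X)"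

definition jacobson_radical_End ::
    "('k::field, 'o, 'h::ab_group_add) lincat \<Rightarrow> 'o \<Rightarrow> 'h set" where
  "jacobson_radical_End D X = {f \<in> Hom D X X. \<forall>I. maximal_left_ideal_End D X I \<longrightarrow> f \<in> I}"

text \<open>
  \<open>S\<close> is (a copy of) \<open>S\<^sub>X\<close>: the map \<open>p\<close> below is the quotient map \<open>End(X) \<rightarrow> End(X)/J = S(X)\<close>,
  and \<open>End(X)\<close> acts on the quotient by left multiplication.
\<close>

definition is_S :: "('k::field, 'o, 'h::ab_group_add) lincat \<Rightarrow> 'o \<Rightarrow> ('o, 'h) rep \<Rightarrow> bool" where
  "is_S D X S \<longleftrightarrow> is_representation D S \<and>
     (\<exists>p. linear_map_on (Smult D) (Hom D X X) (vscale D) (Val S X) p \<and>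
          p ` Hom D X X = Val S X \<and>
          {f \<in> Hom D X X. p f = 0} = jacobson_radical_End D X \<and>
          (\<forall>f \<in> Hom D X X. \<forall>g \<in> Hom D X X. Act S X X f (p g) = p (Comp D X X X f g))) \<and>
     (\<forall>Y \<in> Obj D. Y \<noteq> X \<longrightarrow> Val S Y = {0})"

text \<open>
  \<open>d 0\<close> is the augmentation \<open>F\<^sub>0 \<rightarrow> M\<close> and \<open>d (i + 1)\<close> the differential \<open>F\<^sub>i\<^sub>+\<^sub>1 \<rightarrow> F\<^sub>i\<close>. Only
  \<open>F 0, \<dots>, F n\<close> and \<open>d 0, \<dots>, d n\<close> are relevant.
\<close>

definition projective_resolution :: "('k::field, 'o, 'h::ab_group_add) lincat \<Rightarrow> nat \<Rightarrow>
    ('o, 'h) rep \<Rightarrow> (nat \<Rightarrow> ('o, 'h) rep) \<Rightarrow> (nat \<Rightarrow> 'o \<Rightarrow> (nat \<Rightarrow> 'h) \<Rightarrow> (nat \<Rightarrow> 'h)) \<Rightarrow> bool" where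
  "projective_resolution D n M F d \<longleftrightarrow>
     (\<forall>i \<le> n. projective_rep D (F i)) \<and>
     rep_hom D (F 0) M (d 0) \<and>
     (\<forall>i < n. rep_hom D (F (Suc i)) (F i) (d (Suc i))) \<and>
     (\<forall>Y \<in> Obj D.
        d 0 Y ` Val (F 0) Y = Val M Y \<and>
        (\<forall>i < n. d (Suc i) Y ` Val (F (Suc i)) Y = {v \<in> Val (F i) Y. d i Y v = 0}) \<and>
        {v \<in> Val (F n) Y. d n Y v = 0} = {0})"

definition pd_S :: "('k::field, 'o, 'h::ab_group_add) lincat \<Rightarrow> 'o \<Rightarrow> enat" where
  "pd_S D X = Inf {enat n | n. \<exists>S F d. is_S D X S \<and> projective_resolution D n S F d}"

definition global_dimension :: "('k::field, 'o, 'h::ab_group_add) lincat \<Rightarrow> enat" where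
  "global_dimension D = (SUP X \<in> Obj D. pd_S D X)"

end

theory Submission
  imports Defs
begin

text \<open>
  This is Lenzing's argument with Hattori-Stallings traces. A linear functional on \<open>V\<close> that vanishes
  on \<open>[V,V]\<close> gives functions \<open>\<theta>\<^sub>X\<close> on \<open>End(X)\<close> with \<open>\<theta>\<^sub>X(g f) = \<theta>\<^sub>Y(f g)\<close>, hence a trace for
  endomorphisms of projectives and, by alternating sums over finite projective resolutions, for
  endomorphisms of modules that have such a resolution. By the horseshoe lemma this trace is additive
  on short exact sequences compatible with the endomorphisms; on a projective it is the original one,
  because resolutions of projectives split. If \<open>\<phi>\<close> is a nilpotent endomorphism of a module of finite
  length, there is a \<open>\<phi>\<close>-stable composition series on whose factors \<open>S\<^sub>Y\<close> it acts as zero, and these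
  factors have finite projective dimension; so its trace vanishes. Apply this to precomposition with
  \<open>a\<close> on the direct sum of the representable functors at the objects in the support of \<open>a\<close>: the trace
  is the value of the functional on the diagonal part of \<open>a\<close>, while the off-diagonal components of \<open>a\<close>
  are commutators with identities.
\<close>

section \<open>Homomorphisms of representations\<close>

text \<open>Values of representations are subspaces of one fixed ambient space, where kernels exist
  literally but quotients do not. Hence submodules and syzygies are kept as subspaces with the
  identity as inclusion, and a quotient is only ever reached through a map onto a module that is
  already given. The finite projective dimension of S_Y supplies such a module together with its
  resolution, so the simple factor has to be matched with that copy. Algebraic closedness makes this
  possible: it forces End(Y)/J = K, and a simple factor at Y is a line on which the radical acts by
  zero.

  The Hattori-Stallings trace is kept as a relation between an endomorphism and a scalar, since a
  trace depends a priori on the resolution and on the lift. Independence of these choices is proved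
  for projective modules only. That suffices: 0 is one possible trace of precomposition with
  \<open>a\<close> on a free module, obtained along the composition series, and on a free module the
  possible trace is unique.\<close>

sublocale linear_category \<subseteq> vs: vector_space "vscale D"
  by unfold_locales (auto simp: vscale_def fun_eq_iff scale_right_distrib scale_left_distrib)

context linear_category
begin

lemma zero_in_Hom: "\<lbrakk>X \<in> Obj D; Y \<in> Obj D\<rbrakk> \<Longrightarrow> 0 \<in> Hom D X Y"
  by (simp add: subspace_Hom subspace_0)

lemma add_in_Hom:
  "\<lbrakk>X \<in> Obj D; Y \<in> Obj D; f \<in> Hom D X Y; g \<in> Hom D X Y\<rbrakk> \<Longrightarrow> f + g \<in> Hom D X Y"
  by (simp add: subspace_Hom subspace_add)

lemma diff_in_Hom:
  "\<lbrakk>X \<in> Obj D; Y \<in> Obj D; f \<in> Hom D X Y; g \<in> Hom D X Y\<rbrakk> \<Longrightarrow> f - g \<in> Hom D X Y"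
  by (simp add: subspace_Hom subspace_diff)

lemma scale_in_Hom:
  "\<lbrakk>X \<in> Obj D; Y \<in> Obj D; f \<in> Hom D X Y\<rbrakk> \<Longrightarrow> Smult D c f \<in> Hom D X Y"
  by (simp add: subspace_Hom subspace_scale)

lemma sum_in_Hom:
  "\<lbrakk>X \<in> Obj D; Y \<in> Obj D; \<And>i. i \<in> I \<Longrightarrow> f i \<in> Hom D X Y\<rbrakk> \<Longrightarrow> sum f I \<in> Hom D X Y"
  by (simp add: subspace_Hom subspace_sum)

lemma Comp_zero_left:
  "\<lbrakk>X \<in> Obj D; Y \<in> Obj D; Z \<in> Obj D; f \<in> Hom D X Y\<rbrakk> \<Longrightarrow> Comp D X Y Z 0 f = 0"
  using Comp_add_left[of X Y Z f 0 0] zero_in_Hom by simp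

lemma Comp_zero_right:
  "\<lbrakk>X \<in> Obj D; Y \<in> Obj D; Z \<in> Obj D; g \<in> Hom D Y Z\<rbrakk> \<Longrightarrow> Comp D X Y Z g 0 = 0"
  using Comp_add_right[of X Y Z 0 0 g] zero_in_Hom by simp

lemma Comp_diff_left:
  "\<lbrakk>X \<in> Obj D; Y \<in> Obj D; Z \<in> Obj D; f \<in> Hom D X Y; g \<in> Hom D Y Z; g' \<in> Hom D Y Z\<rbrakk>
    \<Longrightarrow> Comp D X Y Z (g - g') f = Comp D X Y Z g f - Comp D X Y Z g' f"
  using Comp_add_left[of X Y Z f "g - g'" g'] diff_in_Hom[of Y Z g g'] by simp

lemma Comp_diff_right:
  "\<lbrakk>X \<in> Obj D; Y \<in> Obj D; Z \<in> Obj D; f \<in> Hom D X Y; f' \<in> Hom D X Y; g \<in> Hom D Y Z\<rbrakk>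
    \<Longrightarrow> Comp D X Y Z g (f - f') = Comp D X Y Z g f - Comp D X Y Z g f'"
  using Comp_add_right[of X Y Z "f - f'" f' g] diff_in_Hom[of X Y f f'] by simp

lemma Comp_sum_left:
  assumes "X \<in> Obj D" "Y \<in> Obj D" "Z \<in> Obj D" "f \<in> Hom D X Y"
    and "\<And>i. i \<in> I \<Longrightarrow> g i \<in> Hom D Y Z"
  shows "Comp D X Y Z (sum g I) f = (\<Sum>i\<in>I. Comp D X Y Z (g i) f)"
  using assms(5)
  by (induction I rule: infinite_finite_induct)
    (auto simp: Comp_zero_left Comp_add_left sum_in_Hom assms(1-4))

lemma Comp_sum_right:
  assumes "X \<in> Obj D" "Y \<in> Obj D" "Z \<in> Obj D" "g \<in> Hom D Y Z"
    and "\<And>i. i \<in> I \<Longrightarrow> f i \<in> Hom D X Y"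
  shows "Comp D X Y Z g (sum f I) = (\<Sum>i\<in>I. Comp D X Y Z g (f i))"
  using assms(5)
  by (induction I rule: infinite_finite_induct)
    (auto simp: Comp_zero_right Comp_add_right sum_in_Hom assms(1-4))

lemma rep_homI:
  assumes "\<And>X v. \<lbrakk>X \<in> Obj D; v \<in> Val M X\<rbrakk> \<Longrightarrow> \<phi> X v \<in> Val N X"
    and "\<And>X v w. \<lbrakk>X \<in> Obj D; v \<in> Val M X; w \<in> Val M X\<rbrakk> \<Longrightarrow> \<phi> X (v + w) = \<phi> X v + \<phi> X w"
    and "\<And>X c v. \<lbrakk>X \<in> Obj D; v \<in> Val M X\<rbrakk> \<Longrightarrow> \<phi> X (vscale D c v) = vscale D c (\<phi> X v)"
    and "\<And>X Y f v. \<lbrakk>X \<in> Obj D; Y \<in> Obj D; f \<in> Hom D X Y; v \<in> Val M X\<rbrakk>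
           \<Longrightarrow> \<phi> Y (Act M X Y f v) = Act N X Y f (\<phi> X v)"
  shows "rep_hom D M N \<phi>"
  using assms by (simp add: rep_hom_def linear_map_on_def)

lemma
  assumes "rep_hom D M N \<phi>" "X \<in> Obj D"
  shows rep_hom_in: "v \<in> Val M X \<Longrightarrow> \<phi> X v \<in> Val N X"
    and rep_hom_add: "\<lbrakk>v \<in> Val M X; w \<in> Val M X\<rbrakk> \<Longrightarrow> \<phi> X (v + w) = \<phi> X v + \<phi> X w"
    and rep_hom_scale: "v \<in> Val M X \<Longrightarrow> \<phi> X (vscale D c v) = vscale D c (\<phi> X v)"
    and rep_hom_nat: "\<lbrakk>Y \<in> Obj D; f \<in> Hom D X Y; v \<in> Val M X\<rbrakk>
      \<Longrightarrow> \<phi> Y (Act M X Y f v) = Act N X Y f (\<phi> X v)"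
  using assms by (auto simp: rep_hom_def linear_map_on_def)

lemma
  assumes "is_representation D M" "X \<in> Obj D"
  shows rep_subspace: "vs.subspace (Val M X)"
    and rep_zero: "0 \<in> Val M X"
    and rep_add: "\<lbrakk>v \<in> Val M X; w \<in> Val M X\<rbrakk> \<Longrightarrow> v + w \<in> Val M X"
    and rep_diff: "\<lbrakk>v \<in> Val M X; w \<in> Val M X\<rbrakk> \<Longrightarrow> v - w \<in> Val M X"
    and rep_scale: "v \<in> Val M X \<Longrightarrow> vscale D c v \<in> Val M X"
    and rep_sum: "(\<And>i. i \<in> I \<Longrightarrow> g i \<in> Val M X) \<Longrightarrow> sum g I \<in> Val M X"
    and rep_finite_dim: "finite_dim (vscale D) (Val M X)"
proof -
  show s: "vs.subspace (Val M X)" and "finite_dim (vscale D) (Val M X)"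
    using assms by (auto simp: is_representation_def)
  show "0 \<in> Val M X"
    "\<lbrakk>v \<in> Val M X; w \<in> Val M X\<rbrakk> \<Longrightarrow> v + w \<in> Val M X"
    "\<lbrakk>v \<in> Val M X; w \<in> Val M X\<rbrakk> \<Longrightarrow> v - w \<in> Val M X"
    "v \<in> Val M X \<Longrightarrow> vscale D c v \<in> Val M X"
    "(\<And>i. i \<in> I \<Longrightarrow> g i \<in> Val M X) \<Longrightarrow> sum g I \<in> Val M X"
    using s vs.subspace_0 vs.subspace_add vs.subspace_diff vs.subspace_scale vs.subspace_sum
    by blast+
qed

lemma
  assumes "is_representation D M" "X \<in> Obj D" "Y \<in> Obj D"
  shows Act_in: "\<lbrakk>f \<in> Hom D X Y; v \<in> Val M X\<rbrakk> \<Longrightarrow> Act M X Y f v \<in> Val M Y"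
    and Act_add: "\<lbrakk>f \<in> Hom D X Y; v \<in> Val M X; w \<in> Val M X\<rbrakk>
      \<Longrightarrow> Act M X Y f (v + w) = Act M X Y f v + Act M X Y f w"
    and Act_scale: "\<lbrakk>f \<in> Hom D X Y; v \<in> Val M X\<rbrakk>
      \<Longrightarrow> Act M X Y f (vscale D c v) = vscale D c (Act M X Y f v)"
    and Act_add_Hom: "\<lbrakk>f \<in> Hom D X Y; g \<in> Hom D X Y; v \<in> Val M X\<rbrakk>
      \<Longrightarrow> Act M X Y (f + g) v = Act M X Y f v + Act M X Y g v"
    and Act_scale_Hom: "\<lbrakk>f \<in> Hom D X Y; v \<in> Val M X\<rbrakk>
      \<Longrightarrow> Act M X Y (Smult D c f) v = vscale D c (Act M X Y f v)"
  using assms by (auto simp: is_representation_def linear_map_on_def)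

lemma Act_Idn:
  "\<lbrakk>is_representation D M; X \<in> Obj D; v \<in> Val M X\<rbrakk> \<Longrightarrow> Act M X X (Idn D X) v = v"
  by (auto simp: is_representation_def)

lemma Act_Comp:
  "\<lbrakk>is_representation D M; X \<in> Obj D; Y \<in> Obj D; Z \<in> Obj D; f \<in> Hom D X Y; g \<in> Hom D Y Z;
    v \<in> Val M X\<rbrakk> \<Longrightarrow> Act M X Z (Comp D X Y Z g f) v = Act M Y Z g (Act M X Y f v)"
  unfolding is_representation_def by blast

lemma Act_zero:
  assumes "is_representation D M" "X \<in> Obj D" "Y \<in> Obj D" "f \<in> Hom D X Y"
  shows "Act M X Y f 0 = 0"
  using Act_add[OF assms(1-4), of 0 0] rep_zero assms by simp

lemma Act_diff:
  assumes "is_representation D M" "X \<in> Obj D" "Y \<in> Obj D" "f \<in> Hom D X Y"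
    "v \<in> Val M X" "w \<in> Val M X"
  shows "Act M X Y f (v - w) = Act M X Y f v - Act M X Y f w"
  using Act_add[OF assms(1-4), of "v - w" w] rep_diff assms by simp

lemma Act_zero_Hom:
  assumes "is_representation D M" "X \<in> Obj D" "Y \<in> Obj D" "v \<in> Val M X"
  shows "Act M X Y 0 v = 0"
  using Act_add_Hom[OF assms(1-3), of 0 0] zero_in_Hom assms by simp

lemma rep_hom_zero:
  assumes "rep_hom D M N \<phi>" "X \<in> Obj D" "is_representation D M"
  shows "\<phi> X 0 = 0"
  using rep_hom_add[OF assms(1,2), of 0 0] rep_zero assms by simp

lemma rep_hom_diff:
  assumes "rep_hom D M N \<phi>" "X \<in> Obj D" "is_representation D M" "v \<in> Val M X" "w \<in> Val M X"
  shows "\<phi> X (v - w) = \<phi> X v - \<phi> X w"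
  using rep_hom_add[OF assms(1,2), of "v - w" w] rep_diff assms by simp

lemma rep_hom_sum:
  assumes "rep_hom D M N \<phi>" "X \<in> Obj D" "is_representation D M"
    and "\<And>i. i \<in> I \<Longrightarrow> g i \<in> Val M X"
  shows "\<phi> X (sum g I) = (\<Sum>i\<in>I. \<phi> X (g i))"
  using assms(4)
  by (induction I rule: infinite_finite_induct)
    (auto simp: rep_hom_zero[OF assms(1-3)] rep_hom_add[OF assms(1,2)] rep_sum[OF assms(3,2)])

lemma rep_hom_compose:
  assumes "rep_hom D M N \<phi>" "rep_hom D N P \<psi>"
  shows "rep_hom D M P (\<lambda>X v. \<psi> X (\<phi> X v))"
  by (rule rep_homI) (auto simp: rep_hom_in[OF assms(1)] rep_hom_in[OF assms(2)]
    rep_hom_add[OF assms(1)] rep_hom_add[OF assms(2)]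
    rep_hom_scale[OF assms(1)] rep_hom_scale[OF assms(2)]
    rep_hom_nat[OF assms(1)] rep_hom_nat[OF assms(2)])

lemma rep_hom_plus:
  assumes "rep_hom D M N \<phi>" "rep_hom D M N \<psi>" "is_representation D N"
  shows "rep_hom D M N (\<lambda>X v. \<phi> X v + \<psi> X v)"
  by (rule rep_homI) (auto simp: rep_hom_in[OF assms(1)] rep_hom_in[OF assms(2)]
    rep_add[OF assms(3)] Act_add[OF assms(3)] vs.scale_right_distrib
    rep_hom_add[OF assms(1)] rep_hom_add[OF assms(2)]
    rep_hom_scale[OF assms(1)] rep_hom_scale[OF assms(2)]
    rep_hom_nat[OF assms(1)] rep_hom_nat[OF assms(2)])

lemma rep_hom_minus:
  assumes "rep_hom D M N \<phi>" "rep_hom D M N \<psi>" "is_representation D N"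
  shows "rep_hom D M N (\<lambda>X v. \<phi> X v - \<psi> X v)"
  by (rule rep_homI) (auto simp: rep_hom_in[OF assms(1)] rep_hom_in[OF assms(2)]
    rep_diff[OF assms(3)] Act_diff[OF assms(3)] vs.scale_right_diff_distrib
    rep_hom_add[OF assms(1)] rep_hom_add[OF assms(2)]
    rep_hom_scale[OF assms(1)] rep_hom_scale[OF assms(2)]
    rep_hom_nat[OF assms(1)] rep_hom_nat[OF assms(2)])

lemma rep_hom_id: "rep_hom D M M (\<lambda>X v. v)"
  by (rule rep_homI) auto

lemma rep_hom_const_zero:
  assumes "is_representation D N"
  shows "rep_hom D M N (\<lambda>X v. 0)"
  by (rule rep_homI) (auto simp: rep_zero[OF assms] Act_zero[OF assms])

section \<open>Subrepresentations and kernels\<close>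

definition subrep :: "('o, 'h) rep \<Rightarrow> ('o \<Rightarrow> (nat \<Rightarrow> 'h) set) \<Rightarrow> bool" where
  "subrep M W \<longleftrightarrow> (\<forall>X \<in> Obj D. vs.subspace (W X) \<and> W X \<subseteq> Val M X) \<and>
     (\<forall>X \<in> Obj D. \<forall>Y \<in> Obj D. \<forall>f \<in> Hom D X Y. \<forall>v \<in> W X. Act M X Y f v \<in> W Y)"

lemma is_representation_subrep:
  assumes "is_representation D M" "subrep M W"
  shows "is_representation D (M\<lparr>Val := W\<rparr>)"
proof -
  have sub: "\<And>X v. X \<in> Obj D \<Longrightarrow> v \<in> W X \<Longrightarrow> v \<in> Val M X"
    and act: "\<And>X Y f v. \<lbrakk>X \<in> Obj D; Y \<in> Obj D; f \<in> Hom D X Y; v \<in> W X\<rbrakk> \<Longrightarrow> Act M X Y f v \<in> W Y"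
    and ss: "\<And>X. X \<in> Obj D \<Longrightarrow> vs.subspace (W X)"
    using assms(2) unfolding subrep_def by blast+
  have "finite_dim (vscale D) (W X)" if "X \<in> Obj D" for X
    using rep_finite_dim[OF assms(1) that] sub[OF that] unfolding finite_dim_def by blast
  then show ?thesis
    unfolding is_representation_def linear_map_on_def
    by (simp add: ss act Act_add[OF assms(1)] Act_scale[OF assms(1)] Act_add_Hom[OF assms(1)]
        Act_scale_Hom[OF assms(1)] Act_Idn[OF assms(1)] Act_Comp[OF assms(1)] sub)
qed

text \<open>The action is inherited unchanged from \<open>M\<close>, so inclusions between kernels
  are the identity on elements and a homomorphism restricts to a kernel without changing its
  term.\<close>

definition kernel :: "('o, 'h) rep \<Rightarrow> ('o \<Rightarrow> (nat \<Rightarrow> 'h) \<Rightarrow> (nat \<Rightarrow> 'h)) \<Rightarrow> ('o, 'h) rep" where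
  "kernel M \<phi> = M\<lparr>Val := \<lambda>X. {v \<in> Val M X. \<phi> X v = 0}\<rparr>"

lemma Val_kernel: "Val (kernel M \<phi>) X = {v \<in> Val M X. \<phi> X v = 0}"
  by (simp add: kernel_def)

lemma is_representation_kernel:
  assumes "is_representation D M" "is_representation D N" "rep_hom D M N \<phi>"
  shows "is_representation D (kernel M \<phi>)"
  unfolding kernel_def
  by (rule is_representation_subrep[OF assms(1)])
    (auto simp: subrep_def vs.subspace_def rep_zero[OF assms(1)] rep_add[OF assms(1)]
      rep_scale[OF assms(1)] rep_hom_add[OF assms(3)] rep_hom_scale[OF assms(3)]
      rep_hom_zero[OF assms(3) _ assms(1)] Act_in[OF assms(1)] rep_hom_nat[OF assms(3)]
      Act_zero[OF assms(2)])

lemma rep_hom_from_subrep: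
  assumes "rep_hom D M N \<phi>" "\<And>X. X \<in> Obj D \<Longrightarrow> W X \<subseteq> Val M X"
  shows "rep_hom D (M\<lparr>Val := W\<rparr>) N \<phi>"
  using assms(2) by (intro rep_homI)
    (auto simp: rep_hom_in[OF assms(1)] rep_hom_add[OF assms(1)] rep_hom_scale[OF assms(1)]
      rep_hom_nat[OF assms(1)] subset_eq)

lemma rep_hom_to_subrep:
  assumes "rep_hom D M N \<phi>" "\<And>X v. \<lbrakk>X \<in> Obj D; v \<in> Val M X\<rbrakk> \<Longrightarrow> \<phi> X v \<in> W X"
  shows "rep_hom D M (N\<lparr>Val := W\<rparr>) \<phi>"
  using assms by (auto simp: rep_hom_def linear_map_on_def)

lemma rep_hom_from_kernel:
  "rep_hom D M N \<phi> \<Longrightarrow> rep_hom D (kernel M \<psi>) N \<phi>"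
  unfolding kernel_def by (rule rep_hom_from_subrep) auto

lemma rep_hom_to_kernel:
  assumes "rep_hom D M N \<phi>" "\<And>X v. \<lbrakk>X \<in> Obj D; v \<in> Val M X\<rbrakk> \<Longrightarrow> \<psi> X (\<phi> X v) = 0"
  shows "rep_hom D M (kernel N \<psi>) \<phi>"
  unfolding kernel_def
  by (rule rep_hom_to_subrep) (use assms in \<open>auto intro: rep_hom_in\<close>)

end

section \<open>Sums of representable functors\<close>

lemma (in linear_category) Act_sum:
  assumes "is_representation D M" "X \<in> Obj D" "Y \<in> Obj D" "f \<in> Hom D X Y"
    and "\<And>i. i \<in> I \<Longrightarrow> g i \<in> Val M X"
  shows "Act M X Y f (sum g I) = (\<Sum>i\<in>I. Act M X Y f (g i))"
  using assms(5)
  by (induction I rule: infinite_finite_induct)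
    (auto simp: Act_zero[OF assms(1-4)] Act_add[OF assms(1-4)] rep_sum[OF assms(1,2)])

text \<open>Finiteness of the Hom spaces makes sums of representable functors take
  finite-dimensional values, as \<open>is_representation\<close> demands, and later provides
  annihilating polynomials of endomorphisms.\<close>

locale hom_finite_category = linear_category D
  for D :: "('k::field, 'o, 'h::ab_group_add) lincat" +
  assumes finite_dim_Hom: "\<lbrakk>X \<in> Obj D; Y \<in> Obj D\<rbrakk> \<Longrightarrow> finite_dim (Smult D) (Hom D X Y)"
begin

abbreviation R :: "'o list \<Rightarrow> ('o, 'h) rep" where
  "R \<equiv> representable_sum D"

lemma in_Val_R:
  "v \<in> Val (R Xs) Y \<longleftrightarrow>
    (\<forall>i < length Xs. v i \<in> Hom D (Xs ! i) Y) \<and> (\<forall>i \<ge> length Xs. v i = 0)"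
  by (simp add: representable_sum_def)

lemma Act_R: "Act (R Xs) Y Z f v = (\<lambda>i. if i < length Xs then Comp D (Xs ! i) Y Z f (v i) else 0)"
  by (simp add: representable_sum_def)

lemma nth_in_Obj: "\<lbrakk>set Xs \<subseteq> Obj D; i < length Xs\<rbrakk> \<Longrightarrow> Xs ! i \<in> Obj D"
  using nth_mem by blast

lemma sum_fun_apply: "(sum f I) x = (\<Sum>i\<in>I. f i x)"
  for f :: "_ \<Rightarrow> _ \<Rightarrow> _ :: comm_monoid_add"
  by (induction I rule: infinite_finite_induct) auto

lemma vscale_apply: "vscale D c v i = Smult D c (v i)"
  by (simp add: vscale_def)

lemma finite_dim_Val_R:
  assumes "set Xs \<subseteq> Obj D" "Y \<in> Obj D"
  shows "finite_dim (vscale D) (Val (R Xs) Y)"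
proof -
  define single where "single i h = (\<lambda>j. if j = i then h else 0)" for i :: nat and h :: 'h
  have "\<forall>i. \<exists>B. i < length Xs \<longrightarrow> finite B \<and> Hom D (Xs ! i) Y \<subseteq> span B"
    using finite_dim_Hom[OF nth_in_Obj[OF assms(1)] assms(2)] by (auto simp: finite_dim_def)
  then obtain B where B: "\<And>i. i < length Xs \<Longrightarrow> finite (B i)"
    "\<And>i. i < length Xs \<Longrightarrow> Hom D (Xs ! i) Y \<subseteq> span (B i)"
    by metis
  define C where "C = (\<Union>i<length Xs. single i ` B i)"
  have single_span: "single i h \<in> vs.span C" if "i < length Xs" "h \<in> span (B i)" for i h
    using that(2)
  proof (induction rule: span_induct)
    case base
    show ?case
    proof (rule subspaceI)
      show "0 \<in> {h. single i h \<in> vs.span C}"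
        using vs.span_zero[of C] by (simp add: single_def zero_fun_def)
    next
      fix x y assume "x \<in> {h. single i h \<in> vs.span C}" "y \<in> {h. single i h \<in> vs.span C}"
      moreover have "single i (x + y) = single i x + single i y"
        by (auto simp: single_def)
      ultimately show "x + y \<in> {h. single i h \<in> vs.span C}"
        by (simp add: vs.span_add)
    next
      fix c x assume "x \<in> {h. single i h \<in> vs.span C}"
      moreover have "single i (Smult D c x) = vscale D c (single i x)"
        by (auto simp: single_def vscale_def)
      ultimately show "Smult D c x \<in> {h. single i h \<in> vs.span C}"
        by (simp add: vs.span_scale)
    qed
  next
    case (step x)
    then show ?case using that(1) by (auto simp: C_def intro!: vs.span_base)
  qed
  have "v \<in> vs.span C" if "v \<in> Val (R Xs) Y" for v
  proof -
    have "v = (\<Sum>i<length Xs. single i (v i))"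
      using that by (auto simp: in_Val_R sum_fun_apply single_def fun_eq_iff not_less)
    also have "\<dots> \<in> vs.span C"
      using that B(2) by (intro vs.span_sum single_span) (auto simp: in_Val_R)
    finally show ?thesis .
  qed
  moreover have "finite C" using B(1) by (auto simp: C_def)
  ultimately show ?thesis unfolding finite_dim_def by blast
qed

lemma is_representation_R:
  assumes "set Xs \<subseteq> Obj D"
  shows "is_representation D (R Xs)"
proof -
  note X = nth_in_Obj[OF assms]
  have "vs.subspace (Val (R Xs) Y)" if "Y \<in> Obj D" for Y
    using that by (auto simp: vs.subspace_def in_Val_R zero_in_Hom add_in_Hom scale_in_Hom X vscale_def)
  then show ?thesis
    unfolding is_representation_def linear_map_on_def
    by (auto simp: finite_dim_Val_R[OF assms] in_Val_R Act_R fun_eq_iff X Comp_in_Hom Comp_add_left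
        Comp_add_right Comp_scale_left Comp_scale_right vscale_def Comp_Idn_left Comp_assoc)
qed

text \<open>The universal elements of Yoneda's lemma. A homomorphism out of \<open>R Xs\<close> is
  determined by its values on them.\<close>

definition gen :: "'o list \<Rightarrow> nat \<Rightarrow> nat \<Rightarrow> 'h" where
  "gen Xs i = (\<lambda>j. if j = i then Idn D (Xs ! i) else 0)"

lemma gen_in: "\<lbrakk>set Xs \<subseteq> Obj D; i < length Xs\<rbrakk> \<Longrightarrow> gen Xs i \<in> Val (R Xs) (Xs ! i)"
  by (auto simp: in_Val_R gen_def Idn_in_Hom zero_in_Hom nth_in_Obj)

lemma R_expansion:
  assumes "set Xs \<subseteq> Obj D" "Y \<in> Obj D" "v \<in> Val (R Xs) Y"
  shows "v = (\<Sum>i<length Xs. Act (R Xs) (Xs ! i) Y (v i) (gen Xs i))"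
proof
  fix j
  have "(\<Sum>i<length Xs. Act (R Xs) (Xs ! i) Y (v i) (gen Xs i)) j =
    (\<Sum>i<length Xs. if j = i then v i else 0)"
    unfolding sum_fun_apply
    using assms by (intro sum.cong refl)
      (auto simp: Act_R gen_def in_Val_R Comp_Idn_right Comp_zero_right nth_in_Obj)
  also have "\<dots> = v j"
    using assms(3) by (auto simp: in_Val_R not_less)
  finally show "v j = (\<Sum>i<length Xs. Act (R Xs) (Xs ! i) Y (v i) (gen Xs i)) j" by simp
qed

lemma rep_hom_expansion:
  assumes "set Xs \<subseteq> Obj D" "Y \<in> Obj D" "v \<in> Val (R Xs) Y" "rep_hom D (R Xs) M \<phi>"
  shows "\<phi> Y v = (\<Sum>i<length Xs. Act M (Xs ! i) Y (v i) (\<phi> (Xs ! i) (gen Xs i)))"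
proof -
  note X = nth_in_Obj[OF assms(1)] and rep = is_representation_R[OF assms(1)]
  have v: "\<And>i. i < length Xs \<Longrightarrow> v i \<in> Hom D (Xs ! i) Y"
    using assms(3) by (simp add: in_Val_R)
  have "\<phi> Y v = \<phi> Y (\<Sum>i<length Xs. Act (R Xs) (Xs ! i) Y (v i) (gen Xs i))"
    using R_expansion[OF assms(1-3)] by simp
  also have "\<dots> = (\<Sum>i<length Xs. \<phi> Y (Act (R Xs) (Xs ! i) Y (v i) (gen Xs i)))"
    by (rule rep_hom_sum[OF assms(4,2) rep])
      (auto intro!: Act_in[OF rep] X v assms gen_in)
  also have "\<dots> = (\<Sum>i<length Xs. Act M (Xs ! i) Y (v i) (\<phi> (Xs ! i) (gen Xs i)))"
    by (intro sum.cong refl rep_hom_nat[OF assms(4)]) (auto intro!: X v assms gen_in[OF assms(1)])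
  finally show ?thesis .
qed

text \<open>By Yoneda, any choice of preimages under \<open>q\<close> of the images of the
  generators determines a lift \<open>\<sigma>\<close>. The condition on images, in place of
  surjectivity of \<open>q\<close>, admits lifts through a cover of a submodule of
  \<open>N\<close>.\<close>

lemma R_lift:
  assumes Xs: "set Xs \<subseteq> Obj D" and M: "is_representation D M"
    and q: "rep_hom D M N q" and g: "rep_hom D (R Xs) N g"
    and im: "\<And>Y v. \<lbrakk>Y \<in> Obj D; v \<in> Val (R Xs) Y\<rbrakk> \<Longrightarrow> g Y v \<in> q Y ` Val M Y"
  obtains \<sigma> where "rep_hom D (R Xs) M \<sigma>"
    "\<And>Y v. \<lbrakk>Y \<in> Obj D; v \<in> Val (R Xs) Y\<rbrakk> \<Longrightarrow> q Y (\<sigma> Y v) = g Y v"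
proof -
  note X = nth_in_Obj[OF Xs]
  have "\<forall>i. \<exists>m. i < length Xs \<longrightarrow> m \<in> Val M (Xs ! i) \<and> q (Xs ! i) m = g (Xs ! i) (gen Xs i)"
    using im[OF X gen_in[OF Xs]] by (metis imageE)
  then obtain m where m: "\<And>i. i < length Xs \<Longrightarrow> m i \<in> Val M (Xs ! i)"
    "\<And>i. i < length Xs \<Longrightarrow> q (Xs ! i) (m i) = g (Xs ! i) (gen Xs i)"
    by metis
  define \<sigma> where "\<sigma> = (\<lambda>Y v. \<Sum>i<length Xs. Act M (Xs ! i) Y (v i) (m i))"
  have "rep_hom D (R Xs) M \<sigma>"
  proof (rule rep_homI)
    fix Y Z f v assume Y: "Y \<in> Obj D" "Z \<in> Obj D" "f \<in> Hom D Y Z" "v \<in> Val (R Xs) Y"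
    have v: "\<And>i. i < length Xs \<Longrightarrow> v i \<in> Hom D (Xs ! i) Y"
      using Y by (simp add: in_Val_R)
    show "\<sigma> Z (Act (R Xs) Y Z f v) = Act M Y Z f (\<sigma> Y v)"
      unfolding \<sigma>_def
      by (subst Act_sum[OF M Y(1-3)])
        (auto simp: Act_R Act_Comp[OF M] X m v Y intro!: Act_in[OF M] sum.cong)
  qed (auto simp: \<sigma>_def in_Val_R Act_add_Hom[OF M] Act_scale_Hom[OF M] X m vs.scale_sum_right
      sum.distrib vscale_apply intro!: rep_sum[OF M] Act_in[OF M])
  moreover have "q Y (\<sigma> Y v) = g Y v" if Y: "Y \<in> Obj D" "v \<in> Val (R Xs) Y" for Y v
  proof -
    have v: "\<And>i. i < length Xs \<Longrightarrow> v i \<in> Hom D (Xs ! i) Y"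
      using Y by (simp add: in_Val_R)
    have "q Y (\<sigma> Y v) = (\<Sum>i<length Xs. q Y (Act M (Xs ! i) Y (v i) (m i)))"
      unfolding \<sigma>_def by (rule rep_hom_sum[OF q Y(1) M]) (auto intro!: Act_in[OF M] X m v Y)
    also have "\<dots> = (\<Sum>i<length Xs. Act N (Xs ! i) Y (v i) (g (Xs ! i) (gen Xs i)))"
      by (intro sum.cong refl) (auto simp: rep_hom_nat[OF q] X m v Y)
    also have "\<dots> = g Y v"
      by (rule rep_hom_expansion[OF Xs Y g, symmetric])
    finally show ?thesis .
  qed
  ultimately show thesis using that by blast
qed

text \<open>
  The inclusion of \<open>R Xs\<close> into \<open>R (Xs @ Ys)\<close> is the identity on underlying families, so only the
  second summand needs an injection.
\<close>

definition proj1 :: "nat \<Rightarrow> (nat \<Rightarrow> 'h) \<Rightarrow> nat \<Rightarrow> 'h" where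
  "proj1 n v = (\<lambda>i. if i < n then v i else 0)"

definition proj2 :: "nat \<Rightarrow> (nat \<Rightarrow> 'h) \<Rightarrow> nat \<Rightarrow> 'h" where
  "proj2 n v = (\<lambda>i. v (n + i))"

definition inj2 :: "nat \<Rightarrow> (nat \<Rightarrow> 'h) \<Rightarrow> nat \<Rightarrow> 'h" where
  "inj2 n v = (\<lambda>i. if i < n then 0 else v (i - n))"

context
  fixes Xs Ys assumes Xs: "set Xs \<subseteq> Obj D" and Ys: "set Ys \<subseteq> Obj D"
begin

lemma rep_hom_inj1: "rep_hom D (R Xs) (R (Xs @ Ys)) (\<lambda>X v. v)"
  by (rule rep_homI) (auto simp: in_Val_R Act_R fun_eq_iff nth_append zero_in_Hom nth_in_Obj[OF Ys]
      Comp_zero_right)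

lemma rep_hom_proj1: "rep_hom D (R (Xs @ Ys)) (R Xs) (\<lambda>X. proj1 (length Xs))"
  by (rule rep_homI)
    (auto simp: in_Val_R Act_R fun_eq_iff nth_append proj1_def vscale_def split: if_splits)

lemma rep_hom_proj2: "rep_hom D (R (Xs @ Ys)) (R Ys) (\<lambda>X. proj2 (length Xs))"
proof (rule rep_homI)
  fix X v assume "X \<in> Obj D" "v \<in> Val (R (Xs @ Ys)) X"
  then have v: "i < length Xs + length Ys \<longrightarrow> v i \<in> Hom D ((Xs @ Ys) ! i) X"
    "length Xs + length Ys \<le> i \<longrightarrow> v i = 0" for i
    by (auto simp: in_Val_R)
  show "proj2 (length Xs) v \<in> Val (R Ys) X"
    using v[of "length Xs + _"] by (auto simp: in_Val_R proj2_def nth_append)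
qed (auto simp: Act_R fun_eq_iff nth_append proj2_def vscale_def)

lemma rep_hom_inj2: "rep_hom D (R Ys) (R (Xs @ Ys)) (\<lambda>X. inj2 (length Xs))"
  by (rule rep_homI) (auto simp: in_Val_R Act_R fun_eq_iff nth_append inj2_def vscale_def
      zero_in_Hom Comp_zero_right nth_in_Obj[OF Xs])

end

lemma inj2_zero: "inj2 n 0 = 0"
  by (auto simp: inj2_def fun_eq_iff)

lemma proj1_inj1: "v \<in> Val (R Xs) Y \<Longrightarrow> proj1 (length Xs) v = v"
  by (auto simp: in_Val_R proj1_def fun_eq_iff)

lemma proj2_inj1: "v \<in> Val (R Xs) Y \<Longrightarrow> proj2 (length Xs) v = 0"
  by (auto simp: in_Val_R proj2_def fun_eq_iff)

lemma proj1_inj2: "proj1 n (inj2 n v) = 0"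
  by (auto simp: proj1_def inj2_def fun_eq_iff)

lemma proj2_inj2: "proj2 n (inj2 n v) = v"
  by (auto simp: proj2_def inj2_def fun_eq_iff)

lemma proj1_plus_inj2: "proj1 n v + inj2 n (proj2 n v) = v"
  by (auto simp: proj1_def inj2_def proj2_def fun_eq_iff)

lemma gen_append1: "i < length Xs \<Longrightarrow> gen (Xs @ Ys) i = gen Xs i"
  by (auto simp: gen_def nth_append fun_eq_iff)

lemma gen_append2: "gen (Xs @ Ys) (length Xs + i) = inj2 (length Xs) (gen Ys i)"
  by (auto simp: gen_def nth_append fun_eq_iff inj2_def)

end

section \<open>The trace of an endomorphism\<close>

text \<open>The homological argument sees the functional on \<open>V\<close> only through its values
  on endomorphisms; \<open>\<theta>_swap\<close> is what it keeps of the vanishing on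
  commutators.\<close>

locale trace_category = hom_finite_category D
  for D :: "('k::field, 'o, 'h::ab_group_add) lincat" +
  fixes \<theta> :: "'o \<Rightarrow> 'h \<Rightarrow> 'k"
  assumes \<theta>_add: "\<lbrakk>X \<in> Obj D; f \<in> Hom D X X; g \<in> Hom D X X\<rbrakk> \<Longrightarrow> \<theta> X (f + g) = \<theta> X f + \<theta> X g"
    and \<theta>_swap: "\<lbrakk>X \<in> Obj D; Y \<in> Obj D; f \<in> Hom D X Y; g \<in> Hom D Y X\<rbrakk>
      \<Longrightarrow> \<theta> X (Comp D X Y X g f) = \<theta> Y (Comp D Y X Y f g)"
begin

lemma \<theta>_zero: "X \<in> Obj D \<Longrightarrow> \<theta> X 0 = 0"
  using \<theta>_add[of X 0 0] by (metis add_0 add_cancel_right_right zero_in_Hom)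

lemma \<theta>_diff: "\<lbrakk>X \<in> Obj D; f \<in> Hom D X X; g \<in> Hom D X X\<rbrakk> \<Longrightarrow> \<theta> X (f - g) = \<theta> X f - \<theta> X g"
  using \<theta>_add[of X "f - g" g] diff_in_Hom[of X X f g] by simp

lemma \<theta>_sum:
  assumes "X \<in> Obj D" "\<And>i. i \<in> I \<Longrightarrow> f i \<in> Hom D X X"
  shows "\<theta> X (sum f I) = (\<Sum>i\<in>I. \<theta> X (f i))"
  using assms(2)
  by (induction I rule: infinite_finite_induct)
    (auto simp: \<theta>_zero \<theta>_add sum_in_Hom assms(1))

text \<open>The summand at \<open>i\<close> is the i-th diagonal entry of the matrix of
  \<open>\<psi>\<close>, an endomorphism of \<open>Xs ! i\<close> by Yoneda. The formula is the
  Hattori-Stallings trace of a free module, pushed forward along \<open>\<theta>\<close>.\<close>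

definition tr :: "'o list \<Rightarrow> ('o \<Rightarrow> (nat \<Rightarrow> 'h) \<Rightarrow> (nat \<Rightarrow> 'h)) \<Rightarrow> 'k" where
  "tr Xs \<psi> = (\<Sum>i<length Xs. \<theta> (Xs ! i) (\<psi> (Xs ! i) (gen Xs i) i))"

text \<open>Homomorphisms are total functions with arbitrary values outside \<open>Val\<close>, so
  identities between them hold only on \<open>Val\<close>; the generators lie there, hence
  \<open>tr\<close> does not see the difference.\<close>

lemma tr_cong:
  assumes "set Xs \<subseteq> Obj D" "\<And>X v. \<lbrakk>X \<in> Obj D; v \<in> Val (R Xs) X\<rbrakk> \<Longrightarrow> \<phi> X v = \<psi> X v"
  shows "tr Xs \<phi> = tr Xs \<psi>"
  unfolding tr_def using assms by (intro sum.cong refl) (simp add: nth_in_Obj gen_in)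

lemma tr_zero: "set Xs \<subseteq> Obj D \<Longrightarrow> tr Xs (\<lambda>X v. 0) = 0"
  unfolding tr_def by (intro sum.neutral) (simp add: nth_in_Obj \<theta>_zero)

lemma tr_diff:
  assumes Xs: "set Xs \<subseteq> Obj D" and "rep_hom D (R Xs) (R Xs) \<phi>" "rep_hom D (R Xs) (R Xs) \<psi>"
  shows "tr Xs (\<lambda>X v. \<phi> X v - \<psi> X v) = tr Xs \<phi> - tr Xs \<psi>"
proof -
  have "\<chi> (Xs ! i) (gen Xs i) i \<in> Hom D (Xs ! i) (Xs ! i)"
    if "i < length Xs" "rep_hom D (R Xs) (R Xs) \<chi>" for i \<chi>
    using rep_hom_in[OF that(2) nth_in_Obj[OF Xs] gen_in[OF Xs]] that(1) by (auto simp: in_Val_R)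
  then show ?thesis
    using assms by (simp add: tr_def sum_subtractf[symmetric] \<theta>_diff nth_in_Obj)
qed

lemma sum_lessThan_plus:
  fixes f :: "nat \<Rightarrow> 'k"
  shows "(\<Sum>i<m + n. f i) = (\<Sum>i<m. f i) + (\<Sum>i<n. f (m + i))"
  by (induction n) (auto simp: add.assoc)

text \<open>Only the diagonal blocks of a block matrix contribute. The inclusion of the first
  summand is the identity on families and therefore invisible in the first term.\<close>

lemma tr_append:
  "tr (Xs @ Ys) \<psi> =
    tr Xs (\<lambda>X v. proj1 (length Xs) (\<psi> X v)) +
    tr Ys (\<lambda>X v. proj2 (length Xs) (\<psi> X (inj2 (length Xs) v)))"
proof -
  have "tr (Xs @ Ys) \<psi> = (\<Sum>i<length Xs + length Ys. \<theta> ((Xs @ Ys) ! i) (\<psi> ((Xs @ Ys) ! i) (gen (Xs @ Ys) i) i))"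
    by (simp add: tr_def)
  also have "\<dots> = (\<Sum>i<length Xs. \<theta> ((Xs @ Ys) ! i) (\<psi> ((Xs @ Ys) ! i) (gen (Xs @ Ys) i) i)) +
    (\<Sum>i<length Ys. \<theta> ((Xs @ Ys) ! (length Xs + i)) (\<psi> ((Xs @ Ys) ! (length Xs + i))
       (gen (Xs @ Ys) (length Xs + i)) (length Xs + i)))"
    by (rule sum_lessThan_plus)
  also have "\<dots> = tr Xs (\<lambda>X v. proj1 (length Xs) (\<psi> X v)) +
    tr Ys (\<lambda>X v. proj2 (length Xs) (\<psi> X (inj2 (length Xs) v)))"
    unfolding tr_def
    by (intro arg_cong2[of _ _ _ _ "(+)"] sum.cong refl)
      (auto simp: gen_append1 gen_append2 nth_append proj1_def proj2_def)
  finally show ?thesis .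
qed

text \<open>Expand both sides in matrix entries; \<open>\<theta>_swap\<close> matches them term by
  term. Maps between representable functors are precompositions, so the entries multiply in reversed
  order.\<close>

lemma tr_swap:
  assumes Xs: "set Xs \<subseteq> Obj D" and Ys: "set Ys \<subseteq> Obj D"
    and A: "rep_hom D (R Xs) (R Ys) A" and B: "rep_hom D (R Ys) (R Xs) B"
  shows "tr Xs (\<lambda>X v. B X (A X v)) = tr Ys (\<lambda>X v. A X (B X v))"
proof -
  define a where "a i j = A (Xs ! i) (gen Xs i) j" for i j
  define b where "b j i = B (Ys ! j) (gen Ys j) i" for i j
  have expand: "Q (Us ! i) (P (Us ! i) (gen Us i)) i =
      (\<Sum>j<length Vs. Comp D (Us ! i) (Vs ! j) (Us ! i) (P (Us ! i) (gen Us i) j) (Q (Vs ! j) (gen Vs j) i))"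
    and ent: "\<And>j. j < length Vs \<Longrightarrow> P (Us ! i) (gen Us i) j \<in> Hom D (Vs ! j) (Us ! i)"
    if UV: "set Us \<subseteq> Obj D" "set Vs \<subseteq> Obj D" "i < length Us"
      "rep_hom D (R Us) (R Vs) P" "rep_hom D (R Vs) (R Us) Q" for P Q Us Vs i
  proof -
    have in_V: "P (Us ! i) (gen Us i) \<in> Val (R Vs) (Us ! i)"
      using UV by (intro rep_hom_in[OF UV(4)] nth_in_Obj gen_in)
    then show "P (Us ! i) (gen Us i) j \<in> Hom D (Vs ! j) (Us ! i)" if "j < length Vs" for j
      using that by (simp add: in_Val_R)
    show "Q (Us ! i) (P (Us ! i) (gen Us i)) i =
      (\<Sum>j<length Vs. Comp D (Us ! i) (Vs ! j) (Us ! i) (P (Us ! i) (gen Us i) j) (Q (Vs ! j) (gen Vs j) i))"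
      using rep_hom_expansion[OF UV(2) nth_in_Obj[OF UV(1,3)] in_V UV(5)] UV(3)
      by (simp add: sum_fun_apply Act_R)
  qed
  have a: "a i j \<in> Hom D (Ys ! j) (Xs ! i)" and b: "b j i \<in> Hom D (Xs ! i) (Ys ! j)"
    if "i < length Xs" "j < length Ys" for i j
    using ent[OF Xs Ys _ A B] ent[OF Ys Xs _ B A] that by (auto simp: a_def b_def)
  have "tr Xs (\<lambda>X v. B X (A X v)) =
    (\<Sum>i<length Xs. \<theta> (Xs ! i) (\<Sum>j<length Ys. Comp D (Xs ! i) (Ys ! j) (Xs ! i) (a i j) (b j i)))"
    unfolding tr_def a_def b_def
    by (intro sum.cong refl arg_cong[where f = "\<theta> _"] expand[OF Xs Ys _ A B]) simp
  also have "\<dots> = (\<Sum>i<length Xs. \<Sum>j<length Ys.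
      \<theta> (Xs ! i) (Comp D (Xs ! i) (Ys ! j) (Xs ! i) (a i j) (b j i)))"
    by (intro sum.cong refl \<theta>_sum) (auto intro!: Comp_in_Hom a b nth_in_Obj[OF Xs] nth_in_Obj[OF Ys])
  also have "\<dots> = (\<Sum>i<length Xs. \<Sum>j<length Ys.
      \<theta> (Ys ! j) (Comp D (Ys ! j) (Xs ! i) (Ys ! j) (b j i) (a i j)))"
    by (intro sum.cong refl \<theta>_swap) (auto intro!: a b nth_in_Obj[OF Xs] nth_in_Obj[OF Ys])
  also have "\<dots> = (\<Sum>j<length Ys. \<Sum>i<length Xs.
      \<theta> (Ys ! j) (Comp D (Ys ! j) (Xs ! i) (Ys ! j) (b j i) (a i j)))"
    by (rule sum.swap)
  also have "\<dots> = (\<Sum>j<length Ys. \<theta> (Ys ! j) (\<Sum>i<length Xs.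
      Comp D (Ys ! j) (Xs ! i) (Ys ! j) (b j i) (a i j)))"
    by (intro sum.cong refl \<theta>_sum[symmetric])
      (auto intro!: Comp_in_Hom a b nth_in_Obj[OF Xs] nth_in_Obj[OF Ys])
  also have "\<dots> = tr Ys (\<lambda>X v. A X (B X v))"
    unfolding tr_def a_def b_def
    by (intro sum.cong refl arg_cong[where f = "\<theta> _"] expand[OF Ys Xs _ B A, symmetric]) simp
  finally show ?thesis .
qed

end

section \<open>Direct summands of free functors and short exact sequences\<close>

context hom_finite_category
begin

text \<open>A finitely generated projective, presented by a split epimorphism from a free functor.
  The complement is recovered as the kernel of \<open>\<pi>\<close> in
  \<open>retract_kernel\<close>.\<close>

definition retract :: "'o list \<Rightarrow> ('o, 'h) rep \<Rightarrow> ('o \<Rightarrow> (nat \<Rightarrow> 'h) \<Rightarrow> (nat \<Rightarrow> 'h)) \<Rightarrow>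
    ('o \<Rightarrow> (nat \<Rightarrow> 'h) \<Rightarrow> (nat \<Rightarrow> 'h)) \<Rightarrow> bool" where
  "retract Xs P \<iota> \<pi> \<longleftrightarrow> set Xs \<subseteq> Obj D \<and> is_representation D P \<and>
     rep_hom D P (R Xs) \<iota> \<and> rep_hom D (R Xs) P \<pi> \<and>
     (\<forall>X \<in> Obj D. \<forall>v \<in> Val P X. \<pi> X (\<iota> X v) = v)"

lemma retractD:
  assumes "retract Xs P \<iota> \<pi>"
  shows "set Xs \<subseteq> Obj D" "is_representation D P" "rep_hom D P (R Xs) \<iota>" "rep_hom D (R Xs) P \<pi>"
    "\<And>X v. \<lbrakk>X \<in> Obj D; v \<in> Val P X\<rbrakk> \<Longrightarrow> \<pi> X (\<iota> X v) = v"
  using assms by (auto simp: retract_def)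

lemma retract_surj:
  assumes "retract Xs P \<iota> \<pi>" "X \<in> Obj D"
  shows "\<pi> X ` Val (R Xs) X = Val P X"
proof (intro equalityI subsetI)
  fix v assume "v \<in> Val P X"
  then show "v \<in> \<pi> X ` Val (R Xs) X"
    using assms retractD[OF assms(1)] by (metis imageI rep_hom_in)
qed (use assms retractD[OF assms(1)] rep_hom_in in blast)

lemma retract_lift:
  assumes P: "retract Xs P \<iota> \<pi>" and M: "is_representation D M"
    and q: "rep_hom D M N q" and g: "rep_hom D P N g"
    and im: "\<And>Y v. \<lbrakk>Y \<in> Obj D; v \<in> Val P Y\<rbrakk> \<Longrightarrow> g Y v \<in> q Y ` Val M Y"
  obtains \<sigma> where "rep_hom D P M \<sigma>"
    "\<And>Y v. \<lbrakk>Y \<in> Obj D; v \<in> Val P Y\<rbrakk> \<Longrightarrow> q Y (\<sigma> Y v) = g Y v"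
proof -
  note P = retractD[OF P]
  obtain \<sigma> where s: "rep_hom D (R Xs) M \<sigma>"
    "\<And>Y v. \<lbrakk>Y \<in> Obj D; v \<in> Val (R Xs) Y\<rbrakk> \<Longrightarrow> q Y (\<sigma> Y v) = g Y (\<pi> Y v)"
    using R_lift[OF P(1) M q rep_hom_compose[OF P(4) g]] im rep_hom_in[OF P(4)] by metis
  show thesis
    using that[OF rep_hom_compose[OF P(3) s(1)]] s(2) rep_hom_in[OF P(3)] P(5) by simp
qed

text \<open>\<open>1 - \<iota> \<pi>\<close> is the idempotent of the free functor complementary to
  \<open>\<iota> \<pi>\<close>; its image is the kernel of \<open>\<pi>\<close>.\<close>

lemma retract_kernel:
  assumes "retract Xs P \<iota> \<pi>"
  shows "retract Xs (kernel (R Xs) \<pi>) (\<lambda>X v. v) (\<lambda>X v. v - \<iota> X (\<pi> X v))"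
proof -
  note P = retractD[OF assms]
  note R = is_representation_R[OF P(1)]
  note minus = rep_hom_minus[OF rep_hom_id rep_hom_compose[OF P(4) P(3)] R]
  have "rep_hom D (R Xs) (kernel (R Xs) \<pi>) (\<lambda>X v. v - \<iota> X (\<pi> X v))"
    by (rule rep_hom_to_kernel[OF minus])
      (simp add: rep_hom_diff[OF P(4) _ R] rep_hom_in[OF P(3)] rep_hom_in[OF P(4)] P(5))
  then show ?thesis
    unfolding retract_def
    using rep_hom_from_kernel[OF rep_hom_id] P is_representation_kernel[OF R P(2) P(4)]
    by (auto simp: Val_kernel rep_hom_zero[OF P(3) _ P(2)])
qed

text \<open>The submodule is a literal subspace, while the quotient is given only as the target of
  \<open>q\<close>; this is the form in which kernels and simple factors arise.\<close>

definition exact_seq :: "('o, 'h) rep \<Rightarrow> ('o, 'h) rep \<Rightarrow> ('o, 'h) rep \<Rightarrow>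
    ('o \<Rightarrow> (nat \<Rightarrow> 'h) \<Rightarrow> (nat \<Rightarrow> 'h)) \<Rightarrow> bool" where
  "exact_seq M' M M'' q \<longleftrightarrow>
     is_representation D M' \<and> is_representation D M \<and> is_representation D M'' \<and>
     rep_hom D M' M (\<lambda>X v. v) \<and> rep_hom D M M'' q \<and>
     (\<forall>X \<in> Obj D. Val M' X = {v \<in> Val M X. q X v = 0} \<and> q X ` Val M X = Val M'' X)"

lemma exact_seqD:
  assumes "exact_seq M' M M'' q"
  shows "is_representation D M'" "is_representation D M" "is_representation D M''"
    "rep_hom D M' M (\<lambda>X v. v)" "rep_hom D M M'' q"
    "\<And>X. X \<in> Obj D \<Longrightarrow> Val M' X = {v \<in> Val M X. q X v = 0}"
    "\<And>X. X \<in> Obj D \<Longrightarrow> q X ` Val M X = Val M'' X"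
  using assms by (auto simp: exact_seq_def)

end

section \<open>Traces along projective resolutions\<close>

context trace_category
begin

text \<open>
  \<open>has_trace n M \<phi> t\<close>: the endomorphism \<open>\<phi>\<close> of \<open>M\<close> lifts to a projective resolution of length
  \<open>n\<close>, and \<open>t\<close> is the alternating sum of the traces of the lifted endomorphisms (the
  Hattori-Stallings trace). All terms except the last syzygy are free.
\<close>

primrec has_trace :: "nat \<Rightarrow> ('o, 'h) rep \<Rightarrow> ('o \<Rightarrow> (nat \<Rightarrow> 'h) \<Rightarrow> (nat \<Rightarrow> 'h)) \<Rightarrow> 'k \<Rightarrow> bool" where
  "has_trace 0 M \<phi> t \<longleftrightarrow> rep_hom D M M \<phi> \<and>
     (\<exists>Xs \<iota> \<pi>. retract Xs M \<iota> \<pi> \<and> t = tr Xs (\<lambda>X v. \<iota> X (\<phi> X (\<pi> X v))))"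
| "has_trace (Suc n) M \<phi> t \<longleftrightarrow> is_representation D M \<and> rep_hom D M M \<phi> \<and>
     (\<exists>Xs \<epsilon> \<psi> t'. set Xs \<subseteq> Obj D \<and> rep_hom D (R Xs) M \<epsilon> \<and> rep_hom D (R Xs) (R Xs) \<psi> \<and>
       (\<forall>X \<in> Obj D. \<epsilon> X ` Val (R Xs) X = Val M X) \<and>
       (\<forall>X \<in> Obj D. \<forall>v \<in> Val (R Xs) X. \<epsilon> X (\<psi> X v) = \<phi> X (\<epsilon> X v)) \<and>
       has_trace n (kernel (R Xs) \<epsilon>) \<psi> t' \<and> t = tr Xs \<psi> - t')"

lemma has_trace_retract:
  assumes "retract Xs M \<iota> \<pi>" "rep_hom D M M \<phi>"
  shows "has_trace 0 M \<phi> (tr Xs (\<lambda>X v. \<iota> X (\<phi> X (\<pi> X v))))"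
  using assms by auto

text \<open>Insert \<open>\<pi>' \<iota>' = 1\<close> and rotate cyclically with
  \<open>tr_swap\<close>; then \<open>\<pi> \<iota> = 1\<close> cancels.\<close>

lemma tr_retract_independent:
  assumes P: "retract Xs P \<iota> \<pi>" and P': "retract Ys P \<iota>' \<pi>'" and f: "rep_hom D P P \<phi>"
  shows "tr Xs (\<lambda>X v. \<iota> X (\<phi> X (\<pi> X v))) = tr Ys (\<lambda>X v. \<iota>' X (\<phi> X (\<pi>' X v)))"
proof -
  note P = retractD[OF P] and P' = retractD[OF P']
  have "tr Xs (\<lambda>X v. \<iota> X (\<phi> X (\<pi> X v))) = tr Xs (\<lambda>X v. \<iota> X (\<phi> X (\<pi>' X (\<iota>' X (\<pi> X v)))))"
    by (rule tr_cong[OF P(1)]) (simp add: P'(5) rep_hom_in[OF P(4)])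
  also have "\<dots> = tr Ys (\<lambda>X v. \<iota>' X (\<pi> X (\<iota> X (\<phi> X (\<pi>' X v)))))"
    using tr_swap[OF P(1) P'(1) rep_hom_compose[OF P(4) P'(3)]
        rep_hom_compose[OF rep_hom_compose[OF P'(4) f] P(3)]] .
  also have "\<dots> = tr Ys (\<lambda>X v. \<iota>' X (\<phi> X (\<pi>' X v)))"
    by (rule tr_cong[OF P'(1)]) (simp add: P(5) rep_hom_in[OF f] rep_hom_in[OF P'(4)])
  finally show ?thesis .
qed

text \<open>A cover \<open>\<epsilon>\<close> of a projective has a section \<open>s\<close>, so its
  kernel is again a retract, cut out by \<open>1 - s \<epsilon>\<close>, and the induction
  hypothesis evaluates its trace. Subtracting leaves the trace of
  \<open>\<psi> s \<epsilon>\<close>, which rotates to that of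
  \<open>s \<epsilon> \<psi> = s \<phi> \<epsilon>\<close>.\<close>

lemma has_trace_unique:
  assumes "has_trace n P \<phi> t" "retract Xs P \<iota> \<pi>"
  shows "t = tr Xs (\<lambda>X v. \<iota> X (\<phi> X (\<pi> X v)))"
  using assms
proof (induction n arbitrary: P \<phi> t Xs \<iota> \<pi>)
  case 0
  then obtain Ys \<iota>' \<pi>' where f: "rep_hom D P P \<phi>" and r: "retract Ys P \<iota>' \<pi>'"
    and t: "t = tr Ys (\<lambda>X v. \<iota>' X (\<phi> X (\<pi>' X v)))"
    by auto
  show ?case unfolding t by (rule tr_retract_independent[OF r 0(2) f])
next
  case (Suc n)
  note P = retractD[OF Suc.prems(2)]
  from Suc.prems obtain Ys \<epsilon> \<psi> t' where Ys: "set Ys \<subseteq> Obj D" and f: "rep_hom D P P \<phi>"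
    and e: "rep_hom D (R Ys) P \<epsilon>" and g: "rep_hom D (R Ys) (R Ys) \<psi>"
    and surj: "\<forall>X \<in> Obj D. \<epsilon> X ` Val (R Ys) X = Val P X"
    and comm: "\<forall>X \<in> Obj D. \<forall>v \<in> Val (R Ys) X. \<epsilon> X (\<psi> X v) = \<phi> X (\<epsilon> X v)"
    and t': "has_trace n (kernel (R Ys) \<epsilon>) \<psi> t'" and t: "t = tr Ys \<psi> - t'"
    by auto
  note RY = is_representation_R[OF Ys]
  obtain s where s: "rep_hom D P (R Ys) s"
    and es: "\<And>Y v. \<lbrakk>Y \<in> Obj D; v \<in> Val P Y\<rbrakk> \<Longrightarrow> \<epsilon> Y (s Y v) = v"
    using retract_lift[OF Suc.prems(2) RY e rep_hom_id] surj by metis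
  have r: "retract Ys P s \<epsilon>"
    using Ys P(2) s e es by (auto simp: retract_def)
  have se: "rep_hom D (R Ys) (R Ys) (\<lambda>X v. s X (\<epsilon> X v))"
    by (rule rep_hom_compose[OF e s])
  have "t' = tr Ys (\<lambda>X v. \<psi> X (v - s X (\<epsilon> X v)))"
    using Suc.IH[OF t' retract_kernel[OF r]] .
  also have "\<dots> = tr Ys (\<lambda>X v. \<psi> X v - \<psi> X (s X (\<epsilon> X v)))"
    by (rule tr_cong[OF Ys]) (simp add: rep_hom_diff[OF g _ RY] rep_hom_in[OF se])
  also have "\<dots> = tr Ys \<psi> - tr Ys (\<lambda>X v. \<psi> X (s X (\<epsilon> X v)))"
    using tr_diff[OF Ys g rep_hom_compose[OF se g]] .
  finally have "t = tr Ys (\<lambda>X v. \<psi> X (s X (\<epsilon> X v)))"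
    using t by simp
  also have "\<dots> = tr Ys (\<lambda>X v. s X (\<epsilon> X (\<psi> X v)))"
    using tr_swap[OF Ys Ys se g] .
  also have "\<dots> = tr Ys (\<lambda>X v. s X (\<phi> X (\<epsilon> X v)))"
    using comm by (intro tr_cong[OF Ys]) simp
  also have "\<dots> = tr Xs (\<lambda>X v. \<iota> X (\<phi> X (\<pi> X v)))"
    by (rule tr_retract_independent[OF r Suc.prems(2) f])
  finally show ?case .
qed

text \<open>In the base case a retract \<open>M\<close> of \<open>R Xs\<close> is covered by
  \<open>R Xs\<close> with lift \<open>\<iota> \<phi> \<pi>\<close>. This lift vanishes on the
  kernel of \<open>\<pi>\<close>, so the new syzygy contributes trace zero.\<close>

lemma has_trace_Suc:
  assumes "has_trace n M \<phi> t"
  shows "has_trace (Suc n) M \<phi> t"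
  using assms
proof (induction n arbitrary: M \<phi> t)
  case 0
  then obtain Xs \<iota> \<pi> where f: "rep_hom D M M \<phi>" and r: "retract Xs M \<iota> \<pi>"
    and t: "t = tr Xs (\<lambda>X v. \<iota> X (\<phi> X (\<pi> X v)))"
    by auto
  note P = retractD[OF r]
  define \<psi> where "\<psi> = (\<lambda>X v. \<iota> X (\<phi> X (\<pi> X v)))"
  have g: "rep_hom D (R Xs) (R Xs) \<psi>"
    unfolding \<psi>_def by (rule rep_hom_compose[OF rep_hom_compose[OF P(4) f] P(3)])
  note R = is_representation_R[OF P(1)]
  have zero: "\<psi> X v = 0" if "X \<in> Obj D" "\<pi> X v = 0" for X v
    using that by (simp add: \<psi>_def rep_hom_zero[OF f _ P(2)] rep_hom_zero[OF P(3) _ P(2)])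
  have "rep_hom D (kernel (R Xs) \<pi>) (kernel (R Xs) \<pi>) \<psi>"
    by (rule rep_hom_to_kernel[OF rep_hom_from_kernel[OF g]])
      (simp add: Val_kernel zero rep_hom_zero[OF P(4) _ R])
  from has_trace_retract[OF retract_kernel[OF r] this]
  have "has_trace 0 (kernel (R Xs) \<pi>) \<psi> (tr Xs (\<lambda>X v. \<psi> X (v - \<iota> X (\<pi> X v))))" .
  also have "tr Xs (\<lambda>X v. \<psi> X (v - \<iota> X (\<pi> X v))) = tr Xs (\<lambda>X v. 0)"
    by (rule tr_cong[OF P(1)], rule zero)
      (simp_all add: rep_hom_diff[OF P(4) _ R] rep_hom_in[OF P(3)] rep_hom_in[OF P(4)] P(5))
  finally have "has_trace 0 (kernel (R Xs) \<pi>) \<psi> 0"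
    by (simp only: tr_zero[OF P(1)])
  moreover note retract_surj[OF r]
  moreover have "\<pi> X (\<psi> X v) = \<phi> X (\<pi> X v)" if "X \<in> Obj D" "v \<in> Val (R Xs) X" for X v
    using that by (simp add: \<psi>_def P(5) rep_hom_in[OF f] rep_hom_in[OF P(4)])
  moreover have "t = tr Xs \<psi> - 0"
    by (simp add: t \<psi>_def)
  ultimately show ?case
    unfolding has_trace.simps(2) using P f g by blast
next
  case (Suc n)
  from Suc.prems show ?case
    by (subst has_trace.simps(2), subst (asm) has_trace.simps(2)) (use Suc.IH in blast)
qed

text \<open>Additivity compares resolutions of one common length; this brings the outer terms of a
  sequence to it.\<close>

lemma has_trace_mono:
  assumes "has_trace m M \<phi> t" "m \<le> n"
  shows "has_trace n M \<phi> t"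
  using assms(2,1) by (induction rule: dec_induct) (auto intro: has_trace_Suc simp del: has_trace.simps)

text \<open>The horseshoe lemma, carried out together with a lift of the endomorphism.\<close>

lemma has_trace_additive:
  assumes "exact_seq M' M M'' q" "rep_hom D M M \<phi>"
    and "\<And>X v. \<lbrakk>X \<in> Obj D; v \<in> Val M' X\<rbrakk> \<Longrightarrow> \<phi>' X v = \<phi> X v"
    and "\<And>X v. \<lbrakk>X \<in> Obj D; v \<in> Val M X\<rbrakk> \<Longrightarrow> q X (\<phi> X v) = \<phi>'' X (q X v)"
    and "has_trace n M' \<phi>' t'" "has_trace n M'' \<phi>'' t''"
  shows "has_trace n M \<phi> (t' + t'')"
  using assms
proof (induction n arbitrary: M' M M'' q \<phi> \<phi>' \<phi>'' t' t'')
  case 0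
  note ex = exact_seqD[OF 0(1)]
  note f = 0(2) and f' = 0(3) and f'' = 0(4)
  obtain Xs \<iota>' \<pi>' where fh': "rep_hom D M' M' \<phi>'" and r': "retract Xs M' \<iota>' \<pi>'"
    and t': "t' = tr Xs (\<lambda>X v. \<iota>' X (\<phi>' X (\<pi>' X v)))"
    using 0(5) by auto
  obtain Ys \<iota>'' \<pi>'' where fh'': "rep_hom D M'' M'' \<phi>''" and r'': "retract Ys M'' \<iota>'' \<pi>''"
    and t'': "t'' = tr Ys (\<lambda>X v. \<iota>'' X (\<phi>'' X (\<pi>'' X v)))"
    using 0(6) by auto
  note P' = retractD[OF r'] and P'' = retractD[OF r'']
  note p1 = rep_hom_proj1[OF P'(1) P''(1)] and p2 = rep_hom_proj2[OF P'(1) P''(1)]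
    and i1 = rep_hom_inj1[OF P'(1) P''(1)] and i2 = rep_hom_inj2[OF P'(1) P''(1)]
  let ?m = "length Xs"
  have XY: "set (Xs @ Ys) \<subseteq> Obj D" using P'(1) P''(1) by simp
  note R = is_representation_R[OF XY] and R' = is_representation_R[OF P'(1)]
    and R'' = is_representation_R[OF P''(1)]
  obtain s where s: "rep_hom D M'' M s"
    and qs: "\<And>Y v. \<lbrakk>Y \<in> Obj D; v \<in> Val M'' Y\<rbrakk> \<Longrightarrow> q Y (s Y v) = v"
    using retract_lift[OF r'' ex(2) ex(5) rep_hom_id] ex(7) by metis
  \<comment> \<open>\<open>s\<close> splits \<open>q\<close> because \<open>M''\<close> is
    projective, and \<open>k\<close> is the corresponding retraction of \<open>M\<close> onto
    \<open>M'\<close>.\<close>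
  define k where "k = (\<lambda>X v. v - s X (q X v))"
  have k: "rep_hom D M M' k"
  proof -
    have "rep_hom D M M k"
      unfolding k_def by (rule rep_hom_minus[OF rep_hom_id rep_hom_compose[OF ex(5) s] ex(2)])
    moreover have "k X v \<in> Val M' X" if "X \<in> Obj D" "v \<in> Val M X" for X v
      using that rep_hom_in[OF calculation that]
      by (simp add: ex(6) k_def rep_hom_diff[OF ex(5) _ ex(2)] qs rep_hom_in[OF ex(5)] rep_hom_in[OF s])
    ultimately show ?thesis
      using rep_hom_nat[OF ex(4)] by (simp add: rep_hom_def linear_map_on_def)
  qed
  have k_id: "k X v = v" if "X \<in> Obj D" "v \<in> Val M' X" for X v
    using that by (simp add: k_def ex(6) rep_hom_zero[OF s _ ex(3)])
  have ks: "k X (s X v) = 0" if "X \<in> Obj D" "v \<in> Val M'' X" for X v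
    using that by (simp add: k_def qs)
  define \<pi> where "\<pi> = (\<lambda>X v. \<pi>' X (proj1 ?m v) + s X (\<pi>'' X (proj2 ?m v)))"
  define \<iota> where "\<iota> = (\<lambda>X v. \<iota>' X (k X v) + inj2 ?m (\<iota>'' X (q X v)))"
  have pi: "rep_hom D (R (Xs @ Ys)) M \<pi>"
    unfolding \<pi>_def
    by (rule rep_hom_plus[OF rep_hom_compose[OF rep_hom_compose[OF p1 P'(4)] ex(4)]
          rep_hom_compose[OF rep_hom_compose[OF p2 P''(4)] s] ex(2)])
  have iota: "rep_hom D M (R (Xs @ Ys)) \<iota>"
    unfolding \<iota>_def
    by (rule rep_hom_plus[OF rep_hom_compose[OF rep_hom_compose[OF k P'(3)] i1]
          rep_hom_compose[OF rep_hom_compose[OF ex(5) P''(3)] i2] R])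
  have p1i: "proj1 ?m (\<iota> X v) = \<iota>' X (k X v)" and p2i: "proj2 ?m (\<iota> X v) = \<iota>'' X (q X v)"
    if X: "X \<in> Obj D" "v \<in> Val M X" for X v
  proof -
    have "\<iota>' X (k X v) \<in> Val (R Xs) X"
      using X by (simp add: rep_hom_in[OF P'(3)] rep_hom_in[OF k])
    moreover have "proj1 ?m (a + b) = proj1 ?m a + proj1 ?m b"
      "proj2 ?m (a + b) = proj2 ?m a + proj2 ?m b" for a b :: "nat \<Rightarrow> 'h"
      by (auto simp: proj1_def proj2_def)
    ultimately show "proj1 ?m (\<iota> X v) = \<iota>' X (k X v)" "proj2 ?m (\<iota> X v) = \<iota>'' X (q X v)"
      by (simp_all add: \<iota>_def proj1_inj1 proj1_inj2 proj2_inj1 proj2_inj2)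
  qed
  have "\<pi> X (\<iota> X v) = v" if X: "X \<in> Obj D" "v \<in> Val M X" for X v
  proof -
    have "\<pi> X (\<iota> X v) = k X v + s X (q X v)"
      using X by (simp add: \<pi>_def p1i p2i P'(5) P''(5) rep_hom_in[OF k] rep_hom_in[OF ex(5)])
    then show ?thesis by (simp add: k_def)
  qed
  then have r: "retract (Xs @ Ys) M \<iota> \<pi>"
    unfolding retract_def using XY ex(2) pi iota by blast
  \<comment> \<open>The diagonal blocks of \<open>\<iota> \<phi> \<pi>\<close> are the endomorphisms
    whose traces are \<open>t'\<close> and \<open>t''\<close>; the off-diagonal blocks do not enter
    \<open>tr_append\<close>.\<close>
  have "proj1 ?m (\<iota> X (\<phi> X (\<pi> X v))) = \<iota>' X (\<phi>' X (\<pi>' X v))"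
    if X: "X \<in> Obj D" "v \<in> Val (R Xs) X" for X v
  proof -
    have "\<pi> X v = \<pi>' X v"
      using X by (simp add: \<pi>_def proj1_inj1 proj2_inj1 rep_hom_zero[OF P''(4) _ R'']
          rep_hom_zero[OF s _ ex(3)])
    moreover have *: "\<phi>' X (\<pi>' X v) \<in> Val M' X"
      by (rule rep_hom_in[OF fh' X(1) rep_hom_in[OF P'(4) X]])
    moreover have "\<phi> X (\<pi>' X v) = \<phi>' X (\<pi>' X v)"
      using X by (simp add: f' rep_hom_in[OF P'(4)])
    moreover from * X have "\<phi>' X (\<pi>' X v) \<in> Val M X" by (simp add: ex(6))
    ultimately show ?thesis using X by (simp add: p1i k_id)
  qed
  moreover have "proj2 ?m (\<iota> X (\<phi> X (\<pi> X (inj2 ?m v)))) = \<iota>'' X (\<phi>'' X (\<pi>'' X v))"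
    if X: "X \<in> Obj D" "v \<in> Val (R Ys) X" for X v
  proof -
    have "\<pi> X (inj2 ?m v) = s X (\<pi>'' X v)"
      using X by (simp add: \<pi>_def proj1_inj2 proj2_inj2 rep_hom_zero[OF P'(4) _ R'])
    then show ?thesis
      using X by (simp add: p2i f'' qs rep_hom_in[OF f] rep_hom_in[OF s] rep_hom_in[OF P''(4)])
  qed
  ultimately have "tr (Xs @ Ys) (\<lambda>X v. \<iota> X (\<phi> X (\<pi> X v))) = t' + t''"
    unfolding tr_append t' t''
    by (intro arg_cong2[of _ _ _ _ "(+)"] tr_cong P'(1) P''(1))
  then show ?case using has_trace_retract[OF r f] by (simp only:)
next
  case (Suc n)
  note ex = exact_seqD[OF Suc(2)]
  note f = Suc(3) and f' = Suc(4) and f'' = Suc(5)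
  obtain Xs \<epsilon>' \<psi>' u' where Xs: "set Xs \<subseteq> Obj D" and fh': "rep_hom D M' M' \<phi>'"
    and e': "rep_hom D (R Xs) M' \<epsilon>'" and g': "rep_hom D (R Xs) (R Xs) \<psi>'"
    and surj': "\<And>X. X \<in> Obj D \<Longrightarrow> \<epsilon>' X ` Val (R Xs) X = Val M' X"
    and comm': "\<And>X v. X \<in> Obj D \<Longrightarrow> v \<in> Val (R Xs) X \<Longrightarrow> \<epsilon>' X (\<psi>' X v) = \<phi>' X (\<epsilon>' X v)"
    and u': "has_trace n (kernel (R Xs) \<epsilon>') \<psi>' u'" and t': "t' = tr Xs \<psi>' - u'"
    using Suc(6) by auto
  obtain Ys \<epsilon>'' \<psi>'' u'' where Ys: "set Ys \<subseteq> Obj D" and fh'': "rep_hom D M'' M'' \<phi>''"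
    and e'': "rep_hom D (R Ys) M'' \<epsilon>''" and g'': "rep_hom D (R Ys) (R Ys) \<psi>''"
    and surj'': "\<And>X. X \<in> Obj D \<Longrightarrow> \<epsilon>'' X ` Val (R Ys) X = Val M'' X"
    and comm'': "\<And>X v. X \<in> Obj D \<Longrightarrow> v \<in> Val (R Ys) X \<Longrightarrow> \<epsilon>'' X (\<psi>'' X v) = \<phi>'' X (\<epsilon>'' X v)"
    and u'': "has_trace n (kernel (R Ys) \<epsilon>'') \<psi>'' u''" and t'': "t'' = tr Ys \<psi>'' - u''"
    using Suc(7) by auto
  note p1 = rep_hom_proj1[OF Xs Ys] and p2 = rep_hom_proj2[OF Xs Ys]
    and i1 = rep_hom_inj1[OF Xs Ys] and i2 = rep_hom_inj2[OF Xs Ys]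
  let ?m = "length Xs"
  have XY: "set (Xs @ Ys) \<subseteq> Obj D" using Xs Ys by simp
  note R = is_representation_R[OF XY] and R' = is_representation_R[OF Xs]
    and R'' = is_representation_R[OF Ys]
  obtain \<sigma> where s: "rep_hom D (R Ys) M \<sigma>"
    and qs: "\<And>Y v. \<lbrakk>Y \<in> Obj D; v \<in> Val (R Ys) Y\<rbrakk> \<Longrightarrow> q Y (\<sigma> Y v) = \<epsilon>'' Y v"
    using R_lift[OF Ys ex(2) ex(5) e''] ex(7) rep_hom_in[OF e''] by metis
  note e'M = rep_hom_compose[OF e' ex(4)]
  \<comment> \<open>\<open>\<sigma>\<close> need not intertwine \<open>\<psi>''\<close> with
    \<open>\<phi>\<close>. The defect \<open>\<phi> \<sigma> - \<sigma> \<psi>''\<close> is killed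
    by \<open>q\<close>, because both terms become \<open>\<phi>'' \<epsilon>''\<close>; so it takes
    values in \<open>M'\<close> and lifts through \<open>\<epsilon>'\<close> to
    \<open>h\<close>.\<close>
  note d = rep_hom_minus[OF rep_hom_compose[OF s f] rep_hom_compose[OF g'' s] ex(2)]
  have d_im: "\<phi> X (\<sigma> X v) - \<sigma> X (\<psi>'' X v) \<in> \<epsilon>' X ` Val (R Xs) X"
    if X: "X \<in> Obj D" "v \<in> Val (R Ys) X" for X v
    using X rep_hom_in[OF d X]
    by (simp add: surj' ex(6) rep_hom_diff[OF ex(5) _ ex(2)] f'' qs comm'' rep_hom_in[OF f]
        rep_hom_in[OF s] rep_hom_in[OF g''])
  obtain h where h: "rep_hom D (R Ys) (R Xs) h"
    and eh: "\<And>Y v. \<lbrakk>Y \<in> Obj D; v \<in> Val (R Ys) Y\<rbrakk> \<Longrightarrow> \<epsilon>' Y (h Y v) = \<phi> Y (\<sigma> Y v) - \<sigma> Y (\<psi>'' Y v)"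
    using R_lift[OF Ys R' e'M d d_im] by metis
  define \<epsilon> where "\<epsilon> = (\<lambda>X v. \<epsilon>' X (proj1 ?m v) + \<sigma> X (proj2 ?m v))"
  \<comment> \<open>A block triangular lift of \<open>\<phi>\<close>: the corner \<open>h\<close>
    repairs the defect of \<open>\<sigma>\<close>, and the diagonal blocks stay
    \<open>\<psi>'\<close> and \<open>\<psi>''\<close>.\<close>
  define \<psi> where "\<psi> = (\<lambda>X v. (\<psi>' X (proj1 ?m v) + h X (proj2 ?m v)) + inj2 ?m (\<psi>'' X (proj2 ?m v)))"
  have e: "rep_hom D (R (Xs @ Ys)) M \<epsilon>"
    unfolding \<epsilon>_def
    by (rule rep_hom_plus[OF rep_hom_compose[OF p1 e'M] rep_hom_compose[OF p2 s] ex(2)])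
  have top: "rep_hom D (R (Xs @ Ys)) (R Xs) (\<lambda>X v. \<psi>' X (proj1 ?m v) + h X (proj2 ?m v))"
    by (rule rep_hom_plus[OF rep_hom_compose[OF p1 g'] rep_hom_compose[OF p2 h] R'])
  have g: "rep_hom D (R (Xs @ Ys)) (R (Xs @ Ys)) \<psi>"
    unfolding \<psi>_def
    by (rule rep_hom_plus[OF rep_hom_compose[OF top i1]
          rep_hom_compose[OF rep_hom_compose[OF p2 g''] i2] R])
  have add: "proj1 ?m (a + b) = proj1 ?m a + proj1 ?m b"
    "proj2 ?m (a + b) = proj2 ?m a + proj2 ?m b" for a b :: "nat \<Rightarrow> 'h"
    by (auto simp: proj1_def proj2_def)
  have p1g: "proj1 ?m (\<psi> X v) = \<psi>' X (proj1 ?m v) + h X (proj2 ?m v)"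
    and p2g: "proj2 ?m (\<psi> X v) = \<psi>'' X (proj2 ?m v)"
    if X: "X \<in> Obj D" "v \<in> Val (R (Xs @ Ys)) X" for X v
    using rep_hom_in[OF top X] proj1_inj2 proj2_inj1 proj2_inj2 proj1_inj1
    by (simp_all add: \<psi>_def add[of "_ + _" "inj2 _ _"])
  have inj: "proj1 ?m v = v" "proj2 ?m v = 0" "v \<in> Val (R (Xs @ Ys)) X"
    if "X \<in> Obj D" "v \<in> Val (R Xs) X" for X v
    using proj1_inj1[OF that(2)] proj2_inj1[OF that(2)] rep_hom_in[OF i1 that] by auto
  have e_inj: "\<epsilon> X v = \<epsilon>' X v" if "X \<in> Obj D" "v \<in> Val (R Xs) X" for X v
    using that by (simp add: \<epsilon>_def inj[OF that] rep_hom_zero[OF s _ R''])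
  have g_inj: "\<psi> X v = \<psi>' X v" if "X \<in> Obj D" "v \<in> Val (R Xs) X" for X v
    using that by (simp add: \<psi>_def inj2_zero inj[OF that] rep_hom_zero[OF h _ R''] rep_hom_zero[OF g'' _ R''])
  have qe: "q X (\<epsilon> X v) = \<epsilon>'' X (proj2 ?m v)" if X: "X \<in> Obj D" "v \<in> Val (R (Xs @ Ys)) X" for X v
  proof -
    have v: "proj1 ?m v \<in> Val (R Xs) X" "proj2 ?m v \<in> Val (R Ys) X"
      using X rep_hom_in[OF p1] rep_hom_in[OF p2] by auto
    then have "\<epsilon>' X (proj1 ?m v) \<in> Val M X" "q X (\<epsilon>' X (proj1 ?m v)) = 0"
      using rep_hom_in[OF e' X(1) v(1)] X by (auto simp: ex(6))
    then show ?thesis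
      using v X by (simp add: \<epsilon>_def rep_hom_add[OF ex(5)] rep_hom_in[OF s] qs zero_fun_def)
  qed
  have surj: "\<epsilon> X ` Val (R (Xs @ Ys)) X = Val M X" if X: "X \<in> Obj D" for X
  proof
    show "\<epsilon> X ` Val (R (Xs @ Ys)) X \<subseteq> Val M X" using X rep_hom_in[OF e] by auto
    show "Val M X \<subseteq> \<epsilon> X ` Val (R (Xs @ Ys)) X"
    proof
      fix w assume w: "w \<in> Val M X"
      then have "q X w \<in> \<epsilon>'' X ` Val (R Ys) X" using X rep_hom_in[OF ex(5)] by (simp add: surj'')
      then obtain y where y: "y \<in> Val (R Ys) X" "q X w = \<epsilon>'' X y" by auto
      then have "w - \<sigma> X y \<in> Val M' X"
        using X w by (simp add: ex(6) rep_diff[OF ex(2)] rep_hom_in[OF s] rep_hom_diff[OF ex(5) _ ex(2)] qs)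
      then obtain x where x: "x \<in> Val (R Xs) X" "w - \<sigma> X y = \<epsilon>' X x" using surj'[OF X] by auto
      have "x + inj2 ?m y \<in> Val (R (Xs @ Ys)) X"
        using X x y by (intro rep_add[OF R] inj(3) rep_hom_in[OF i2])
      moreover have "\<epsilon> X (x + inj2 ?m y) = w"
        using x(2) by (simp add: \<epsilon>_def add inj[OF X x(1)] proj1_inj2 proj2_inj2 eq_diff_eq diff_eq_eq)
      ultimately show "w \<in> \<epsilon> X ` Val (R (Xs @ Ys)) X" by force
    qed
  qed
  have comm: "\<epsilon> X (\<psi> X v) = \<phi> X (\<epsilon> X v)" if X: "X \<in> Obj D" "v \<in> Val (R (Xs @ Ys)) X" for X v
  proof -
    have v: "proj1 ?m v \<in> Val (R Xs) X" "proj2 ?m v \<in> Val (R Ys) X"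
      using X rep_hom_in[OF p1] rep_hom_in[OF p2] by auto
    have e'v: "\<epsilon>' X (proj1 ?m v) \<in> Val M' X" using rep_hom_in[OF e' X(1) v(1)] .
    then have "\<phi>' X (\<epsilon>' X (proj1 ?m v)) = \<phi> X (\<epsilon>' X (proj1 ?m v))" "\<epsilon>' X (proj1 ?m v) \<in> Val M X"
      using X by (auto simp: f' ex(6))
    then show ?thesis
      using X v
      by (simp add: \<epsilon>_def p1g[OF X] p2g[OF X] rep_hom_add[OF e'] rep_hom_add[OF f] rep_hom_in[OF g']
          rep_hom_in[OF h] rep_hom_in[OF s] comm' eh)
  qed
  let ?K' = "kernel (R Xs) \<epsilon>'" and ?K = "kernel (R (Xs @ Ys)) \<epsilon>" and ?K'' = "kernel (R Ys) \<epsilon>''"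
  have exK: "exact_seq ?K' ?K ?K'' (\<lambda>X. proj2 ?m)"
    unfolding exact_seq_def
  proof (intro conjI ballI)
    show "is_representation D ?K'" "is_representation D ?K" "is_representation D ?K''"
      using is_representation_kernel R R' R'' e e' e'' ex by blast+
    show "rep_hom D ?K' ?K (\<lambda>X v. v)"
      by (rule rep_hom_to_kernel[OF rep_hom_from_kernel[OF i1]]) (simp add: Val_kernel e_inj)
    show p2K: "rep_hom D ?K ?K'' (\<lambda>X. proj2 ?m)"
      by (rule rep_hom_to_kernel[OF rep_hom_from_kernel[OF p2]])
        (auto simp: Val_kernel qe[symmetric] rep_hom_zero[OF ex(5) _ ex(2)])
    fix X assume X: "X \<in> Obj D"
    show "Val ?K' X = {v \<in> Val ?K X. proj2 ?m v = 0}"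
    proof (intro equalityI subsetI)
      fix v assume "v \<in> Val ?K' X"
      then show "v \<in> {v \<in> Val ?K X. proj2 ?m v = 0}"
        using X inj e_inj by (simp add: Val_kernel)
    next
      fix v assume v: "v \<in> {v \<in> Val ?K X. proj2 ?m v = 0}"
      then have "proj1 ?m v = v"
        using proj1_plus_inj2[of ?m v] by (simp add: inj2_zero)
      then have "v \<in> Val (R Xs) X"
        using v rep_hom_in[OF p1 X, of v] by (simp add: Val_kernel)
      then show "v \<in> Val ?K' X"
        using v e_inj[OF X] by (simp add: Val_kernel)
    qed
    show "proj2 ?m ` Val ?K X = Val ?K'' X"
    proof
      show "proj2 ?m ` Val ?K X \<subseteq> Val ?K'' X" using rep_hom_in[OF p2K X] by auto
      show "Val ?K'' X \<subseteq> proj2 ?m ` Val ?K X"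
      proof
        fix y assume "y \<in> Val ?K'' X"
        then have y: "y \<in> Val (R Ys) X" "\<epsilon>'' X y = 0" by (auto simp: Val_kernel)
        then have "\<sigma> X y \<in> Val M' X"
          using X by (simp add: ex(6) rep_hom_in[OF s] qs)
        then obtain x where x: "x \<in> Val (R Xs) X" "\<sigma> X y = \<epsilon>' X x" using surj'[OF X] by auto
        \<comment> \<open>\<open>inj2 ?m y\<close> is mapped to \<open>\<sigma> X y\<close>, which
          lies in \<open>M'\<close>; the correction by \<open>x\<close> brings it into the kernel
          without changing the second component.\<close>
        have "inj2 ?m y - x \<in> Val (R (Xs @ Ys)) X"
          using X x y by (intro rep_diff[OF R] inj(3) rep_hom_in[OF i2])
        moreover have "\<epsilon> X (inj2 ?m y) = \<sigma> X y"
          using X by (simp add: \<epsilon>_def proj1_inj2 proj2_inj2 rep_hom_zero[OF e' _ R'])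
        then have "\<epsilon> X (inj2 ?m y - x) = 0"
          using X x y by (simp add: rep_hom_diff[OF e _ R] e_inj inj(3) rep_hom_in[OF i2])
        moreover have "proj2 ?m (inj2 ?m y - x) = y"
          using proj2_inj2[of ?m y] inj(2)[OF X x(1)] by (simp add: proj2_def fun_eq_iff)
        ultimately show "y \<in> proj2 ?m ` Val ?K X"
          by (force simp: Val_kernel)
      qed
    qed
  qed
  have gK: "rep_hom D ?K ?K \<psi>"
    by (rule rep_hom_to_kernel[OF rep_hom_from_kernel[OF g]])
      (simp add: Val_kernel comm rep_hom_zero[OF f _ ex(2)])
  have "has_trace n ?K \<psi> (u' + u'')"
    by (rule Suc.IH[OF exK gK _ _ u' u'']) (simp_all add: Val_kernel g_inj p2g)
  moreover have "tr (Xs @ Ys) \<psi> = tr Xs \<psi>' + tr Ys \<psi>''"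
    unfolding tr_append
  proof (intro arg_cong2[of _ _ _ _ "(+)"] tr_cong Xs Ys)
    fix X v assume "X \<in> Obj D" "v \<in> Val (R Xs) X"
    then show "proj1 ?m (\<psi> X v) = \<psi>' X v"
      by (simp add: g_inj proj1_inj1[OF rep_hom_in[OF g']])
  next
    fix X v assume "X \<in> Obj D" "v \<in> Val (R Ys) X"
    then show "proj2 ?m (\<psi> X (inj2 ?m v)) = \<psi>'' X v"
      by (simp add: p2g rep_hom_in[OF i2] proj2_inj2)
  qed
  then have "t' + t'' = tr (Xs @ Ys) \<psi> - (u' + u'')"
    by (simp add: t' t'')
  ultimately show ?case
    unfolding has_trace.simps(2) using ex(2) f XY e g surj comm by blast
qed

text \<open>The zero module is a retract of the empty sum. It closes resolutions and starts the
  induction over composition series.\<close>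

lemma has_trace_Val_zero:
  assumes "is_representation D M" "\<And>X. X \<in> Obj D \<Longrightarrow> Val M X = {0}" "rep_hom D M M \<phi>"
  shows "has_trace n M \<phi> 0"
proof -
  have N: "is_representation D (R [])" by (rule is_representation_R) simp
  have "retract [] M (\<lambda>X v. 0) (\<lambda>X v. 0)"
    unfolding retract_def using assms rep_hom_const_zero[OF N] rep_hom_const_zero[OF assms(1)] by simp
  from has_trace_retract[OF this assms(3)] have "has_trace 0 M \<phi> 0"
    by (simp add: tr_def del: has_trace.simps)
  then show ?thesis by (rule has_trace_mono) simp
qed

text \<open>
  The free cover of \<open>M\<close> through \<open>P\<close> has as kernel an extension of the syzygy \<open>ker d\<close> by the
  complement of \<open>P\<close>, so additivity trades projective resolutions for those in \<open>has_trace\<close>.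
\<close>

lemma has_trace_zero_cover:
  assumes r: "retract Xs P \<iota> \<pi>" and M: "is_representation D M" and d: "rep_hom D P M d"
    and surj: "\<And>X. X \<in> Obj D \<Longrightarrow> d X ` Val P X = Val M X"
    and K: "has_trace n (kernel P d) (\<lambda>X v. 0) 0"
  shows "has_trace (Suc n) M (\<lambda>X v. 0) 0"
proof -
  note P = retractD[OF r]
  note R = is_representation_R[OF P(1)]
  define \<epsilon> where "\<epsilon> = (\<lambda>X v. d X (\<pi> X v))"
  have e: "rep_hom D (R Xs) M \<epsilon>" unfolding \<epsilon>_def by (rule rep_hom_compose[OF P(4) d])
  note pi_surj = retract_surj[OF r]
  have e_surj: "\<epsilon> X ` Val (R Xs) X = Val M X" if "X \<in> Obj D" for X
    using surj[OF that] pi_surj[OF that] by (simp add: \<epsilon>_def image_image[symmetric])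
  have Ke: "is_representation D (kernel (R Xs) \<epsilon>)"
    by (rule is_representation_kernel[OF R M e])
  have Kp: "is_representation D (kernel (R Xs) \<pi>)"
    by (rule is_representation_kernel[OF R P(2) P(4)])
  have ex: "exact_seq (kernel (R Xs) \<pi>) (kernel (R Xs) \<epsilon>) (kernel P d) \<pi>"
    unfolding exact_seq_def
  proof (intro conjI ballI Ke Kp is_representation_kernel[OF P(2) M d])
    show "rep_hom D (kernel (R Xs) \<pi>) (kernel (R Xs) \<epsilon>) (\<lambda>X v. v)"
      by (rule rep_hom_to_kernel[OF rep_hom_from_kernel[OF rep_hom_id]])
        (simp add: Val_kernel \<epsilon>_def rep_hom_zero[OF d _ P(2)])
    show "rep_hom D (kernel (R Xs) \<epsilon>) (kernel P d) \<pi>"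
      by (rule rep_hom_to_kernel[OF rep_hom_from_kernel[OF P(4)]]) (simp add: Val_kernel \<epsilon>_def)
    fix X assume X: "X \<in> Obj D"
    show "Val (kernel (R Xs) \<pi>) X = {v \<in> Val (kernel (R Xs) \<epsilon>) X. \<pi> X v = 0}"
      using X by (auto simp: Val_kernel \<epsilon>_def rep_hom_zero[OF d _ P(2)])
    show "\<pi> X ` Val (kernel (R Xs) \<epsilon>) X = Val (kernel P d) X"
      using pi_surj[OF X] by (auto simp: Val_kernel \<epsilon>_def image_iff)
  qed
  have "has_trace 0 (kernel (R Xs) \<pi>) (\<lambda>X v. 0) 0"
    using has_trace_retract[OF retract_kernel[OF r] rep_hom_const_zero[OF Kp]]
    by (simp only: tr_zero[OF P(1)])
  then have "has_trace n (kernel (R Xs) \<pi>) (\<lambda>X v. 0) 0"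
    by (rule has_trace_mono) simp
  from has_trace_additive[OF ex rep_hom_const_zero[OF Ke] refl _ this K]
  have "has_trace n (kernel (R Xs) \<epsilon>) (\<lambda>X v. 0) 0"
    by (simp add: rep_hom_zero[OF P(4) _ R])
  then show ?thesis
    unfolding has_trace.simps(2)
    using M rep_hom_const_zero[OF M] P(1) e rep_hom_const_zero[OF R] e_surj
    by (intro conjI exI[of _ Xs] exI[of _ \<epsilon>] exI[of _ "\<lambda>X v. 0"] exI[of _ 0])
      (auto simp: rep_hom_zero[OF e _ R] tr_zero[OF P(1)])
qed

lemma projective_rep_retract:
  assumes "projective_rep D P"
  obtains Xs \<iota> \<pi> where "retract Xs P \<iota> \<pi>"
  using assms unfolding projective_rep_def is_direct_sum_def retract_def by blast

text \<open>The zero endomorphism lifts to zero on every term, whatever the projectives are.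
  Starting from the zero kernel of \<open>d n\<close> and covering one syzygy at a time takes
  \<open>n + 1\<close> steps, hence the length \<open>Suc n\<close>.\<close>

lemma has_trace_zero_resolution:
  assumes res: "projective_resolution D n M F d" and M: "is_representation D M"
  shows "has_trace (Suc n) M (\<lambda>X v. 0) 0"
proof -
  have proj: "\<And>i. i \<le> n \<Longrightarrow> projective_rep D (F i)"
    and d0: "rep_hom D (F 0) M (d 0)"
    and dS: "\<And>i. i < n \<Longrightarrow> rep_hom D (F (Suc i)) (F i) (d (Suc i))"
    and im0: "\<And>Y. Y \<in> Obj D \<Longrightarrow> d 0 Y ` Val (F 0) Y = Val M Y"
    and imS: "\<And>Y i. \<lbrakk>Y \<in> Obj D; i < n\<rbrakk> \<Longrightarrow>
      d (Suc i) Y ` Val (F (Suc i)) Y = {v \<in> Val (F i) Y. d i Y v = 0}"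
    and inj: "\<And>Y. Y \<in> Obj D \<Longrightarrow> {v \<in> Val (F n) Y. d n Y v = 0} = {0}"
    using res unfolding projective_resolution_def by blast+
  have F: "is_representation D (F i)" if "i \<le> n" for i
    using proj[OF that] by (simp add: projective_rep_def)
  have ker: "is_representation D (kernel (F i) (d i))" if "i \<le> n" for i
  proof (cases i)
    case 0
    then show ?thesis using is_representation_kernel[OF F M] d0 by simp
  next
    case (Suc j)
    then show ?thesis using is_representation_kernel[OF F F dS[of j]] that by simp
  qed
  have "k \<le> n \<Longrightarrow> has_trace k (kernel (F (n - k)) (d (n - k))) (\<lambda>X v. 0) 0" for k
  proof (induction k)
    case 0
    show ?case
      using ker[of n] inj by (intro has_trace_Val_zero rep_hom_const_zero) (auto simp: Val_kernel)
  next
    case (Suc k)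
    define i where "i = n - Suc k"
    have i: "n - k = Suc i" "i < n" using Suc.prems by (auto simp: i_def)
    obtain Xs \<iota> \<pi> where r: "retract Xs (F (Suc i)) \<iota> \<pi>"
      using projective_rep_retract[OF proj[of "Suc i"]] i by auto
    have d': "rep_hom D (F (Suc i)) (kernel (F i) (d i)) (d (Suc i))"
      using imS[OF _ i(2)] by (intro rep_hom_to_kernel dS[OF i(2)]) blast
    show ?case
      unfolding i_def[symmetric]
    proof (rule has_trace_zero_cover[OF r ker d'])
      show "has_trace k (kernel (F (Suc i)) (d (Suc i))) (\<lambda>X v. 0) 0"
        using Suc.IH Suc.prems by (simp only: i Suc_leD)
    qed (use i imS in \<open>simp_all add: Val_kernel\<close>)
  qed
  from this[of n] have K: "has_trace n (kernel (F 0) (d 0)) (\<lambda>X v. 0) 0" by simp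
  obtain Xs \<iota> \<pi> where r: "retract Xs (F 0) \<iota> \<pi>"
    using projective_rep_retract[OF proj[of 0]] by auto
  show ?thesis
    by (rule has_trace_zero_cover[OF r M d0 im0 K])
qed

end

section \<open>Endomorphism rings of indecomposable objects\<close>

text \<open>Hom-finiteness and trivial idempotents make the endomorphism rings local, with residue
  field K over an algebraically closed field; non-isomorphism of distinct objects then puts every
  morphism between them into the radical.\<close>

locale spectroid = hom_finite_category D
  for D :: "('k::alg_closed_field, 'o, 'h::ab_group_add) lincat" +
  assumes indecomposable: "X \<in> Obj D \<Longrightarrow> indecomposable D X"
    and not_isomorphic: "\<lbrakk>X \<in> Obj D; Y \<in> Obj D; X \<noteq> Y\<rbrakk> \<Longrightarrow> \<not> isomorphic_obj D X Y"
begin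

lemma Idn_nonzero: "X \<in> Obj D \<Longrightarrow> Idn D X \<noteq> 0"
  using indecomposable by (auto simp: indecomposable_def)

lemma idempotent_cases:
  "\<lbrakk>X \<in> Obj D; e \<in> Hom D X X; Comp D X X X e e = e\<rbrakk> \<Longrightarrow> e = 0 \<or> e = Idn D X"
  using indecomposable by (auto simp: indecomposable_def)

section \<open>Powers and polynomials of an endomorphism\<close>

definition epow :: "'o \<Rightarrow> 'h \<Rightarrow> nat \<Rightarrow> 'h" where
  "epow X f n = (Comp D X X X f ^^ n) (Idn D X)"

definition nilp :: "'o \<Rightarrow> 'h \<Rightarrow> bool" where
  "nilp X f \<longleftrightarrow> f \<in> Hom D X X \<and> (\<exists>n. epow X f n = 0)"

text \<open>The substitution homomorphism from K[t] to End(X), written as Horner's scheme; End(X) is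
  a subset of the ambient type and not a ring type, so it is built by hand from
  \<open>Comp\<close>.\<close>

definition peval :: "'o \<Rightarrow> 'h \<Rightarrow> 'k poly \<Rightarrow> 'h" where
  "peval X f p = fold_coeffs (\<lambda>a e. Smult D a (Idn D X) + Comp D X X X f e) p 0"

context
  fixes X f
  assumes X: "X \<in> Obj D" and f: "f \<in> Hom D X X"
begin

lemma epow_0: "epow X f 0 = Idn D X"
  and epow_Suc: "epow X f (Suc n) = Comp D X X X f (epow X f n)"
  by (simp_all add: epow_def)

lemma epow_in: "epow X f n \<in> Hom D X X"
  by (induction n) (simp_all add: epow_0 epow_Suc Idn_in_Hom Comp_in_Hom X f)

lemma epow_scale: "epow X (Smult D a f) n = Smult D (a ^ n) (epow X f n)"
proof (induction n)
  case 0
  then show ?case by (simp add: epow_def)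
next
  case (Suc n)
  then have "epow X (Smult D a f) (Suc n) = Comp D X X X (Smult D a f) (Smult D (a ^ n) (epow X f n))"
    by (simp add: epow_def)
  then show ?case
    by (simp add: Comp_scale_left Comp_scale_right X f epow_in scale_in_Hom epow_Suc)
qed

lemma peval_0: "peval X f 0 = 0"
  by (simp add: peval_def)

lemma peval_pCons: "peval X f (pCons a p) = Smult D a (Idn D X) + Comp D X X X f (peval X f p)"
  by (cases "p = 0"; cases "a = 0") (auto simp: peval_def Comp_zero_right X f)

lemma peval_in: "peval X f p \<in> Hom D X X"
  by (induction p) (auto simp: peval_0 peval_pCons X f zero_in_Hom Idn_in_Hom intro!: add_in_Hom scale_in_Hom Comp_in_Hom)

lemma peval_add: "peval X f (p + q) = peval X f p + peval X f q"
proof (induction p q rule: poly_induct2)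
  case (pCons a p b q)
  then show ?case
    by (simp add: peval_pCons Comp_add_right X f peval_in scale_left_distrib ac_simps)
qed (simp add: peval_0)

lemma peval_smult: "peval X f (smult c p) = Smult D c (peval X f p)"
  by (induction p) (auto simp: peval_0 peval_pCons Comp_scale_right X f peval_in scale_right_distrib)

lemma peval_mult: "peval X f (p * q) = Comp D X X X (peval X f p) (peval X f q)"
proof (induction p)
  case 0
  then show ?case by (simp add: peval_0 Comp_zero_left X peval_in)
next
  case (pCons a p)
  have "peval X f (pCons a p * q) = Smult D a (peval X f q) +
      Comp D X X X f (Comp D X X X (peval X f p) (peval X f q))"
    by (simp add: mult_pCons_left peval_add peval_smult peval_pCons pCons)
  also have "\<dots> = Comp D X X X (peval X f (pCons a p)) (peval X f q)"
    by (simp add: peval_pCons Comp_add_left Comp_scale_left Comp_Idn_left Comp_assoc X f peval_in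
        Idn_in_Hom scale_in_Hom Comp_in_Hom)
  finally show ?case .
qed

lemma peval_const: "peval X f [:c:] = Smult D c (Idn D X)"
  by (simp add: peval_pCons peval_0 Comp_zero_right X f)

lemma peval_1: "peval X f 1 = Idn D X"
  using peval_const[of 1] by (simp add: one_pCons)

lemma peval_linear: "peval X f [:c, 1:] = Smult D c (Idn D X) + f"
  by (simp add: peval_pCons peval_0 Comp_zero_right X f Comp_Idn_right)

lemma peval_power: "peval X f (p ^ n) = epow X (peval X f p) n"
  by (induction n) (simp_all add: peval_1 peval_mult epow_def)

lemma peval_sum: "peval X f (sum p I) = (\<Sum>i\<in>I. peval X f (p i))"
  by (induction I rule: infinite_finite_induct) (simp_all add: peval_0 peval_add)

lemma peval_monom: "peval X f (monom c n) = Smult D c (epow X f n)"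
proof -
  have "monom c n = smult c ([:0, 1:] ^ n)"
    by (simp add: monom_altdef)
  then show ?thesis
    by (simp add: peval_smult peval_power peval_linear)
qed

text \<open>\<open>card B + 1\<close> powers lie in a space spanned by \<open>card B\<close>
  elements. Linear dependence is a notion for sets, so a repetition among the powers is treated
  apart; it gives a difference of two monomials.\<close>

lemma annihilating_poly: "\<exists>p. p \<noteq> 0 \<and> peval X f p = 0"
proof -
  obtain B where B: "finite B" "Hom D X X \<subseteq> span B"
    using finite_dim_Hom[OF X X] by (auto simp: finite_dim_def)
  show ?thesis
  proof (cases "inj_on (epow X f) {..card B}")
    case False
    then obtain i j where ij: "i \<noteq> j" "epow X f i = epow X f j"
      by (auto simp: inj_on_def)
    have "peval X f (monom 1 i + monom (-1) j) = 0"
      using ij(2) by (simp add: peval_add peval_monom)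
    moreover have "coeff (monom 1 i + monom (-1) j) i \<noteq> (0 :: 'k)"
      using ij(1) by simp
    ultimately show ?thesis by (metis coeff_0)
  next
    case True
    let ?S = "epow X f ` {..card B}"
    have "card ?S = Suc (card B)" using card_image[OF True] by simp
    then have "dependent ?S"
      using independent_span_bound[OF B(1), of ?S] epow_in B(2) by fastforce
    then obtain u v where u: "v \<in> ?S" "u v \<noteq> 0" "(\<Sum>v\<in>?S. Smult D (u v) v) = 0"
      using dependent_finite[of ?S] by auto
    define p where "p = (\<Sum>i\<le>card B. monom (u (epow X f i)) i)"
    have "peval X f p = (\<Sum>i\<le>card B. Smult D (u (epow X f i)) (epow X f i))"
      by (simp add: p_def peval_sum peval_monom)
    also have "\<dots> = 0" using u(3) by (simp add: sum.reindex[OF True])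
    finally have "peval X f p = 0" .
    moreover from u(1) obtain i where i: "i \<le> card B" "v = epow X f i" by auto
    have "coeff p i = u v"
      using i by (simp add: p_def coeff_sum)
    then have "p \<noteq> 0" using u(2) by auto
    ultimately show ?thesis by blast
  qed
qed

text \<open>
  Splitting a minimal annihilating polynomial into coprime factors would produce a nontrivial
  idempotent.
\<close>

lemma nilp_shift: "\<exists>c. nilp X (f - Smult D c (Idn D X))"
proof -
  define p where "p = (ARG_MIN degree p. p \<noteq> 0 \<and> peval X f p = 0)"
  have p: "p \<noteq> 0" "peval X f p = 0"
    using arg_min_natI[of "\<lambda>p. p \<noteq> 0 \<and> peval X f p = 0" _ degree] annihilating_poly
    unfolding p_def by blast+
  have minimal: "degree p \<le> degree q" if "q \<noteq> 0" "peval X f q = 0" for q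
    using arg_min_nat_le[of "\<lambda>p. p \<noteq> 0 \<and> peval X f p = 0" q degree] that unfolding p_def by blast
  have "degree p \<noteq> 0"
  proof
    assume "degree p = 0"
    then obtain a where "p = [:a:]" by (rule degree_eq_zeroE)
    then show False using p Idn_nonzero[OF X] by (simp add: peval_const)
  qed
  \<comment> \<open>The root, which exists over an algebraically closed field, is the eigenvalue by
    which \<open>f\<close> gets shifted.\<close>
  then obtain c where c: "poly p c = 0"
    using alg_closed_imp_poly_has_root[of p] by auto
  define L where "L = [:-c, 1:]"
  define m where "m = order c p"
  obtain q where q: "p = L ^ m * q" "\<not> L dvd q"
    using order_decomp[OF p(1), of c] unfolding L_def m_def by blast
  have "m \<noteq> 0" using c p(1) by (simp add: m_def order_root)
  have qc: "poly q c \<noteq> 0" using q(2) by (simp add: L_def poly_eq_0_iff_dvd)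
  \<comment> \<open>\<open>b\<close> is \<open>q\<close> rescaled to take the value 1 at
    \<open>c\<close>, so \<open>L\<close> divides \<open>1 - b\<close> and \<open>L ^ m\<close>
    divides \<open>(1 - b) ^ m\<close>. As \<open>b\<close> divides \<open>1 - (1 - b) ^ m\<close>,
    this makes the Bezout identity for the coprime factors \<open>L ^ m\<close> and \<open>q\<close>
    explicit.\<close>
  define b where "b = smult (1 / poly q c) q"
  have "poly (1 - b) c = 0" using qc by (simp add: b_def)
  then have "L dvd 1 - b" unfolding L_def by (rule poly_eq_0_iff_dvd[THEN iffD1])
  then obtain w where w: "1 - b = L * w" ..
  have "1 - (1 - b) dvd 1 - (1 - b) ^ m"
    by (simp add: one_diff_power_eq)
  then obtain z where z: "1 - (1 - b) ^ m = b * z" by auto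
  define v where "v = smult (1 / poly q c) z"
  have bez: "L ^ m * w ^ m + v * q = 1"
  proof -
    have "L ^ m * w ^ m = (1 - b) ^ m" by (simp only: w power_mult_distrib)
    moreover have "v * q = b * z" by (simp add: v_def b_def mult.commute)
    ultimately show ?thesis using z by (metis add.commute diff_add_cancel)
  qed
  \<comment> \<open>The Chinese remainder idempotent: \<open>v * q\<close> is 0 modulo
    \<open>q\<close> and 1 modulo \<open>L ^ m\<close>, hence idempotent modulo
    \<open>p\<close>.\<close>
  define e where "e = peval X f (v * q)"
  have "v * q * (v * q) + w ^ m * v * p = v * q * (L ^ m * w ^ m + v * q)"
    by (simp add: q(1) algebra_simps)
  also have "\<dots> = v * q" by (simp only: bez mult_1_right)
  finally have "v * q * (v * q) + w ^ m * v * p = v * q" .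
  then have "peval X f (v * q * (v * q) + w ^ m * v * p) = e" by (simp add: e_def)
  then have "Comp D X X X e e = e"
    by (simp add: peval_add peval_mult[of "w ^ m * v" p] p(2) Comp_zero_right X peval_in e_def
        peval_mult[of "v * q" "v * q"])
  then consider "e = 0" | "e = Idn D X"
    using idempotent_cases[OF X peval_in, of "v * q"] by (auto simp: e_def)
  then show ?thesis
  proof cases
    case 1
    \<comment> \<open>If \<open>e = 0\<close>, then \<open>q\<close> already annihilates
      \<open>f\<close>, contrary to the minimality of \<open>p\<close>, since \<open>m\<close> is
      positive.\<close>
    have "w ^ m * p + q * (v * q) = q * (L ^ m * w ^ m + v * q)"
      by (simp add: q(1) algebra_simps)
    also have "\<dots> = q" by (simp only: bez mult_1_right)
    finally have "q = w ^ m * p + q * (v * q)" by (rule sym)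
    then have "peval X f q = peval X f (w ^ m * p + q * (v * q))" by (rule arg_cong)
    also have "\<dots> = Comp D X X X (peval X f (w ^ m)) 0 + Comp D X X X (peval X f q) e"
      by (simp only: e_def peval_add peval_mult p(2))
    also have "\<dots> = 0"
      by (simp only: 1 Comp_zero_right[OF X X X peval_in] add_0)
    finally have "peval X f q = 0" .
    moreover have "q \<noteq> 0" using qc by auto
    ultimately have "degree p \<le> degree q" by (intro minimal)
    moreover have "degree p = m + degree q"
    proof -
      have "degree p = degree (L ^ m) + degree q"
        unfolding q(1) by (rule degree_mult_eq) (use \<open>q \<noteq> 0\<close> in \<open>simp_all add: L_def\<close>)
      then show ?thesis by (simp add: degree_power_eq L_def)
    qed
    ultimately show ?thesis using \<open>m \<noteq> 0\<close> by simp
  next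
    case 2
    \<comment> \<open>If \<open>e\<close> is the identity, then \<open>L ^ m\<close> annihilates
      \<open>f\<close>, so the shift of \<open>f\<close> by \<open>c\<close> is nilpotent.\<close>
    have "peval X f (L ^ m) = Comp D X X X (peval X f (L ^ m)) e"
      by (simp only: 2 Comp_Idn_right[OF X X peval_in])
    also have "\<dots> = peval X f (L ^ m * (v * q))"
      by (simp only: e_def peval_mult)
    also have "L ^ m * (v * q) = v * p"
      by (simp add: q(1) algebra_simps)
    also have "peval X f (v * p) = 0"
      by (simp only: peval_mult p(2) Comp_zero_right[OF X X X peval_in])
    finally have "epow X (peval X f L) m = 0" by (simp add: peval_power)
    moreover have "peval X f L = f - Smult D c (Idn D X)"
      by (simp add: L_def peval_linear scale_minus_left)
    ultimately show ?thesis
      using peval_in[of L] by (auto simp: nilp_def)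
  qed
qed

text \<open>A power of \<open>t - c\<close> annihilates \<open>f\<close> and has nonzero constant
  term, so solving for the constant 1 exhibits the inverse as a polynomial in \<open>f\<close>; as
  such it is two-sided.\<close>

lemma shift_invertible:
  assumes "nilp X (f - Smult D c (Idn D X))" "c \<noteq> 0"
  obtains g where "g \<in> Hom D X X" "Comp D X X X g f = Idn D X" "Comp D X X X f g = Idn D X"
proof -
  define L where "L = [:-c, 1:]"
  have L: "peval X f L = f - Smult D c (Idn D X)"
    by (simp add: L_def peval_linear scale_minus_left)
  obtain m where "epow X (peval X f L) m = 0" using assms by (auto simp: nilp_def L)
  then have "peval X f (L ^ m) = 0" by (simp add: peval_power)
  obtain a s where as: "L ^ m = pCons a s" by (cases "L ^ m") auto
  have "a = poly (L ^ m) 0" by (simp add: as)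
  also have "\<dots> \<noteq> 0" using assms(2) by (simp add: L_def)
  finally have "a \<noteq> 0" .
  define g where "g = smult (- 1 / a) s"
  have "1 = g * [:0, 1:] + smult (1 / a) (L ^ m)"
    using \<open>a \<noteq> 0\<close> by (simp add: as one_pCons g_def)
  then have "peval X f 1 = peval X f (g * [:0, 1:] + smult (1 / a) (L ^ m))" by (rule arg_cong)
  then have "Idn D X = peval X f (g * [:0, 1:])"
    by (simp only: peval_1 peval_add peval_smult \<open>peval X f (L ^ m) = 0\<close> scale_zero_right add_0_right)
  then have "Idn D X = Comp D X X X (peval X f g) f" "Idn D X = Comp D X X X f (peval X f g)"
    using peval_mult[of g "[:0, 1:]"] peval_mult[of "[:0, 1:]" g] peval_linear[of 0]
    by (simp_all only: mult.commute[of g] scale_zero_left add_0)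
  then show thesis using that[OF peval_in] by metis
qed

text \<open>Locality of End(X): when \<open>f\<close> is written as a scalar plus a nilpotent, the
  scalar cannot vanish.\<close>

lemma invertible_if_not_nilp:
  assumes "\<not> nilp X f"
  obtains g where "g \<in> Hom D X X" "Comp D X X X g f = Idn D X" "Comp D X X X f g = Idn D X"
proof -
  obtain c where c: "nilp X (f - Smult D c (Idn D X))" using nilp_shift by blast
  with assms have "c \<noteq> 0" by auto
  with c show thesis using shift_invertible that by blast
qed

lemma nilp_no_left_inverse:
  assumes "nilp X f" "g \<in> Hom D X X" "Comp D X X X g f = Idn D X"
  shows False
proof -
  have "epow X f n \<noteq> 0" for n
  proof (induction n)
    case 0
    then show ?case using Idn_nonzero[OF X] by (simp add: epow_0)
  next
    case (Suc n)
    have "Comp D X X X g (epow X f (Suc n)) = epow X f n"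
      by (simp add: epow_Suc Comp_assoc X f assms epow_in Comp_Idn_left)
    then show ?case using Suc Comp_zero_right[OF X X X assms(2)] by auto
  qed
  then show False using assms(1) by (auto simp: nilp_def)
qed

end

section \<open>Radical morphisms and the simple representations\<close>

lemma nilp_in: "nilp X f \<Longrightarrow> f \<in> Hom D X X"
  by (simp add: nilp_def)

text \<open>The Jacobson radical of the category; between distinct objects it is everything, as
  these are non-isomorphic with local endomorphism rings.\<close>

definition radical :: "'o \<Rightarrow> 'o \<Rightarrow> 'h \<Rightarrow> bool" where
  "radical X Y f \<longleftrightarrow> f \<in> Hom D X Y \<and> (X = Y \<longrightarrow> nilp X f)"

text \<open>Otherwise \<open>f\<close> has a left inverse \<open>h\<close>, which no nilpotent
  endomorphism has. If X and Y differ, the idempotent \<open>f h\<close> of Y is 0 or the identity: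
  in the first case \<open>f\<close> vanishes and so does the identity of X, in the second X and Y
  are isomorphic.\<close>

lemma nilp_Comp_radical:
  assumes X: "X \<in> Obj D" and Y: "Y \<in> Obj D" and f: "radical X Y f" and g: "g \<in> Hom D Y X"
  shows "nilp X (Comp D X Y X g f)"
proof (rule ccontr)
  have fH: "f \<in> Hom D X Y" using f by (simp add: radical_def)
  assume "\<not> nilp X (Comp D X Y X g f)"
  then obtain u where u: "u \<in> Hom D X X" "Comp D X X X u (Comp D X Y X g f) = Idn D X"
    using invertible_if_not_nilp[OF X Comp_in_Hom[OF X Y X fH g]] by metis
  define h where "h = Comp D Y X X u g"
  have h: "h \<in> Hom D Y X" "Comp D X Y X h f = Idn D X"
    using u by (simp_all add: h_def Comp_in_Hom Comp_assoc X Y fH g flip: u(2))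
  show False
  proof (cases "X = Y")
    case True
    then show False using nilp_no_left_inverse[OF X] f h by (auto simp: radical_def nilp_in)
  next
    case False
    define e where "e = Comp D Y X Y f h"
    have e: "e \<in> Hom D Y Y" by (simp add: e_def Comp_in_Hom X Y fH h)
    have ef: "Comp D X Y Y e f = f"
      unfolding e_def
      using Comp_assoc[OF X Y X Y fH h(1) fH] by (simp add: h(2) Comp_Idn_right X Y fH)
    have "Comp D Y Y Y e e = Comp D Y X Y (Comp D X Y Y e f) h"
      using Comp_assoc[OF Y X Y Y h(1) fH e] by (simp add: e_def)
    then have "Comp D Y Y Y e e = e" by (simp add: ef flip: e_def)
    then consider "e = 0" | "e = Idn D Y" using idempotent_cases[OF Y e] by blast
    then show False
    proof cases
      case 1
      then have "f = 0" using ef Comp_zero_left[OF X Y Y fH] by simp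
      then show False using h Comp_zero_right[OF X Y X h(1)] Idn_nonzero[OF X] by simp
    next
      case 2
      then have "isomorphic_obj D X Y"
        using fH h by (auto simp: isomorphic_obj_def e_def)
      then show False using not_isomorphic[OF X Y False] by blast
    qed
  qed
qed

lemma nilp_radical: "nilp X f \<Longrightarrow> radical X X f"
  by (simp add: radical_def nilp_in)

lemma nilp_uminus: "\<lbrakk>X \<in> Obj D; nilp X f\<rbrakk> \<Longrightarrow> nilp X (- f)"
  using epow_scale[of X f "-1"] scale_in_Hom[of X X f "-1"]
  by (auto simp: nilp_def scale_minus_left)

text \<open>If a maximal left ideal missed \<open>r\<close>, then together with the multiples of
  \<open>r\<close> it would be everything, so it would contain \<open>1 - g r\<close> for some
  \<open>g\<close>; but \<open>g r\<close> is nilpotent and \<open>1 - g r\<close> a unit.\<close>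

lemma nilp_in_jacobson_radical:
  assumes X: "X \<in> Obj D" and r: "nilp X r"
  shows "r \<in> jacobson_radical_End D X"
  unfolding jacobson_radical_End_def
proof (intro CollectI conjI allI impI)
  show rH: "r \<in> Hom D X X" using r by (rule nilp_in)
  fix I assume max: "maximal_left_ideal_End D X I"
  then have I: "I \<subseteq> Hom D X X" "0 \<in> I" "\<And>f g. f \<in> I \<Longrightarrow> g \<in> I \<Longrightarrow> f - g \<in> I"
    "\<And>h f. h \<in> Hom D X X \<Longrightarrow> f \<in> I \<Longrightarrow> Comp D X X X h f \<in> I" "I \<noteq> Hom D X X"
    by (auto simp: maximal_left_ideal_End_def left_ideal_End_def)
  show "r \<in> I"
  proof (rule ccontr)
    assume "r \<notin> I"
    define I' where "I' = {i + Comp D X X X g r | i g. i \<in> I \<and> g \<in> Hom D X X}"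
    have I'I: "i + Comp D X X X g r \<in> I'" if "i \<in> I" "g \<in> Hom D X X" for i g
      using that by (auto simp: I'_def)
    have "left_ideal_End D X I'"
      unfolding left_ideal_End_def
    proof (intro conjI ballI)
      show "I' \<subseteq> Hom D X X"
        using I(1) X rH by (auto simp: I'_def intro!: add_in_Hom Comp_in_Hom)
      show "0 \<in> I'"
        using I'I[OF I(2) zero_in_Hom[OF X X]] by (simp add: Comp_zero_left X rH)
    next
      fix x y assume "x \<in> I'" "y \<in> I'"
      then obtain i g j h where 1: "x = i + Comp D X X X g r" "y = j + Comp D X X X h r"
        "i \<in> I" "g \<in> Hom D X X" "j \<in> I" "h \<in> Hom D X X" by (auto simp: I'_def)
      have "x - y = (i - j) + Comp D X X X (g - h) r"
        by (simp add: 1 Comp_diff_left X rH)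
      then show "x - y \<in> I'" using 1 I'I[OF I(3) diff_in_Hom] X by metis
    next
      fix h x assume "h \<in> Hom D X X" "x \<in> I'"
      then obtain i g where 1: "x = i + Comp D X X X g r" "i \<in> I" "g \<in> Hom D X X" "h \<in> Hom D X X"
        by (auto simp: I'_def)
      have "Comp D X X X h x = Comp D X X X h i + Comp D X X X (Comp D X X X h g) r"
        using subsetD[OF I(1)] by (simp add: 1 Comp_add_right Comp_assoc X rH Comp_in_Hom)
      then show "Comp D X X X h x \<in> I'" using 1 I'I[OF I(4) Comp_in_Hom] X by metis
    qed
    moreover have "i \<in> I'" if "i \<in> I" for i
      using I'I[OF that zero_in_Hom[OF X X]] by (simp add: Comp_zero_left X rH)
    moreover have "r \<in> I'"
      using I'I[OF I(2) Idn_in_Hom[OF X]] by (simp add: Comp_Idn_left X rH)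
    ultimately have "I' = Hom D X X"
      using max \<open>r \<notin> I\<close> unfolding maximal_left_ideal_End_def by blast
    then have "Idn D X \<in> I'" using Idn_in_Hom[OF X] by simp
    then obtain i g where ig: "Idn D X = i + Comp D X X X g r" "i \<in> I" "g \<in> Hom D X X"
      by (auto simp: I'_def)
    have "nilp X (- Comp D X X X g r)"
      by (intro nilp_uminus nilp_Comp_radical nilp_radical X r ig)
    moreover have "i - Smult D 1 (Idn D X) = - Comp D X X X g r"
      by (simp add: ig(1))
    ultimately obtain h where "h \<in> Hom D X X" "Comp D X X X h i = Idn D X"
      using shift_invertible[OF X, of i 1] ig(2) I(1) by (metis subsetD zero_neq_one)
    then have id: "Idn D X \<in> I" using I(4) ig(2) by metis
    have "Hom D X X \<subseteq> I"
      using I(4)[OF _ id] by (auto simp: Comp_Idn_right X)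
    then show False using I by blast
  qed
qed

text \<open>The nilpotent elements form a maximal left ideal, since everything else is invertible,
  and the identity is not among them.\<close>

lemma Idn_notin_jacobson_radical:
  assumes X: "X \<in> Obj D"
  shows "Idn D X \<notin> jacobson_radical_End D X"
proof -
  let ?N = "{f. nilp X f}"
  have id: "\<not> nilp X (Idn D X)"
    using nilp_no_left_inverse[OF X Idn_in_Hom[OF X] _ Idn_in_Hom[OF X]] X by (auto simp: Comp_Idn_left Idn_in_Hom)
  have mult: "nilp X (Comp D X X X h f)" if "h \<in> Hom D X X" "nilp X f" for h f
    by (intro nilp_Comp_radical nilp_radical X that)
  have "left_ideal_End D X ?N"
    unfolding left_ideal_End_def
  proof (intro conjI ballI)
    show "?N \<subseteq> Hom D X X" by (auto simp: nilp_in)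
    have "epow X 0 1 = 0" by (simp add: epow_def Comp_zero_left X Idn_in_Hom)
    then show "0 \<in> ?N" using zero_in_Hom[OF X X] by (auto simp: nilp_def)
  next
    fix f g assume fg: "f \<in> ?N" "g \<in> ?N"
    show "f - g \<in> ?N"
    proof (rule ccontr)
      assume "f - g \<notin> ?N"
      then obtain u where u: "u \<in> Hom D X X" "Comp D X X X u (f - g) = Idn D X"
        using invertible_if_not_nilp[OF X diff_in_Hom[OF X X]] fg nilp_in by (metis mem_Collect_eq)
      \<comment> \<open>From \<open>u (f - g) = 1\<close> it follows that \<open>u g\<close> is -1
        plus the nilpotent \<open>u f\<close>, so \<open>u g\<close> would be invertible; hence the
        shift by -1.\<close>
      have "Comp D X X X u g - Smult D (- 1) (Idn D X) = Comp D X X X u f"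
        using u fg by (simp add: Comp_diff_right X nilp_in scale_minus_left flip: u(2))
      moreover have n: "nilp X (Comp D X X X u f)" "nilp X (Comp D X X X u g)"
        using mult[OF u(1)] fg by auto
      ultimately obtain h where "h \<in> Hom D X X" "Comp D X X X h (Comp D X X X u g) = Idn D X"
        using shift_invertible[OF X nilp_in[OF n(2)], of "-1"] by auto
      then show False using nilp_no_left_inverse[OF X nilp_in[OF n(2)] n(2)] by blast
    qed
  next
    fix h f assume "h \<in> Hom D X X" "f \<in> ?N"
    then show "Comp D X X X h f \<in> ?N" using mult by simp
  qed
  moreover have "I' = ?N \<or> I' = Hom D X X" if I': "left_ideal_End D X I'" "?N \<subseteq> I'" for I'
  proof (rule ccontr)
    assume neg: "\<not> (I' = ?N \<or> I' = Hom D X X)"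
    then obtain f where f: "f \<in> I'" "\<not> nilp X f" using I'(2) by blast
    have sub: "I' \<subseteq> Hom D X X" and closed: "\<And>h f. h \<in> Hom D X X \<Longrightarrow> f \<in> I' \<Longrightarrow> Comp D X X X h f \<in> I'"
      using I'(1) by (auto simp: left_ideal_End_def)
    obtain g where "g \<in> Hom D X X" "Comp D X X X g f = Idn D X"
      using invertible_if_not_nilp[OF X _ f(2)] sub f(1) by blast
    then have "Idn D X \<in> I'" using closed f(1) by metis
    then have "h \<in> I'" if "h \<in> Hom D X X" for h
      using closed[OF that, of "Idn D X"] by (simp add: Comp_Idn_right X that)
    then show False using sub neg by blast
  qed
  ultimately have "maximal_left_ideal_End D X ?N"
    unfolding maximal_left_ideal_End_def using id Idn_in_Hom[OF X] by blast
  then show ?thesis using id by (auto simp: jacobson_radical_End_def)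
qed

text \<open>The generator \<open>s\<close> is the class of the identity. Every endomorphism is a
  scalar plus a nilpotent, and nilpotents lie in the Jacobson radical, so the value at X is a
  line.\<close>

lemma is_S_generator:
  assumes X: "X \<in> Obj D" and S: "is_S D X S"
  obtains s where "s \<in> Val S X" "s \<noteq> 0" "\<And>w. w \<in> Val S X \<Longrightarrow> \<exists>c. w = vscale D c s"
    "\<And>r. nilp X r \<Longrightarrow> Act S X X r s = 0"
proof -
  obtain p where p: "linear_map_on (Smult D) (Hom D X X) (vscale D) (Val S X) p"
    "p ` Hom D X X = Val S X" "{f \<in> Hom D X X. p f = 0} = jacobson_radical_End D X"
    "\<forall>f \<in> Hom D X X. \<forall>g \<in> Hom D X X. Act S X X f (p g) = p (Comp D X X X f g)"
    using S unfolding is_S_def by (elim conjE exE)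
  have pr: "p r = 0" if "nilp X r" for r
    using nilp_in_jacobson_radical[OF X that] p(3) by blast
  show thesis
  proof (rule that[of "p (Idn D X)"])
    show "p (Idn D X) \<in> Val S X" using p(2) Idn_in_Hom[OF X] by blast
    show "p (Idn D X) \<noteq> 0"
      using Idn_notin_jacobson_radical[OF X] p(3) Idn_in_Hom[OF X] by blast
    show "\<exists>c. w = vscale D c (p (Idn D X))" if "w \<in> Val S X" for w
    proof -
      obtain f where f: "f \<in> Hom D X X" "w = p f" using \<open>w \<in> Val S X\<close> p(2) by auto
      obtain c where c: "nilp X (f - Smult D c (Idn D X))" using nilp_shift[OF X f(1)] by blast
      have "p f = p ((f - Smult D c (Idn D X)) + Smult D c (Idn D X))" by simp
      also have "\<dots> = p (f - Smult D c (Idn D X)) + vscale D c (p (Idn D X))"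
        using p(1) nilp_in[OF c] Idn_in_Hom[OF X] scale_in_Hom[OF X X Idn_in_Hom[OF X], of c]
        unfolding linear_map_on_def by metis
      finally show ?thesis using f(2) pr[OF c] by auto
    qed
    show "Act S X X r (p (Idn D X)) = 0" if "nilp X r" for r
      using p(4)[rule_format, OF nilp_in[OF that] Idn_in_Hom[OF X]] that
      by (simp add: Comp_Idn_right X nilp_in pr)
  qed
qed

end

section \<open>Nilpotent endomorphisms\<close>

text \<open>The ambient space may have infinite dimension; the finite spanning set \<open>F\<close>
  ensures that a basis of \<open>A\<close> extends to a finite basis of \<open>B\<close>.\<close>

lemma (in vector_space)
  assumes "finite F" "B \<subseteq> span F" "subspace A" "A \<subseteq> B"
  shows dim_subset_finite: "dim A \<le> dim B"
    and dim_psubset_finite: "A \<noteq> B \<Longrightarrow> dim A < dim B"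
proof -
  obtain C where C: "C \<subseteq> A" "independent C" "A \<subseteq> span C" "card C = dim A"
    using basis_exists[of A] by blast
  obtain C' where C': "C \<subseteq> C'" "C' \<subseteq> B" "independent C'" "B \<subseteq> span C'"
    using maximal_independent_subset_extend[of C B] C assms(4) by blast
  have fin: "finite C'"
    using independent_span_bound[OF assms(1) C'(3)] C'(2) assms(2) by blast
  have card: "card C' = dim B"
    using basis_card_eq_dim[OF C'(2,4,3)] .
  show "dim A \<le> dim B" using card_mono[OF fin C'(1)] C(4) card by simp
  show "dim A < dim B" if "A \<noteq> B"
  proof -
    have "C \<noteq> C'"
      using that C'(4) span_minimal[OF C(1) assms(3)] assms(4) by blast
    then have "card C < card C'" using psubset_card_mono[OF fin] C'(1) by blast
    then show ?thesis using C(4) card by simp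
  qed
qed

text \<open>\<open>finite_support\<close> confines a representable functor to finitely many objects;
  with finite-dimensional values this gives the finite total dimension that drives the
  induction.\<close>

locale trace_spectroid = spectroid D + trace_category D \<theta>
  for D :: "('k::alg_closed_field, 'o, 'h::ab_group_add) lincat" and \<theta> :: "'o \<Rightarrow> 'h \<Rightarrow> 'k" +
  assumes finite_pd: "X \<in> Obj D \<Longrightarrow> pd_S D X < \<infinity>"
    and finite_support: "X \<in> Obj D \<Longrightarrow> finite {Y \<in> Obj D. Hom D X Y \<noteq> {0}}"
begin

lemma simple_has_trace:
  assumes "X \<in> Obj D"
  obtains S n where "is_S D X S" "has_trace n S (\<lambda>X v. 0) 0"
proof -
  \<comment> \<open>In \<open>enat\<close> the infimum of the empty set is
    \<open>\<infinity>\<close>, so finiteness of \<open>pd_S\<close> yields an actual copy of the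
    simple representation with a resolution.\<close>
  have "{enat n | n. \<exists>S F d. is_S D X S \<and> projective_resolution D n S F d} \<noteq> {}"
    using finite_pd[OF assms] unfolding pd_S_def by (metis Inf_enat_def less_irrefl)
  then obtain n S F d where S: "is_S D X S" "projective_resolution D n S F d" by blast
  then have "is_representation D S" by (simp add: is_S_def)
  then show thesis using has_trace_zero_resolution[OF S(2)] that S(1) by blast
qed

lemma funpow_rep_hom_in:
  assumes "rep_hom D M M \<phi>" "X \<in> Obj D" "v \<in> Val M X"
  shows "(\<phi> X ^^ n) v \<in> Val M X"
  by (induction n) (simp_all add: assms rep_hom_in[OF assms(1,2)])

text \<open>
  By maximality, any \<open>v\<close> outside \<open>W\<close> generates \<open>M\<close> modulo \<open>W\<close>. Hence a radical \<open>r\<close> with \<open>r v\<close> outside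
  \<open>W\<close> would give \<open>v = g r v\<close> modulo \<open>W\<close> for some \<open>g\<close>, which is impossible as \<open>g r\<close> is nilpotent.
\<close>

lemma maximal_subrep_quotient:
  assumes M: "is_representation D M" and f: "rep_hom D M M \<phi>"
    and nil: "\<And>X v. \<lbrakk>X \<in> Obj D; v \<in> Val M X\<rbrakk> \<Longrightarrow> (\<phi> X ^^ N) v = 0"
    and W: "subrep M W" and fW: "\<And>X v. \<lbrakk>X \<in> Obj D; v \<in> W X\<rbrakk> \<Longrightarrow> \<phi> X v \<in> W X"
    and proper: "Y \<in> Obj D" "W Y \<noteq> Val M Y"
    and maximal: "\<And>W'. \<lbrakk>subrep M W'; \<And>X v. \<lbrakk>X \<in> Obj D; v \<in> W' X\<rbrakk> \<Longrightarrow> \<phi> X v \<in> W' X;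
      \<And>X. X \<in> Obj D \<Longrightarrow> W X \<subseteq> W' X\<rbrakk>
      \<Longrightarrow> (\<forall>X \<in> Obj D. W' X = W X) \<or> (\<forall>X \<in> Obj D. W' X = Val M X)"
    and S: "is_S D Y S"
  obtains q where "exact_seq (M\<lparr>Val := W\<rparr>) M S q"
    "\<And>X v. \<lbrakk>X \<in> Obj D; v \<in> Val M X\<rbrakk> \<Longrightarrow> q X (\<phi> X v) = 0"
proof -
  note Y = proper(1)
  have W_sub: "v \<in> Val M X" if "X \<in> Obj D" "v \<in> W X" for X v
    using W that unfolding subrep_def by blast
  have W_ss: "vs.subspace (W X)" if "X \<in> Obj D" for X
    using W that unfolding subrep_def by blast
  have W_act: "Act M X Z g v \<in> W Z" if "X \<in> Obj D" "Z \<in> Obj D" "g \<in> Hom D X Z" "v \<in> W X" for X Z g v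
    using W that unfolding subrep_def by blast
  note W_add = vs.subspace_add[OF W_ss] and W_diff = vs.subspace_diff[OF W_ss]
    and W_scale = vs.subspace_scale[OF W_ss] and W_0 = vs.subspace_0[OF W_ss]
  obtain v0 where v0: "v0 \<in> Val M Y" "v0 \<notin> W Y"
    using proper W_sub by blast
  have fM: "\<phi> X v \<in> W X" if X: "X \<in> Obj D" and v: "v \<in> Val M X" for X v
  proof -
    \<comment> \<open>\<open>W1\<close> is the preimage of \<open>W\<close> under
      \<open>\<phi>\<close>, a stable subrepresentation above \<open>W\<close>. If it were
      \<open>W\<close>, descending from \<open>(\<phi> Y ^^ N) v0 = 0\<close> one power at a time
      would put \<open>v0\<close> into \<open>W\<close>.\<close>
    define W1 where "W1 = (\<lambda>X. {v \<in> Val M X. \<phi> X v \<in> W X})"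
    have "subrep M W1"
      unfolding subrep_def W1_def vs.subspace_def
      by (auto simp: rep_zero[OF M] rep_add[OF M] rep_scale[OF M] rep_hom_zero[OF f _ M] W_0
          rep_hom_add[OF f] rep_hom_scale[OF f] W_add W_scale Act_in[OF M] rep_hom_nat[OF f] W_act)
    moreover have "\<phi> X v \<in> W1 X" if "X \<in> Obj D" "v \<in> W1 X" for X v
      using that by (simp add: W1_def rep_hom_in[OF f] fW)
    moreover have "W X \<subseteq> W1 X" if "X \<in> Obj D" for X
      using that by (auto simp: W1_def W_sub fW)
    ultimately consider "\<forall>X \<in> Obj D. W1 X = W X" | "\<forall>X \<in> Obj D. W1 X = Val M X"
      using maximal by blast
    then show ?thesis
    proof cases
      case 1
      have down: "v0 \<in> W Y" if "(\<phi> Y ^^ n) v0 \<in> W Y" for n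
        using that
      proof (induction n)
        case (Suc n)
        then have "(\<phi> Y ^^ n) v0 \<in> W1 Y"
          using funpow_rep_hom_in[OF f Y v0(1)] by (simp add: W1_def)
        then show ?case using 1 Y Suc by blast
      qed simp
      show ?thesis using down[of N] nil[OF Y v0(1)] W_0[OF Y] v0(2) by simp
    next
      case 2
      then show ?thesis using X v by (auto simp: W1_def)
    qed
  qed
  have generate: "\<exists>w g. w \<in> W Z \<and> g \<in> Hom D X Z \<and> x = w + Act M X Z g v"
    if X: "X \<in> Obj D" and v: "v \<in> Val M X" "v \<notin> W X" and Z: "Z \<in> Obj D" "x \<in> Val M Z" for X v Z x
  proof -
    \<comment> \<open>\<open>W2\<close> is \<open>W\<close> plus the subrepresentation generated by
      \<open>v\<close>. It is stable since \<open>\<phi>\<close> maps all of \<open>M\<close> into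
      \<open>W\<close>.\<close>
    define W2 where "W2 = (\<lambda>Z. {w + Act M X Z g v | w g. w \<in> W Z \<and> g \<in> Hom D X Z})"
    have W2I: "w + Act M X Z g v \<in> W2 Z" if "w \<in> W Z" "g \<in> Hom D X Z" for w g Z
      using that by (auto simp: W2_def)
    have W2_sub: "W2 Z \<subseteq> Val M Z" if "Z \<in> Obj D" for Z
    proof
      fix x assume "x \<in> W2 Z"
      then obtain w g where "x = w + Act M X Z g v" "w \<in> W Z" "g \<in> Hom D X Z"
        by (auto simp: W2_def)
      then show "x \<in> Val M Z"
        using rep_add[OF M that W_sub[OF that] Act_in[OF M X that _ v(1)]] by simp
    qed
    have W_W2: "W Z \<subseteq> W2 Z" if "Z \<in> Obj D" for Z
    proof
      fix w assume "w \<in> W Z"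
      from W2I[OF this zero_in_Hom[OF X that]] show "w \<in> W2 Z"
        by (simp add: Act_zero_Hom[OF M X that v(1)])
    qed
    have "subrep M W2"
      unfolding subrep_def
    proof (intro conjI ballI W2_sub)
      fix Z assume Z: "Z \<in> Obj D"
      show "vs.subspace (W2 Z)"
      proof (rule vs.subspaceI)
        show "0 \<in> W2 Z" using W_W2[OF Z] W_0[OF Z] by blast
      next
        fix x y assume "x \<in> W2 Z" "y \<in> W2 Z"
        then obtain w g w' g' where 1: "x = w + Act M X Z g v" "y = w' + Act M X Z g' v"
          "w \<in> W Z" "w' \<in> W Z" "g \<in> Hom D X Z" "g' \<in> Hom D X Z" by (auto simp: W2_def)
        have "x + y = (w + w') + Act M X Z (g + g') v"
          using 1 by (simp add: Act_add_Hom[OF M X Z] v ac_simps)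
        then show "x + y \<in> W2 Z" using 1 W2I[OF W_add add_in_Hom] X Z by metis
      next
        fix c x assume "x \<in> W2 Z"
        then obtain w g where 1: "x = w + Act M X Z g v" "w \<in> W Z" "g \<in> Hom D X Z"
          by (auto simp: W2_def)
        have "vscale D c x = vscale D c w + Act M X Z (Smult D c g) v"
          using 1 by (simp add: Act_scale_Hom[OF M X Z] v vs.scale_right_distrib)
        then show "vscale D c x \<in> W2 Z" using 1 W2I[OF W_scale scale_in_Hom] X Z by metis
      qed
    next
      fix Z Z' h x assume Z: "Z \<in> Obj D" "Z' \<in> Obj D" "h \<in> Hom D Z Z'" and "x \<in> W2 Z"
      then obtain w g where 1: "x = w + Act M X Z g v" "w \<in> W Z" "g \<in> Hom D X Z"
        by (auto simp: W2_def)
      have "Act M Z Z' h x = Act M Z Z' h w + Act M X Z' (Comp D X Z Z' h g) v"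
        using 1 X Z v by (simp add: Act_add[OF M] Act_Comp[OF M] W_sub Act_in[OF M])
      then show "Act M Z Z' h x \<in> W2 Z'" using 1 W2I[OF W_act Comp_in_Hom] X Z by metis
    qed
    moreover have "\<phi> Z x \<in> W2 Z" if "Z \<in> Obj D" "x \<in> W2 Z" for Z x
      using that W_W2 W2_sub fM by blast
    moreover have "v \<in> W2 X"
      using W2I[OF W_0[OF X] Idn_in_Hom[OF X]] by (simp add: Act_Idn[OF M X v(1)])
    ultimately have "W2 Z = Val M Z"
      using maximal[of W2] W_W2 X v(2) Z(1) by metis
    then have "x \<in> W2 Z" using Z(2) by simp
    then show ?thesis unfolding W2_def by blast
  qed
  have rad: "Act M X Z r v \<in> W Z"
    if X: "X \<in> Obj D" and Z: "Z \<in> Obj D" and r: "radical X Z r" and v: "v \<in> Val M X" for X Z r v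
  proof (rule ccontr)
    assume neg: "Act M X Z r v \<notin> W Z"
    have rH: "r \<in> Hom D X Z" using r by (simp add: radical_def)
    obtain w g where wg: "w \<in> W X" "g \<in> Hom D Z X" "v = w + Act M Z X g (Act M X Z r v)"
      using generate[OF Z Act_in[OF M X Z rH v] neg X v] by blast
    define h where "h = Comp D X Z X g r"
    have h: "nilp X h" unfolding h_def by (rule nilp_Comp_radical[OF X Z r wg(2)])
    have vh: "v = w + Act M X X h v"
      using wg by (simp add: h_def Act_Comp[OF M X Z X rH wg(2) v])
    \<comment> \<open>Modulo \<open>W\<close>, the element \<open>v\<close> is fixed by
      \<open>h\<close>, hence by all powers of \<open>h\<close>, one of which is zero.\<close>
    have "v - Act M X X (epow X h n) v \<in> W X" for n
    proof (induction n)
      case 0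
      show ?case using W_0[OF X] by (simp add: epow_def Act_Idn[OF M X v] zero_fun_def)
    next
      case (Suc n)
      note hn = epow_in[OF X nilp_in[OF h], of n]
      have "Act M X X h (v - Act M X X (epow X h n) v) \<in> W X"
        by (rule W_act[OF X X nilp_in[OF h] Suc])
      moreover have "Act M X X h (v - Act M X X (epow X h n) v) =
          Act M X X h v - Act M X X (epow X h (Suc n)) v"
        by (simp add: Act_diff[OF M X X nilp_in[OF h] v Act_in[OF M X X hn v]]
            Act_Comp[OF M X X X hn nilp_in[OF h] v] epow_Suc[OF X nilp_in[OF h]])
      ultimately have "w + (Act M X X h v - Act M X X (epow X h (Suc n)) v) \<in> W X"
        using W_add[OF X wg(1)] by simp
      also have "w + (Act M X X h v - Act M X X (epow X h (Suc n)) v) =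
          (w + Act M X X h v) - Act M X X (epow X h (Suc n)) v"
        by (rule add_diff_eq)
      also have "w + Act M X X h v = v" by (rule vh[symmetric])
      finally show ?case .
    qed
    moreover obtain n where "epow X h n = 0" using h by (auto simp: nilp_def)
    ultimately have "v \<in> W X" using Act_zero_Hom[OF M X X v] by (metis diff_zero)
    then show False using W_act[OF X Z rH] neg by blast
  qed
  obtain s where s: "s \<in> Val S Y" "s \<noteq> 0" "\<And>w. w \<in> Val S Y \<Longrightarrow> \<exists>c. w = vscale D c s"
    "\<And>r. nilp Y r \<Longrightarrow> Act S Y Y r s = 0"
    using is_S_generator[OF Y S] by blast
  have SR: "is_representation D S" and S0: "\<And>Z. \<lbrakk>Z \<in> Obj D; Z \<noteq> Y\<rbrakk> \<Longrightarrow> Val S Z = {0}"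
    using S by (auto simp: is_S_def)
  \<comment> \<open>Morphisms from Y to another object are radical, so they send \<open>v0\<close>
    into \<open>W\<close>; since \<open>v0\<close> generates modulo \<open>W\<close>, nothing is
    left away from Y.\<close>
  have W_all: "W Z = Val M Z" if Z: "Z \<in> Obj D" "Z \<noteq> Y" for Z
  proof -
    have "x \<in> W Z" if "x \<in> Val M Z" for x
    proof -
      obtain w g where "w \<in> W Z" "g \<in> Hom D Y Z" "x = w + Act M Y Z g v0"
        using generate[OF Y v0 Z(1) \<open>x \<in> Val M Z\<close>] by blast
      then show ?thesis
        using rad[OF Y Z(1) _ v0(1)] Z(2) W_add[OF Z(1)] by (auto simp: radical_def)
    qed
    then show ?thesis using W_sub[OF Z(1)] by blast
  qed
  \<comment> \<open>Radical endomorphisms vanish modulo \<open>W\<close>, so only the scalar part of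
    \<open>g\<close> survives and \<open>v0\<close> spans the value at Y modulo
    \<open>W Y\<close>.\<close>
  have coeff_ex: "\<exists>c. x - vscale D c v0 \<in> W Y" if x: "x \<in> Val M Y" for x
  proof -
    obtain w g where wg: "w \<in> W Y" "g \<in> Hom D Y Y" "x = w + Act M Y Y g v0"
      using generate[OF Y v0 Y x] by blast
    obtain c where c: "nilp Y (g - Smult D c (Idn D Y))" using nilp_shift[OF Y wg(2)] by blast
    have "Act M Y Y g v0 = Act M Y Y ((g - Smult D c (Idn D Y)) + Smult D c (Idn D Y)) v0" by simp
    also have "\<dots> = Act M Y Y (g - Smult D c (Idn D Y)) v0 + vscale D c v0"
      by (subst Act_add_Hom[OF M Y Y])
        (simp_all add: nilp_in[OF c] scale_in_Hom Y Idn_in_Hom v0 Act_scale_Hom[OF M] Act_Idn[OF M])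
    finally have "x - vscale D c v0 = w + Act M Y Y (g - Smult D c (Idn D Y)) v0"
      by (simp add: wg(3))
    then show ?thesis
      using W_add[OF Y wg(1) rad[OF Y Y nilp_radical[OF c] v0(1)]] by metis
  qed
  have coeff_unique: "c = c'" if "x - vscale D c v0 \<in> W Y" "x - vscale D c' v0 \<in> W Y" for x c c'
  proof (rule ccontr)
    assume "c \<noteq> c'"
    have "vscale D (c' - c) v0 \<in> W Y"
      using W_diff[OF Y that] by (simp add: vs.scale_left_diff_distrib)
    then have "vscale D (inverse (c' - c)) (vscale D (c' - c) v0) \<in> W Y" by (rule W_scale[OF Y])
    then show False using \<open>c \<noteq> c'\<close> v0(2) by simp
  qed
  \<comment> \<open>\<open>cf x\<close> is the coordinate of \<open>x\<close> modulo
    \<open>W Y\<close> with respect to the class of \<open>v0\<close>; the map \<open>q\<close>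
    below sends this class to \<open>s\<close>.\<close>
  define cf where "cf x = (THE c. x - vscale D c v0 \<in> W Y)" for x
  have cf: "x - vscale D (cf x) v0 \<in> W Y" if "x \<in> Val M Y" for x
    unfolding cf_def by (rule theI') (use coeff_ex[OF that] coeff_unique in blast)
  have cf_eq: "cf x = c" if "x - vscale D c v0 \<in> W Y" for x c
    unfolding cf_def by (rule the_equality) (use that coeff_unique in blast)+
  have cf_add: "cf (x + y) = cf x + cf y" if "x \<in> Val M Y" "y \<in> Val M Y" for x y
  proof (rule cf_eq)
    have "(x - vscale D (cf x) v0) + (y - vscale D (cf y) v0) \<in> W Y"
      by (intro W_add[OF Y] cf that)
    then show "x + y - vscale D (cf x + cf y) v0 \<in> W Y"
      by (simp add: vs.scale_left_distrib algebra_simps)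
  qed
  have cf_scale: "cf (vscale D c x) = c * cf x" if "x \<in> Val M Y" for c x
  proof (rule cf_eq)
    have "vscale D c (x - vscale D (cf x) v0) \<in> W Y"
      by (intro W_scale[OF Y] cf that)
    then show "vscale D c x - vscale D (c * cf x) v0 \<in> W Y"
      by (simp add: vs.scale_right_diff_distrib)
  qed
  have cf_0: "cf x = 0 \<longleftrightarrow> x \<in> W Y" if "x \<in> Val M Y" for x
    using cf[OF that] cf_eq[of x 0] by auto
  define q where "q = (\<lambda>Z x. if Z = Y then vscale D (cf x) s else 0)"
  have q: "rep_hom D M S q"
  proof (rule rep_homI)
    fix X Z g x assume X: "X \<in> Obj D" and Z: "Z \<in> Obj D" and g: "g \<in> Hom D X Z" and x: "x \<in> Val M X"
    show "q Z (Act M X Z g x) = Act S X Z g (q X x)"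
    proof (cases "Z = Y")
      case False
      have "q X x \<in> Val S X"
        using X s(1) rep_scale[OF SR] rep_zero[OF SR] by (auto simp: q_def)
      from Act_in[OF SR X Z g this] show ?thesis
        using False S0[OF Z False] by (simp add: q_def)
    next
      case ZY: True
      show ?thesis
      proof (cases "X = Y")
        case False
        then have "Act M X Y g x \<in> W Y"
          using rad[OF X Z _ x] g ZY by (auto simp: radical_def)
        then show ?thesis
          using False ZY cf_0[OF W_sub[OF Y]] Act_zero[OF SR X Z g] by (simp add: q_def)
      next
        case XY: True
        obtain c where c: "nilp Y (g - Smult D c (Idn D Y))"
          using nilp_shift[OF Y] g XY ZY by blast
        \<comment> \<open>Stated for a general \<open>N\<close>, since the actions on
          \<open>M\<close> and on \<open>S\<close> are compared through the same scalar
          \<open>c\<close>.\<close>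
        have decomp: "Act N Y Y g y = Act N Y Y (g - Smult D c (Idn D Y)) y + vscale D c y"
          if N: "is_representation D N" "y \<in> Val N Y" for N y
        proof -
          have "Act N Y Y g y = Act N Y Y ((g - Smult D c (Idn D Y)) + Smult D c (Idn D Y)) y" by simp
          also have "\<dots> = Act N Y Y (g - Smult D c (Idn D Y)) y + vscale D c y"
            by (subst Act_add_Hom[OF N(1) Y Y])
              (simp_all add: nilp_in[OF c] scale_in_Hom Y Idn_in_Hom N(2) Act_scale_Hom[OF N(1)]
                Act_Idn[OF N(1)])
          finally show ?thesis .
        qed
        have x': "x \<in> Val M Y" and g': "g \<in> Hom D Y Y" using x g XY ZY by auto
        have r: "Act M Y Y (g - Smult D c (Idn D Y)) x \<in> W Y"
          by (rule rad[OF Y Y nilp_radical[OF c] x'])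
        have "cf (Act M Y Y g x) = c * cf x"
          using cf_add[OF W_sub[OF Y r] rep_scale[OF M Y x']] cf_0[OF W_sub[OF Y r]] r
          by (simp add: decomp[OF M x'] cf_scale[OF x'])
        moreover have "Act S Y Y g (vscale D (cf x) s) = vscale D (cf x) (vscale D c s)"
          by (simp add: Act_scale[OF SR Y Y g' s(1)] decomp[OF SR s(1)] s(4)[OF c])
        ultimately show ?thesis
          by (simp add: q_def XY ZY mult.commute)
      qed
    qed
  qed (auto simp: q_def s(1) rep_scale[OF SR] rep_zero[OF SR] cf_add cf_scale vs.scale_left_distrib)
  have Wr: "is_representation D (M\<lparr>Val := W\<rparr>)" by (rule is_representation_subrep[OF M W])
  have "exact_seq (M\<lparr>Val := W\<rparr>) M S q"
    unfolding exact_seq_def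
  proof (intro conjI ballI M SR Wr q)
    show "rep_hom D (M\<lparr>Val := W\<rparr>) M (\<lambda>X v. v)"
      by (rule rep_hom_from_subrep[OF rep_hom_id]) (auto intro: W_sub)
    fix X assume X: "X \<in> Obj D"
    show "Val (M\<lparr>Val := W\<rparr>) X = {v \<in> Val M X. q X v = 0}"
    proof (cases "X = Y")
      case True
      then show ?thesis using cf_0 W_sub[OF Y] s(2) by (auto simp: q_def)
    next
      case False
      then show ?thesis using W_all[OF X] by (auto simp: q_def)
    qed
    show "q X ` Val M X = Val S X"
    proof (cases "X = Y")
      case True
      have "q Y (vscale D c v0) = vscale D c s" for c
        using cf_eq[of "vscale D c v0" c] W_0[OF Y] by (simp add: q_def)
      then have "w \<in> q Y ` Val M Y" if "w \<in> Val S Y" for w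
        using s(3)[OF that] rep_scale[OF M Y v0(1)] by (metis imageI)
      then show ?thesis using rep_hom_in[OF q Y] True by blast
    next
      case False
      then show ?thesis using S0[OF X] rep_zero[OF M X] by (auto simp: q_def)
    qed
  qed
  moreover have "q X (\<phi> X v) = 0" if "X \<in> Obj D" "v \<in> Val M X" for X v
    using fM[OF that] cf_0[OF W_sub] that by (auto simp: q_def)
  ultimately show thesis using that by blast
qed

text \<open>The total dimension over the finite set \<open>E\<close>, outside which \<open>M\<close>
  vanishes, is the induction measure. The same number, maximised over the proper stable
  subrepresentations, selects the maximal one to which the induction hypothesis is applied.\<close>

lemma has_trace_nilpotent:
  assumes "finite E" "E \<subseteq> Obj D" "is_representation D M" "rep_hom D M M \<phi>"
    and "\<And>X. X \<in> Obj D - E \<Longrightarrow> Val M X = {0}"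
    and "\<And>X v. \<lbrakk>X \<in> Obj D; v \<in> Val M X\<rbrakk> \<Longrightarrow> (\<phi> X ^^ N) v = 0"
  shows "\<exists>n. has_trace n M \<phi> 0"
  using assms
proof (induction "\<Sum>X\<in>E. vs.dim (Val M X)" arbitrary: M rule: less_induct)
  case less
  note E = less.prems(1,2) and M = less.prems(3) and f = less.prems(4) and supp = less.prems(5)
    and nil = less.prems(6)
  define stable where "stable W \<longleftrightarrow> subrep M W \<and> (\<forall>X \<in> Obj D. \<forall>v \<in> W X. \<phi> X v \<in> W X)" for W
  define \<mu> where "\<mu> W = (\<Sum>X\<in>E. vs.dim (W X))" for W :: "'o \<Rightarrow> (nat \<Rightarrow> 'h) set"
  have M_stable: "stable (Val M)"
    unfolding stable_def subrep_def
    using rep_subspace[OF M] Act_in[OF M] rep_hom_in[OF f] by blast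
  have dim_le: "vs.dim (W X) \<le> vs.dim (W' X)"
    and dim_less: "W X \<noteq> W' X \<Longrightarrow> vs.dim (W X) < vs.dim (W' X)"
    if W: "stable W" "stable W'" "X \<in> Obj D" "W X \<subseteq> W' X" for W W' X
  proof -
    obtain F where F: "finite F" "Val M X \<subseteq> vs.span F"
      using rep_finite_dim[OF M W(3)] by (auto simp: finite_dim_def)
    have sub: "vs.subspace (W X)" "W' X \<subseteq> vs.span F"
      using W F(2) unfolding stable_def subrep_def by blast+
    show "vs.dim (W X) \<le> vs.dim (W' X)" "W X \<noteq> W' X \<Longrightarrow> vs.dim (W X) < vs.dim (W' X)"
      using vs.dim_subset_finite[OF F(1) sub(2,1) W(4)]
        vs.dim_psubset_finite[OF F(1) sub(2,1) W(4)] by auto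
  qed
  have mu_less: "\<mu> W < \<mu> W'"
    if W: "stable W" "stable W'" "\<And>X. X \<in> Obj D \<Longrightarrow> W X \<subseteq> W' X" and X: "X \<in> Obj D" "W X \<noteq> W' X"
    for W W' X
  proof -
    have "X \<in> E"
    proof (rule ccontr)
      assume "X \<notin> E"
      then have "Val M X = {0}" using supp X(1) by simp
      moreover have "vs.subspace (W X)" "vs.subspace (W' X)" "W X \<subseteq> Val M X" "W' X \<subseteq> Val M X"
        using W(1,2) X(1) unfolding stable_def subrep_def by blast+
      ultimately show False using X(2) vs.subspace_0[of "W X"] vs.subspace_0[of "W' X"] by auto
    qed
    show ?thesis
      unfolding \<mu>_def
    proof (rule sum_strict_mono_ex1[OF E(1)])
      show "\<forall>X\<in>E. vs.dim (W X) \<le> vs.dim (W' X)"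
        using dim_le[OF W(1,2)] W(3) E(2) by blast
      show "\<exists>X\<in>E. vs.dim (W X) < vs.dim (W' X)"
        using dim_less[OF W(1,2) X(1) W(3)[OF X(1)] X(2)] \<open>X \<in> E\<close> by blast
    qed
  qed
  show ?case
  proof (cases "\<forall>X \<in> Obj D. Val M X = {0}")
    case True
    then show ?thesis using has_trace_Val_zero[OF M _ f] by blast
  next
    case False
    define proper where "proper W \<longleftrightarrow> stable W \<and> (\<exists>X \<in> Obj D. W X \<noteq> Val M X)" for W
    have "proper (\<lambda>X. {0})"
      using False
      by (auto simp: proper_def stable_def subrep_def vs.subspace_0 rep_zero[OF M] Act_zero[OF M]
          rep_hom_zero[OF f _ M])
    moreover have sub_M: "W X \<subseteq> Val M X" if "stable W" "X \<in> Obj D" for W X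
      using that unfolding stable_def subrep_def by blast
    have proper_less: "\<mu> W < \<mu> (Val M)" if "proper W" for W
      using that mu_less[OF _ M_stable] sub_M unfolding proper_def by metis
    ultimately obtain W where W: "proper W" and Wmax: "\<And>W'. proper W' \<Longrightarrow> \<mu> W' \<le> \<mu> W"
      using ex_has_greatest_nat[of proper "\<lambda>X. {0}" \<mu> "\<mu> (Val M)"] less_imp_le by metis
    have Wst: "stable W" and Wsub: "subrep M W"
      using W by (auto simp: proper_def stable_def)
    have fW: "\<phi> X v \<in> W X" if "X \<in> Obj D" "v \<in> W X" for X v
      using Wst that by (auto simp: stable_def)
    obtain Y where Y: "Y \<in> Obj D" "W Y \<noteq> Val M Y" using W by (auto simp: proper_def)
    obtain S n where S: "is_S D Y S" "has_trace n S (\<lambda>X v. 0) 0"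
      using simple_has_trace[OF Y(1)] by blast
    have max: "(\<forall>X \<in> Obj D. W' X = W X) \<or> (\<forall>X \<in> Obj D. W' X = Val M X)"
      if W': "subrep M W'" "\<And>X v. \<lbrakk>X \<in> Obj D; v \<in> W' X\<rbrakk> \<Longrightarrow> \<phi> X v \<in> W' X"
        "\<And>X. X \<in> Obj D \<Longrightarrow> W X \<subseteq> W' X" for W'
    proof (rule ccontr)
      assume neg: "\<not> ?thesis"
      have "stable W'" using W' by (simp add: stable_def)
      then have "proper W'" using neg by (auto simp: proper_def)
      moreover have "\<mu> W < \<mu> W'" using mu_less[OF Wst \<open>stable W'\<close> W'(3)] neg by metis
      ultimately show False using Wmax by fastforce
    qed
    obtain q where ex: "exact_seq (M\<lparr>Val := W\<rparr>) M S q"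
      and q: "\<And>X v. \<lbrakk>X \<in> Obj D; v \<in> Val M X\<rbrakk> \<Longrightarrow> q X (\<phi> X v) = 0"
      using maximal_subrep_quotient[OF M f nil Wsub fW Y max S(1)] by blast
    note Wrep = is_representation_subrep[OF M Wsub]
    have W0: "Val (M\<lparr>Val := W\<rparr>) X = {0}" if "X \<in> Obj D - E" for X
      using supp[OF that] sub_M[OF Wst, of X] that rep_zero[OF Wrep, of X] by auto
    have fW': "rep_hom D (M\<lparr>Val := W\<rparr>) (M\<lparr>Val := W\<rparr>) \<phi>"
      by (rule rep_hom_to_subrep[OF rep_hom_from_subrep[OF f]]) (use sub_M[OF Wst] fW in auto)
    have "\<exists>n. has_trace n (M\<lparr>Val := W\<rparr>) \<phi> 0"
    proof (rule less.hyps[OF _ E Wrep fW' W0])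
      show "(\<Sum>X\<in>E. vs.dim (Val (M\<lparr>Val := W\<rparr>) X)) < (\<Sum>X\<in>E. vs.dim (Val M X))"
        using proper_less[OF W] by (simp add: \<mu>_def)
      show "(\<phi> X ^^ N) v = 0" if "X \<in> Obj D" "v \<in> Val (M\<lparr>Val := W\<rparr>) X" for X v
        using nil[OF that(1)] that sub_M[OF Wst] by auto
    qed
    then obtain m where m: "has_trace m (M\<lparr>Val := W\<rparr>) \<phi> 0" by blast
    have "has_trace (max m n) M \<phi> (0 + 0)"
      by (rule has_trace_additive[OF ex f _ _ has_trace_mono[OF m] has_trace_mono[OF S(2)]])
        (simp_all add: q)
    then show ?thesis by auto
  qed
qed

section \<open>Precomposition with elements of \<open>V\<close> on free functors\<close>

definition precomp :: "'o list \<Rightarrow> ('o \<Rightarrow> 'o \<Rightarrow> 'h) \<Rightarrow> 'o \<Rightarrow> (nat \<Rightarrow> 'h) \<Rightarrow> nat \<Rightarrow> 'h" where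
  "precomp Xs b Y v = (\<lambda>j. if j < length Xs
     then \<Sum>i<length Xs. Comp D (Xs ! j) (Xs ! i) Y (v i) (b (Xs ! j) (Xs ! i)) else 0)"

text \<open>For finite \<open>A\<close>, products of such elements are sums over \<open>A\<close>
  itself, in place of a set that depends on both factors, and are again of this kind.\<close>

definition matrix_on :: "'o set \<Rightarrow> ('o \<Rightarrow> 'o \<Rightarrow> 'h) \<Rightarrow> bool" where
  "matrix_on A b \<longleftrightarrow> (\<forall>X \<in> Obj D. \<forall>Y \<in> Obj D. b X Y \<in> Hom D X Y) \<and>
     (\<forall>X Y. b X Y \<noteq> 0 \<longrightarrow> X \<in> A \<and> Y \<in> A)"

lemma morphism_mult_matrix_on:
  assumes A: "finite A" "A \<subseteq> Obj D" and a: "matrix_on A a" and b: "matrix_on A b"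
    and X: "X \<in> Obj D" "Z \<in> Obj D"
  shows "morphism_mult D a b X Z = (\<Sum>Y\<in>A. Comp D X Y Z (a Y Z) (b X Y))"
  unfolding morphism_mult_def
proof (rule sum.mono_neutral_left)
  show "{Y \<in> Obj D. b X Y \<noteq> 0 \<and> a Y Z \<noteq> 0} \<subseteq> A"
    using a by (auto simp: matrix_on_def)
  show "\<forall>Y \<in> A - {Y \<in> Obj D. b X Y \<noteq> 0 \<and> a Y Z \<noteq> 0}. Comp D X Y Z (a Y Z) (b X Y) = 0"
  proof
    fix Y assume Y: "Y \<in> A - {Y \<in> Obj D. b X Y \<noteq> 0 \<and> a Y Z \<noteq> 0}"
    then have "Y \<in> Obj D" "b X Y = 0 \<or> a Y Z = 0" using A(2) by auto
    then show "Comp D X Y Z (a Y Z) (b X Y) = 0"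
      using a b X by (auto simp: matrix_on_def Comp_zero_left Comp_zero_right)
  qed
qed (use A in auto)

lemma matrix_on_mult:
  assumes A: "finite A" "A \<subseteq> Obj D" and a: "matrix_on A a" and b: "matrix_on A b"
  shows "matrix_on A (morphism_mult D a b)"
  unfolding matrix_on_def
proof (intro conjI ballI allI impI)
  fix X Y assume "X \<in> Obj D" "Y \<in> Obj D"
  then show "morphism_mult D a b X Y \<in> Hom D X Y"
    using a b by (auto simp: morphism_mult_def matrix_on_def intro!: sum_in_Hom Comp_in_Hom)
next
  fix X Y assume "morphism_mult D a b X Y \<noteq> 0"
  then have "{Z \<in> Obj D. b X Z \<noteq> 0 \<and> a Z Y \<noteq> 0} \<noteq> {}"
    unfolding morphism_mult_def by (metis sum.empty)
  then show "X \<in> A" "Y \<in> A" using a b by (auto simp: matrix_on_def)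
qed

context
  fixes Xs A
  assumes Xs: "distinct Xs" "set Xs = A" and A: "A \<subseteq> Obj D"
begin

lemma nth_Obj: "i < length Xs \<Longrightarrow> Xs ! i \<in> Obj D"
  using Xs A nth_mem by blast

lemma matrix_on_nth:
  "\<lbrakk>matrix_on A b; i < length Xs; j < length Xs\<rbrakk> \<Longrightarrow> b (Xs ! j) (Xs ! i) \<in> Hom D (Xs ! j) (Xs ! i)"
  by (auto simp: matrix_on_def nth_Obj)

lemma rep_hom_precomp:
  assumes "matrix_on A b"
  shows "rep_hom D (R Xs) (R Xs) (precomp Xs b)"
proof (rule rep_homI)
  fix X Y f v assume X: "X \<in> Obj D" "Y \<in> Obj D" "f \<in> Hom D X Y" and "v \<in> Val (R Xs) X"
  then have v: "\<And>i. i < length Xs \<Longrightarrow> v i \<in> Hom D (Xs ! i) X"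
    by (simp add: in_Val_R)
  show "precomp Xs b Y (Act (R Xs) X Y f v) = Act (R Xs) X Y f (precomp Xs b X v)"
  proof
    fix j
    show "precomp Xs b Y (Act (R Xs) X Y f v) j = Act (R Xs) X Y f (precomp Xs b X v) j"
    proof (cases "j < length Xs")
      case j: True
      have "Comp D (Xs ! j) X Y f (\<Sum>i<length Xs. Comp D (Xs ! j) (Xs ! i) X (v i) (b (Xs ! j) (Xs ! i))) =
          (\<Sum>i<length Xs. Comp D (Xs ! j) X Y f (Comp D (Xs ! j) (Xs ! i) X (v i) (b (Xs ! j) (Xs ! i))))"
        using X j by (intro Comp_sum_right Comp_in_Hom) (auto simp: nth_Obj v matrix_on_nth[OF assms])
      also have "\<dots> = (\<Sum>i<length Xs. Comp D (Xs ! j) (Xs ! i) Y (Comp D (Xs ! i) X Y f (v i))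
          (b (Xs ! j) (Xs ! i)))"
        using X j by (intro sum.cong refl Comp_assoc) (auto simp: nth_Obj v matrix_on_nth[OF assms])
      finally show ?thesis using j by (simp add: precomp_def Act_R)
    qed (simp add: precomp_def Act_R)
  qed
qed (auto simp: in_Val_R precomp_def fun_eq_iff nth_Obj matrix_on_nth[OF assms] vscale_apply
      Comp_add_left Comp_scale_left sum.distrib scale_sum_right Comp_in_Hom intro!: sum_in_Hom)

text \<open>Precomposition reverses the order: \<open>v (a b) = (v a) b\<close>, so \<open>a\<close>
  acts first. The two sides differ by associativity and an exchange of finite sums.\<close>

lemma precomp_mult:
  assumes a: "matrix_on A a" and b: "matrix_on A b" and Y: "Y \<in> Obj D" and v: "v \<in> Val (R Xs) Y"
  shows "precomp Xs (morphism_mult D a b) Y v = precomp Xs b Y (precomp Xs a Y v)"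
proof
  fix k
  show "precomp Xs (morphism_mult D a b) Y v k = precomp Xs b Y (precomp Xs a Y v) k"
  proof (cases "k < length Xs")
    case k: True
    have v': "\<And>i. i < length Xs \<Longrightarrow> v i \<in> Hom D (Xs ! i) Y"
      using v by (simp add: in_Val_R)
    have mult: "morphism_mult D a b (Xs ! k) (Xs ! i) =
      (\<Sum>j<length Xs. Comp D (Xs ! k) (Xs ! j) (Xs ! i) (a (Xs ! j) (Xs ! i)) (b (Xs ! k) (Xs ! j)))"
      if "i < length Xs" for i
      using morphism_mult_matrix_on[OF _ A a b] k that Xs nth_Obj
        sum.reindex_bij_betw[OF bij_betw_nth[OF Xs(1) refl Xs(2)[symmetric]],
          of "\<lambda>Z. Comp D (Xs ! k) Z (Xs ! i) (a Z (Xs ! i)) (b (Xs ! k) Z)"] by auto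
    have "precomp Xs (morphism_mult D a b) Y v k = (\<Sum>i<length Xs. \<Sum>j<length Xs.
        Comp D (Xs ! k) (Xs ! i) Y (v i)
          (Comp D (Xs ! k) (Xs ! j) (Xs ! i) (a (Xs ! j) (Xs ! i)) (b (Xs ! k) (Xs ! j))))"
      unfolding precomp_def using k Y
      by (auto intro!: sum.cong Comp_sum_right Comp_in_Hom
          simp: mult nth_Obj v' matrix_on_nth[OF a] matrix_on_nth[OF b])
    also have "\<dots> = (\<Sum>j<length Xs. \<Sum>i<length Xs.
        Comp D (Xs ! k) (Xs ! i) Y (v i)
          (Comp D (Xs ! k) (Xs ! j) (Xs ! i) (a (Xs ! j) (Xs ! i)) (b (Xs ! k) (Xs ! j))))"
      by (rule sum.swap)
    also have "\<dots> = (\<Sum>j<length Xs. \<Sum>i<length Xs.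
        Comp D (Xs ! k) (Xs ! j) Y (Comp D (Xs ! j) (Xs ! i) Y (v i) (a (Xs ! j) (Xs ! i)))
          (b (Xs ! k) (Xs ! j)))"
      using k Y by (intro sum.cong refl Comp_assoc)
        (auto simp: nth_Obj v' matrix_on_nth[OF a] matrix_on_nth[OF b])
    also have "\<dots> = precomp Xs b Y (precomp Xs a Y v) k"
      unfolding precomp_def using k Y
      by (auto intro!: sum.cong Comp_sum_left[symmetric] Comp_in_Hom
          simp: nth_Obj v' matrix_on_nth[OF a] matrix_on_nth[OF b])
    finally show ?thesis .
  qed (simp add: precomp_def)
qed

text \<open>\<open>(morphism_mult D a ^^ n) a\<close> is the power of \<open>a\<close> with exponent
  \<open>n + 1\<close>, hence \<open>Suc n\<close> on the right.\<close>

lemma precomp_funpow: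
  assumes a: "matrix_on A a" and Y: "Y \<in> Obj D" and v: "v \<in> Val (R Xs) Y"
  shows "precomp Xs ((morphism_mult D a ^^ n) a) Y v = (precomp Xs a Y ^^ Suc n) v"
  using v
proof (induction n arbitrary: v)
  case (Suc n)
  have fin: "finite A" using Xs(2) by auto
  have "matrix_on A ((morphism_mult D a ^^ n) a)"
    by (induction n) (simp_all add: a matrix_on_mult[OF fin A])
  then have "precomp Xs ((morphism_mult D a ^^ Suc n) a) Y v =
      precomp Xs ((morphism_mult D a ^^ n) a) Y (precomp Xs a Y v)"
    using precomp_mult[OF a _ Y Suc.prems] by simp
  also have "\<dots> = (precomp Xs a Y ^^ Suc n) (precomp Xs a Y v)"
    by (rule Suc.IH[OF rep_hom_in[OF rep_hom_precomp[OF a] Y Suc.prems]])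
  also have "\<dots> = (precomp Xs a Y ^^ Suc (Suc n)) v"
    by (simp only: funpow_Suc_right comp_apply)
  finally show ?case .
qed simp

lemma tr_precomp:
  assumes "matrix_on A a"
  shows "tr Xs (precomp Xs a) = (\<Sum>X\<in>A. \<theta> X (a X X))"
proof -
  have "precomp Xs a (Xs ! i) (gen Xs i) i = a (Xs ! i) (Xs ! i)" if i: "i < length Xs" for i
  proof -
    have "precomp Xs a (Xs ! i) (gen Xs i) i =
        (\<Sum>j<length Xs. if j = i then a (Xs ! i) (Xs ! i) else 0)"
      unfolding precomp_def if_P[OF i] using i
      by (intro sum.cong refl)
        (auto simp: gen_def Comp_Idn_left Comp_zero_left nth_Obj matrix_on_nth[OF assms])
    then show ?thesis using i by simp
  qed
  then have "tr Xs (precomp Xs a) = (\<Sum>i<length Xs. \<theta> (Xs ! i) (a (Xs ! i) (Xs ! i)))"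
    by (simp add: tr_def)
  also have "\<dots> = (\<Sum>X\<in>A. \<theta> X (a X X))"
    by (rule sum.reindex_bij_betw[OF bij_betw_nth]) (use Xs in auto)
  finally show ?thesis .
qed

end

text \<open>One trace is computed twice: along a composition series it is 0, and for the trivial
  retraction of \<open>R Xs\<close> onto itself it is the sum of the diagonal values.\<close>

lemma trace_nilpotent_zero:
  assumes A: "finite A" "A \<subseteq> Obj D" and a: "matrix_on A a" and nil: "nilpotent_morphism D a"
  shows "(\<Sum>X\<in>A. \<theta> X (a X X)) = 0"
proof -
  obtain Xs where Xs: "set Xs = A" "distinct Xs" using finite_distinct_list[OF A(1)] by blast
  note Xs' = Xs(2,1) A(2)
  have XsO: "set Xs \<subseteq> Obj D" using Xs A by simp
  obtain n where n: "(morphism_mult D a ^^ n) a = 0" using nil by (auto simp: nilpotent_morphism_def)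
  \<comment> \<open>\<open>E\<close> collects the finitely many objects at which some summand of
    \<open>R Xs\<close> is nonzero.\<close>
  define E where "E = (\<Union>X\<in>A. {Y \<in> Obj D. Hom D X Y \<noteq> {0}})"
  have E: "finite E" "E \<subseteq> Obj D" using A finite_support by (auto simp: E_def)
  note hom = rep_hom_precomp[OF Xs' a] and rep = is_representation_R[OF XsO]
  have "Val (R Xs) Y = {0}" if Y: "Y \<in> Obj D - E" for Y
  proof -
    have "Hom D X Y = {0}" if "X \<in> A" for X
      using Y that by (auto simp: E_def)
    then have "v = 0" if "v \<in> Val (R Xs) Y" for v
      using that Xs(1) by (auto simp: in_Val_R fun_eq_iff) (metis nth_mem not_less singletonD)
    then show ?thesis using rep_zero[OF rep] Y by auto
  qed
  moreover have "(precomp Xs a Y ^^ Suc n) v = 0" if "Y \<in> Obj D" "v \<in> Val (R Xs) Y" for Y v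
  proof -
    have "(precomp Xs a Y ^^ Suc n) v = precomp Xs 0 Y v"
      using precomp_funpow[OF Xs' a that, of n] n by simp
    also have "\<dots> = 0"
      using that by (auto simp: precomp_def fun_eq_iff in_Val_R Comp_zero_right nth_in_Obj[OF XsO])
    finally show ?thesis .
  qed
  ultimately obtain m where m: "has_trace m (R Xs) (precomp Xs a) 0"
    using has_trace_nilpotent[OF E rep hom] by blast
  have "retract Xs (R Xs) (\<lambda>X v. v) (\<lambda>X v. v)"
    using XsO rep rep_hom_id by (auto simp: retract_def)
  from has_trace_unique[OF m this] have "tr Xs (precomp Xs a) = 0" by simp
  then show ?thesis using tr_precomp[OF Xs' a] by simp
qed

end

section \<open>Commutators\<close>

context linear_category
begin

definition single :: "'o \<Rightarrow> 'o \<Rightarrow> 'h \<Rightarrow> 'o \<Rightarrow> 'o \<Rightarrow> 'h" where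
  "single X Y f = (\<lambda>X' Y'. if X' = X \<and> Y' = Y then f else 0)"

lemma single_in:
  "\<lbrakk>X \<in> Obj D; Y \<in> Obj D; f \<in> Hom D X Y\<rbrakk> \<Longrightarrow> single X Y f \<in> morphism_algebra D"
  by (auto simp: morphism_algebra_def single_def zero_in_Hom
      intro!: finite_subset[of _ "{(X, Y)}"] split: if_splits)

lemma morphism_mult_single:
  assumes "X \<in> Obj D" "Y \<in> Obj D" "Z \<in> Obj D" "f \<in> Hom D X Y" "g \<in> Hom D Y Z"
  shows "morphism_mult D (single Y Z g) (single X Y f) = single X Z (Comp D X Y Z g f)"
proof (intro ext)
  fix X' Z'
  have "{Y' \<in> Obj D. single X Y f X' Y' \<noteq> 0 \<and> single Y Z g Y' Z' \<noteq> 0} =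
    (if X' = X \<and> Z' = Z \<and> f \<noteq> 0 \<and> g \<noteq> 0 then {Y} else {})"
    using assms by (auto simp: single_def)
  then show "morphism_mult D (single Y Z g) (single X Y f) X' Z' = single X Z (Comp D X Y Z g f) X' Z'"
    using assms by (auto simp: morphism_mult_def single_def Comp_zero_left Comp_zero_right)
qed

lemma morphism_mult_single_neq:
  assumes "Y \<noteq> Y'"
  shows "morphism_mult D (single Y' Z g) (single X Y f) = 0"
proof (intro ext)
  fix X' Z'
  have "{W \<in> Obj D. single X Y f X' W \<noteq> 0 \<and> single Y' Z g W Z' \<noteq> 0} = {}"
    using assms by (auto simp: single_def)
  then show "morphism_mult D (single Y' Z g) (single X Y f) X' Z' = 0 X' Z'"
    by (simp only: morphism_mult_def sum.empty zero_fun_apply)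
qed

lemma vector_space_morphism_scale: "vector_space (morphism_scale D)"
  by unfold_locales
    (auto simp: morphism_scale_def fun_eq_iff scale_right_distrib scale_left_distrib)

lemma commutator_in:
  "\<lbrakk>f \<in> morphism_algebra D; g \<in> morphism_algebra D\<rbrakk>
    \<Longrightarrow> morphism_mult D f g - morphism_mult D g f \<in> commutator_space D"
proof -
  interpret ms: vector_space "morphism_scale D" by (rule vector_space_morphism_scale)
  assume "f \<in> morphism_algebra D" "g \<in> morphism_algebra D"
  then show ?thesis unfolding commutator_space_def by (intro ms.span_base) blast
qed

end

text \<open>Adjoining \<open>a\<close> to a basis of \<open>C\<close> keeps it independent, so the
  values 0 on that basis and 1 at \<open>a\<close> extend linearly.\<close>

lemma (in vector_space) separating_functional:
  assumes "subspace C" "a \<notin> C"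
  obtains l where "Vector_Spaces.linear scale (*) l" "\<And>x. x \<in> C \<Longrightarrow> l x = 0" "l a = 1"
proof -
  obtain B where B: "B \<subseteq> C" "independent B" "C \<subseteq> span B"
    by (rule maximal_independent_subset)
  have span: "span B = C" using B assms(1) span_minimal by blast
  then have "independent (insert a B)"
    using B(2) assms(2) by (simp add: independent_insertI)
  interpret vector_space_pair scale "(*) :: 'a \<Rightarrow> 'a \<Rightarrow> 'a"
    by unfold_locales (auto simp: algebra_simps)
  from linear_independent_extend[OF \<open>independent (insert a B)\<close>, of "\<lambda>x. if x = a then 1 else 0"]
  obtain l where l: "Vector_Spaces.linear scale (*) l"
    "\<And>x. x \<in> insert a B \<Longrightarrow> l x = (if x = a then 1 else 0)" by blast
  have "l x = 0" if "x \<in> C" for x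
  proof (rule linear_eq_0_on_span[OF l(1)])
    show "x \<in> span B" using that span by simp
    show "l y = 0" if "y \<in> B" for y using that l(2)[of y] B(1) assms(2) by auto
  qed
  then show thesis using that l by simp
qed

text \<open>Each nonzero term contributes at least 1 to a sum that is finite in \<open>enat\<close>,
  so only finitely many terms are nonzero, and each single term is bounded by the sum.\<close>

lemma locally_bounded_finite:
  assumes "locally_bounded D" "X \<in> Obj D"
  shows "finite {Y \<in> Obj D. edim (Smult D) (Hom D X Y) + edim (Smult D) (Hom D Y X) \<noteq> 0}"
    and "Y \<in> Obj D \<Longrightarrow> finite_dim (Smult D) (Hom D X Y)"
proof -
  define d where "d = (\<lambda>Y. edim (Smult D) (Hom D X Y) + edim (Smult D) (Hom D Y X))"
  have lt: "infsum d (Obj D) < \<infinity>"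
    using assms unfolding locally_bounded_def d_def by blast
  have sum_le: "sum d F \<le> infsum d (Obj D)" if "finite F" "F \<subseteq> Obj D" for F
    using that by (subst nonneg_infsum_complete) (auto intro: SUP_upper)
  have "finite {Y \<in> Obj D. d Y \<noteq> 0}"
  proof (rule ccontr)
    assume inf: "infinite {Y \<in> Obj D. d Y \<noteq> 0}"
    obtain k where k: "infsum d (Obj D) = enat k" using lt by (cases "infsum d (Obj D)") auto
    obtain F where F: "finite F" "card F = Suc k" "F \<subseteq> {Y \<in> Obj D. d Y \<noteq> 0}"
      using infinite_arbitrarily_large[OF inf] by blast
    have "enat (Suc k) = (\<Sum>Y\<in>F. 1)" using F(2) by (simp add: of_nat_eq_enat)
    also have "\<dots> \<le> sum d F"
      using F(3) by (intro sum_mono) (auto simp: ileI1 one_eSuc)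
    also have "\<dots> \<le> enat k" using sum_le[OF F(1)] F(3) k by auto
    finally show False by simp
  qed
  then show "finite {Y \<in> Obj D. edim (Smult D) (Hom D X Y) + edim (Smult D) (Hom D Y X) \<noteq> 0}"
    by (simp add: d_def)
  show "finite_dim (Smult D) (Hom D X Y)" if "Y \<in> Obj D"
  proof -
    have "d Y \<le> infsum d (Obj D)" using sum_le[of "{Y}"] that by simp
    then have "d Y < \<infinity>" using lt by (rule le_less_trans)
    then show ?thesis by (auto simp: d_def edim_def split: if_splits)
  qed
qed

lemma (in linear_category) edim_zero:
  assumes "edim (Smult D) A = 0" "subspace A"
  shows "A = {0}"
proof -
  obtain B where B: "finite B" "A \<subseteq> span B" and d: "dim A = 0"
    using assms(1) by (auto simp: edim_def finite_dim_def zero_enat_def split: if_splits)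
  have "{0} \<subseteq> A" using subspace_0[OF assms(2)] by simp
  then show ?thesis
    using dim_psubset_finite[OF B subspace_single_0] d by auto
qed

theorem theorem3p9:
  fixes D :: "('k::{alg_closed_field, field_char_0}, 'o, 'h::ab_group_add) lincat"
    and a :: "'o \<Rightarrow> 'o \<Rightarrow> 'h"
  assumes "linear_category D"
    and "locally_bounded D"
    and "global_dimension D < \<infinity>"
    and "a \<in> morphism_algebra D"
    and "nilpotent_morphism D a"
  shows "a \<in> commutator_space D"
proof (rule ccontr)
  assume notin: "a \<notin> commutator_space D"
  interpret linear_category D by fact
  interpret ms: vector_space "morphism_scale D" by (rule vector_space_morphism_scale)
  have "ms.subspace (commutator_space D)"
    by (simp add: commutator_space_def ms.subspace_span)
  then obtain l where l: "Vector_Spaces.linear (morphism_scale D) (*) l"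
    and l0: "\<And>x. x \<in> commutator_space D \<Longrightarrow> l x = 0" and la: "l a = 1"
    using ms.separating_functional notin by blast
  interpret l: Vector_Spaces.linear "morphism_scale D" "(*)" l by (rule l)
  define \<theta> where "\<theta> X f = l (single X X f)" for X f
  have single_add: "single X Y (f + g) = single X Y f + single X Y g" for X Y f g
    by (auto simp: single_def fun_eq_iff)
  have comm: "l (morphism_mult D f g) = l (morphism_mult D g f)"
    if "f \<in> morphism_algebra D" "g \<in> morphism_algebra D" for f g
    using l0[OF commutator_in[OF that]] by (simp add: l.diff)
  interpret trace_spectroid D \<theta>
  proof unfold_locales
    fix X assume X: "X \<in> Obj D"
    show "finite_dim (Smult D) (Hom D X Y)" if "Y \<in> Obj D" for Y
      using locally_bounded_finite(2)[OF assms(2) X that] .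
    show "indecomposable D X" using assms(2) X by (simp add: locally_bounded_def)
    show "\<not> isomorphic_obj D X Y" if "Y \<in> Obj D" "X \<noteq> Y" for Y
      using assms(2) X that by (simp add: locally_bounded_def)
    show "\<theta> X (f + g) = \<theta> X f + \<theta> X g" for f g
      by (simp add: \<theta>_def single_add l.add)
    \<comment> \<open>Applied to two elementary matrices, the vanishing on commutators becomes
      cyclicity of \<open>\<theta>\<close>.\<close>
    show "\<theta> X (Comp D X Y X g f) = \<theta> Y (Comp D Y X Y f g)"
      if "Y \<in> Obj D" "f \<in> Hom D X Y" "g \<in> Hom D Y X" for Y f g
      using comm[OF single_in single_in, of Y X g X Y f] X that
      by (simp add: \<theta>_def morphism_mult_single)
    have "pd_S D X \<le> global_dimension D"
      unfolding global_dimension_def using X by (rule SUP_upper)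
    then show "pd_S D X < \<infinity>" using assms(3) by (rule le_less_trans)
    show "finite {Y \<in> Obj D. Hom D X Y \<noteq> {0}}"
    proof (rule finite_subset[OF _ locally_bounded_finite(1)[OF assms(2) X]])
      show "{Y \<in> Obj D. Hom D X Y \<noteq> {0}} \<subseteq>
          {Y \<in> Obj D. edim (Smult D) (Hom D X Y) + edim (Smult D) (Hom D Y X) \<noteq> 0}"
        using edim_zero subspace_Hom[OF X] by auto
    qed
  qed
  \<comment> \<open>\<open>A\<close> consists of the sources and targets of the nonzero components
    of \<open>a\<close>, of which there are finitely many.\<close>
  define A where "A = (\<Union>(X, Y) \<in> {(X, Y). a X Y \<noteq> 0}. {X, Y})"
  have a: "\<And>X Y. \<lbrakk>X \<in> Obj D; Y \<in> Obj D\<rbrakk> \<Longrightarrow> a X Y \<in> Hom D X Y"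
    "\<And>X Y. X \<notin> Obj D \<or> Y \<notin> Obj D \<Longrightarrow> a X Y = 0" "finite {(X, Y). a X Y \<noteq> 0}"
    using assms(4) unfolding morphism_algebra_def by blast+
  have A: "finite A" "A \<subseteq> Obj D"
    using a(2,3) by (auto simp: A_def)
  have mat: "matrix_on A a"
    using a(1) by (auto simp: matrix_on_def A_def)
  have "a = (\<Sum>X\<in>A. \<Sum>Y\<in>A. single X Y (a X Y))"
  proof (intro ext)
    fix X' Y'
    have "(\<Sum>X\<in>A. \<Sum>Y\<in>A. single X Y (a X Y)) X' Y' =
        (\<Sum>X\<in>A. \<Sum>Y\<in>A. if X = X' then if Y = Y' then a X Y else 0 else 0)"
      unfolding sum_fun_apply by (intro sum.cong refl) (auto simp: single_def)
    also have "\<dots> = (\<Sum>X\<in>A. if X = X' then \<Sum>Y\<in>A. if Y = Y' then a X Y else 0 else 0)"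
      by (intro sum.cong refl) auto
    also have "\<dots> = (if X' \<in> A \<and> Y' \<in> A then a X' Y' else 0)"
      using A(1) by simp
    also have "\<dots> = a X' Y'" using mat by (auto simp: matrix_on_def)
    finally show "a X' Y' = (\<Sum>X\<in>A. \<Sum>Y\<in>A. single X Y (a X Y)) X' Y'" by simp
  qed
  then have "l a = l (\<Sum>X\<in>A. \<Sum>Y\<in>A. single X Y (a X Y))" by simp
  also have "\<dots> = (\<Sum>X\<in>A. \<Sum>Y\<in>A. l (single X Y (a X Y)))"
    by (simp add: l.sum)
  also have "\<dots> = (\<Sum>X\<in>A. \<Sum>Y\<in>A. if Y = X then \<theta> X (a X X) else 0)"
  proof (intro sum.cong refl)
    fix X Y assume XY: "X \<in> A" "Y \<in> A"
    then have O: "X \<in> Obj D" "Y \<in> Obj D" using A by auto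
    show "l (single X Y (a X Y)) = (if Y = X then \<theta> X (a X X) else 0)"
    proof (cases "Y = X")
      case False
      \<comment> \<open>Multiplying by the identity of X on one side returns the component; on the
        other side the objects do not match and the product is 0.\<close>
      have "l (single X Y (a X Y)) =
          l (morphism_mult D (single X Y (a X Y)) (single X X (Idn D X)))"
        by (simp add: morphism_mult_single O Idn_in_Hom a(1) Comp_Idn_right)
      also have "\<dots> = l (morphism_mult D (single X X (Idn D X)) (single X Y (a X Y)))"
        by (intro comm single_in O a(1) Idn_in_Hom)
      also have "\<dots> = 0" by (simp add: morphism_mult_single_neq[OF False] l.zero)
      finally show ?thesis using False by simp
    qed (simp add: \<theta>_def)
  qed
  also have "\<dots> = (\<Sum>X\<in>A. \<theta> X (a X X))" using A(1) by simp
  also have "\<dots> = 0" by (rule trace_nilpotent_zero[OF A mat assms(5)])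
  finally show False using la by simp
qed

end
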